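(* Let $A(z)$ be an exponential polynomial of the normalized form $$A(z)=H_0(z)+H_1(z)e^{\zeta_1z^n}+\cdots+H_m(z)e^{\zeta_mz^n},\qquad m\ge 2,$$ where $n$ is a positive integer, the functions $H_j$ are either exponential polynomials of order $<n$ or ordinary polynomials in $z$, $H_j\not\equiv 0$ for $1\le j\le m$, and $\zeta_1,\dots,\zeta_m$ are pairwise distinct nonzero complex numbers. Denote $B(z)=A(z)-H_1(z)e^{\zeta_1z^n}$. Suppose that $h_A(\theta)>2h_B(\theta)$ whenever $h_B(\theta)>0$, and that $$C(\operatorname{co}(W_0^A))>2\,C(\operatorname{co}(W_0^B)),$$ where $W_0^A=\{0,\bar\zeta_1,\ldots,\bar\zeta_m\}$ and $W_0^B=\{0,\bar\zeta_2,\ldots,\bar\zeta_m\}$. Then $\lambda(f)\ge n$ for every nontrivial solution $f$ of $f''+A(z)f=0$.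
   Context: An exponential polynomial is an entire function of the form $P_1(z)e^{Q_1(z)}+\cdots+P_k(z)e^{Q_k(z)}$ with $P_j,Q_j$ polynomials. The Phragmén–Lindelöf indicator of an entire function $g$ of order $\rho>0$ is $h_g(\theta)=\limsup_{r\to\infty}r^{-\rho}\log|g(re^{i\theta})|$ (here $A$ and $B$ both have order $n$). $\operatorname{co}(W)$ is the convex hull of a finite set $W\subset\mathbb{C}$, and $C(\operatorname{co}(W))$ is its circumference (perimeter), where the circumference of a line segment is twice its length. $\lambda(f)$ is the exponent of convergence of the zeros of $f$. *)

theory Defs
  imports "HOL-Complex_Analysis.Complex_Analysis" "HOL-Computational_Algebra.Polynomial"
begin

definition exponential_polynomial :: "(complex \<Rightarrow> complex) \<Rightarrow> bool" where
  "exponential_polynomial g \<longleftrightarrow>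
     (\<exists>(k::nat) (P :: nat \<Rightarrow> complex poly) (Q :: nat \<Rightarrow> complex poly).
        \<forall>z. g z = (\<Sum>j<k. poly (P j) z * exp (poly (Q j) z)))"

definition max_modulus :: "(complex \<Rightarrow> complex) \<Rightarrow> real \<Rightarrow> real" where
  "max_modulus g r = (SUP z\<in>sphere 0 r. norm (g z))"

definition ln_plus :: "real \<Rightarrow> real" where
  "ln_plus x = ln (max 1 x)"

text \<open>
  Order of growth of an entire function, limsup of log log M(r,g) / log r. Positive parts of
  the logarithms make it 0, as usual, for bounded (in particular zero) functions.
\<close>
definition growth_order :: "(complex \<Rightarrow> complex) \<Rightarrow> ereal" where
  "growth_order g =
     Limsup at_top (\<lambda>r::real. ereal (ln_plus (ln_plus (max_modulus g r)) / ln r))"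

text \<open>Logarithm of a nonnegative real with log 0 = -infinity; in the library ln 0 = 0.\<close>
definition ext_ln :: "real \<Rightarrow> ereal" where
  "ext_ln x = (if x = 0 then - \<infinity> else ereal (ln x))"

text \<open>
  The normalising exponent is the order of the function itself; the notion is meant for
  functions of finite positive order.
\<close>
definition pl_indicator :: "(complex \<Rightarrow> complex) \<Rightarrow> real \<Rightarrow> ereal" where
  "pl_indicator g \<theta> =
     Limsup at_top (\<lambda>r::real.
       ereal (r powr (- real_of_ereal (growth_order g))) * ext_ln (norm (g (of_real r * cis \<theta>))))"

text \<open>
  Perimeter of a polytope in the plane: the sum of its edge lengths if it is two-dimensional,
  and twice the length of a line segment (0 for a point). Each edge is a segment, whose length
  is its diameter.
\<close>
definition circumference :: "complex set \<Rightarrow> real" where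
  "circumference S =
     (if aff_dim S = 2 then (\<Sum>e | e edge_of S. diameter e) else 2 * diameter S)"

text \<open>
  Exponent of convergence of the zeros of an entire function that does not vanish identically:
  zeros other than the origin are counted with multiplicity. The infimum of the empty set is
  infinity.
\<close>
definition zero_exponent :: "(complex \<Rightarrow> complex) \<Rightarrow> ereal" where
  "zero_exponent f =
     Inf {ereal \<tau> | \<tau>. \<tau> > 0 \<and>
       (\<lambda>z. of_int (zorder f z) * norm z powr (- \<tau>)) summable_on {z. z \<noteq> 0 \<and> f z = 0}}"

end

theory Submission
  imports Defs
begin

text \<open>The indicator condition is very restrictive: for every \<open>j \<ge> 2\<close> the half-plane
  \<open>Re (\<zeta>\<^sub>j w) > 0\<close> must lie in \<open>Re (\<zeta>\<^sub>1 w) > 0\<close>, hence \<open>\<zeta>\<^sub>j = c\<^sub>j \<zeta>\<^sub>1\<close> with \<open>0 < c\<^sub>j < 1/2\<close>. Put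
  \<open>h = H\<^sub>1 exp (\<zeta>\<^sub>1 z\<^sup>n)\<close>, \<open>A = B + h\<close>, and suppose that the zeros of a solution \<open>f\<close> have exponent of
  convergence less than \<open>n\<close>. On a zero-free disc \<open>f'/f\<close> is bounded by about \<open>sqrt \<bar>A\<bar>\<close>, so by
  Cauchy estimates the function \<open>D = 2 v' - (h'/h) v\<close> with \<open>v = f'/f + h'/(4 h)\<close> is at most
  \<open>exp (o(r\<^sup>n))\<close> and exponentially small where \<open>h\<close> is large; this uses \<open>c\<^sub>j < 1/2\<close>. After
  multiplication by a polynomial with the zeros of \<open>f\<close> and by powers of \<open>H\<^sub>1\<close>, the maximum principle
  applied to a product of rotations forces \<open>D = 0\<close>. Then \<open>B\<close>, up to a term of minimal type
  coming from \<open>h'/h\<close>, is a constant multiple of \<open>h\<close>, which contradicts the linear independence of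
  exponentials because \<open>B\<close> contains the term with \<open>\<zeta>\<^sub>2\<close>.\<close>

section \<open>Log-derivatives of zero-free solutions\<close>

text \<open>The obstacle is that the defect has poles at the zeros of \<open>f\<close> and of
  \<open>H\<^sub>1\<close>, and near them no useful pointwise bound exists. Let \<open>Y\<close> be
  the positive part of \<open>Re (\<zeta>\<^sub>1 z^n)\<close> and \<open>\<gamma>\<close> the
  largest \<open>c\<^sub>j\<close>. Up to factors \<open>exp (o(r^n))\<close>,
  \<open>sqrt \<bar>A\<bar>\<close> is at most \<open>E = exp (Y / 2)\<close> and
  \<open>\<bar>B\<bar>\<close> is at most \<open>b = exp (\<gamma> Y)\<close>. The defect satisfies
  a linear first order equation which, away from the poles, bounds it by
  \<open>b / E = exp (- (1/2 - \<gamma>) Y)\<close>; this is where the value \<open>1/2\<close> is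
  decisive. Near a pole only a fixed power of \<open>E\<close> is lost, so a power \<open>K\<close>
  of \<open>H\<^sub>1\<close> and of the polynomial with the zeros of \<open>f\<close> repairs the
  bound, with \<open>K\<close> independent of \<open>r\<close>. That polynomial has
  \<open>O(r^\<tau>)\<close> factors with \<open>\<tau> < n\<close>, so its fixed powers are still
  \<open>exp (o(r^n))\<close>. Circles through a zero are avoided, not estimated: if all large
  circles met a zero, a bounded annulus would contain infinitely many of them.\<close>

lemma taylor_remainder2_le:
  assumes f: "f holomorphic_on ball a \<rho>" and "s < \<rho>"
    and M: "\<And>z. z \<in> cball a s \<Longrightarrow> norm (deriv (deriv f) z) \<le> M"
    and z: "z \<in> cball a s"
  shows "norm (f z - f a - deriv f a * (z - a)) \<le> M * (norm (z - a))\<^sup>2"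
proof -
  have sub: "cball a (norm (z - a)) \<subseteq> ball a \<rho>" "cball a (norm (z - a)) \<subseteq> cball a s"
    using z \<open>s < \<rho>\<close> by (auto simp: dist_norm norm_minus_commute)
  have 1: "norm (deriv f y - deriv f a) \<le> M * norm (z - a)" if y: "y \<in> cball a (norm (z - a))" for y
  proof -
    have "norm (deriv f y - deriv f a) \<le> M * norm (y - a)"
    proof (rule field_differentiable_bound[OF convex_cball])
      fix x assume x: "x \<in> cball a (norm (z - a))"
      show "(deriv f has_field_derivative deriv (deriv f) x) (at x within cball a (norm (z - a)))"
        using holomorphic_derivI[OF holomorphic_deriv[OF f open_ball] open_ball, of x] x sub
        by (auto intro: has_field_derivative_at_within)
      show "norm (deriv (deriv f) x) \<le> M" using M x sub by blast
    qed (use y in auto)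
    also have "\<dots> \<le> M * norm (z - a)"
    proof (intro mult_left_mono)
      have "a \<in> cball a s" using z by (auto intro: order_trans[OF zero_le_dist])
      then show "0 \<le> M" using M[of a] norm_ge_zero[of "deriv (deriv f) a"] by linarith
    qed (use y in \<open>auto simp: dist_norm norm_minus_commute\<close>)
    finally show ?thesis .
  qed
  have "norm ((f z - deriv f a * z) - (f a - deriv f a * a)) \<le> M * norm (z - a) * norm (z - a)"
  proof (rule field_differentiable_bound[OF convex_cball])
    fix x assume x: "x \<in> cball a (norm (z - a))"
    show "((\<lambda>x. f x - deriv f a * x) has_field_derivative deriv f x - deriv f a)
        (at x within cball a (norm (z - a)))"
    proof -
      have "(f has_field_derivative deriv f x) (at x)"
        using holomorphic_derivI[OF f open_ball, of x] x sub by blast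
      then show ?thesis
        by (intro has_field_derivative_at_within[OF DERIV_diff] DERIV_cmult_Id)
    qed
    show "norm (deriv f x - deriv f a) \<le> M * norm (z - a)" by (rule 1[OF x])
  qed (auto simp: dist_norm norm_minus_commute)
  then show ?thesis by (simp add: algebra_simps power2_eq_square)
qed

lemma norm_deriv_le_ball:
  assumes g: "g holomorphic_on ball z s" and "0 < s"
    and M: "\<And>y. y \<in> ball z s \<Longrightarrow> norm (g y) \<le> M"
  shows "norm (deriv g z) \<le> M / s"
proof -
  \<comment> \<open>The bound on \<open>g\<close> is given on the open ball only, so Cauchy's
    inequality is used at radii \<open>t < s\<close>, and \<open>t\<close> then tends to
    \<open>s\<close>.\<close>
  have "norm (deriv g z) * t \<le> M" if t: "0 < t" "t < s" for t
  proof -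
    have "norm ((deriv ^^ 1) g z) \<le> fact 1 * M / t ^ 1"
    proof (rule Cauchy_inequality)
      show "g holomorphic_on ball z t" using g t by (auto intro: holomorphic_on_subset)
      show "continuous_on (cball z t) g"
        using t by (auto intro!: holomorphic_on_imp_continuous_on holomorphic_on_subset[OF g])
      show "norm (g x) \<le> M" if "norm (z - x) = t" for x using that t by (intro M) (auto simp: dist_norm)
    qed fact
    then show ?thesis using t by (simp add: field_simps)
  qed
  then have ev: "\<forall>\<^sub>F t in at_left s. norm (deriv g z) * t \<le> M"
    using \<open>0 < s\<close> unfolding eventually_at_left_field by blast
  have "((\<lambda>t. norm (deriv g z) * t) \<longlongrightarrow> norm (deriv g z) * s) (at_left s)"
    by (intro tendsto_intros)
  then have "norm (deriv g z) * s \<le> M"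
    by (rule tendsto_upperbound[OF _ ev]) simp
  then show ?thesis using \<open>0 < s\<close> by (simp add: field_simps)
qed

lemma norm_deriv_le_ball_sub:
  assumes "g holomorphic_on ball z s" and "\<And>y. y \<in> ball z s \<Longrightarrow> norm (g y) \<le> M"
    and "y \<in> ball z t" "t < s"
  shows "norm (deriv g y) \<le> M / (s - t)"
proof (rule norm_deriv_le_ball)
  have sub: "ball y (s - t) \<subseteq> ball z s"
  proof
    fix x assume "x \<in> ball y (s - t)"
    then show "x \<in> ball z s" using assms(3) dist_triangle[of z x y] by simp
  qed
  show "g holomorphic_on ball y (s - t)" using assms(1) sub by (rule holomorphic_on_subset)
  show "norm (g x) \<le> M" if "x \<in> ball y (s - t)" for x by (rule assms(2)[OF subsetD[OF sub that]])
qed (use assms(4) in simp)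

text \<open>If the Newton step \<open>-f/f'\<close> at \<open>z\<close> were small compared to the disc, the minimum principle
  would produce a zero of \<open>f\<close> near its endpoint.\<close>
lemma log_deriv_bound:
  fixes A f :: "complex \<Rightarrow> complex"
  assumes f: "f holomorphic_on ball z d" and d: "0 < d" "d \<le> 1"
    and ode: "\<And>y. y \<in> ball z d \<Longrightarrow> deriv (deriv f) y + A y * f y = 0"
    and nz: "\<And>y. y \<in> ball z d \<Longrightarrow> f y \<noteq> 0"
    and A: "\<And>y. y \<in> ball z d \<Longrightarrow> norm (A y) \<le> M\<^sup>2" and M: "M \<ge> 1"
  shows "norm (deriv f z / f z) \<le> 12 * M / d"
proof -
  have main: "norm (deriv f z / f z) * s < 6" if s: "0 < s" "s < d" "M\<^sup>2 * s\<^sup>2 \<le> 1 / 4" for s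
  proof (rule ccontr)
    define p where "p = deriv f z"
    define K where "K = norm (p / f z) * s"
    assume "\<not> ?thesis"
    then have K: "K \<ge> 6" by (simp add: K_def p_def)
    have fz: "f z \<noteq> 0" using nz d by auto
    have sub: "cball z s \<subseteq> ball z d" using s by auto
    have contf: "continuous_on (cball z s) (\<lambda>y. norm (f y))"
      by (intro continuous_on_norm holomorphic_on_imp_continuous_on holomorphic_on_subset[OF f] sub)
    obtain y0 where y0: "y0 \<in> cball z s" "\<And>y. y \<in> cball z s \<Longrightarrow> norm (f y) \<le> norm (f y0)"
      using continuous_attains_sup[OF compact_cball _ contf] s by auto
    define m where "m = norm (f y0)"
    have taylor: "norm (f y - f z - p * (y - z)) \<le> (M\<^sup>2 * m) * (norm (y - z))\<^sup>2" if "y \<in> cball z s" for y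
      unfolding p_def
    proof (rule taylor_remainder2_le[OF f s(2) _ that])
      fix x assume x: "x \<in> cball z s"
      have "deriv (deriv f) x = - (A x * f x)" using ode[of x] x sub by (metis eq_neg_iff_add_eq_0 subsetD)
      then show "norm (deriv (deriv f) x) \<le> M\<^sup>2 * m"
        using A[of x] y0(2)[OF x] x sub by (auto simp: norm_mult m_def intro!: mult_mono)
    qed
    define F where "F = norm (f z)"
    have F: "F > 0" using fz by (simp add: F_def)
    have pF: "norm p * s = K * F" using F by (simp add: K_def F_def norm_divide field_simps)
    have m0: "m \<ge> 0" by (simp add: m_def)
    \<comment> \<open>The remainder contains the unknown maximum \<open>m\<close> itself, because
      \<open>f'' = - A f\<close>; the restriction \<open>M^2 s^2 \<le> 1/4\<close> leaves only a
      quarter of it, which can be moved to the left.\<close>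
    have "m \<le> F + norm p * s + m / 4"
    proof -
      have "m \<le> norm (f y0 - f z - p * (y0 - z)) + (norm (f z) + norm (p * (y0 - z)))"
        unfolding m_def
        using norm_triangle_ineq[of "f y0 - f z - p * (y0 - z)" "f z + p * (y0 - z)"]
          norm_triangle_ineq[of "f z" "p * (y0 - z)"] by simp
      moreover have "norm (y0 - z) \<le> s" using y0(1) by (simp add: dist_norm norm_minus_commute)
      then have "norm (p * (y0 - z)) \<le> norm p * s" "(norm (y0 - z))\<^sup>2 \<le> s\<^sup>2"
        by (auto simp: norm_mult intro!: mult_left_mono power_mono)
      moreover have "(M\<^sup>2 * m) * (norm (y0 - z))\<^sup>2 \<le> (M\<^sup>2 * m) * s\<^sup>2"
        using \<open>(norm (y0 - z))\<^sup>2 \<le> s\<^sup>2\<close> m0 by (intro mult_left_mono) auto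
      moreover have "(M\<^sup>2 * m) * s\<^sup>2 \<le> m / 4"
        using mult_right_mono[OF s(3) m0] by (simp add: algebra_simps)
      ultimately show ?thesis using taylor[OF y0(1)] unfolding F_def by linarith
    qed
    then have mK: "m \<le> 4 / 3 * (1 + K) * F" unfolding pF by (simp add: algebra_simps)
    define \<sigma> where "\<sigma> = s / K"
    have \<sigma>: "0 < \<sigma>" "2 * \<sigma> \<le> s" using s K by (auto simp: \<sigma>_def field_simps)
    have p0: "p \<noteq> 0" using K K_def by auto
    \<comment> \<open>Endpoint of the Newton step, where the linear part \<open>p (y - t)\<close> of
      \<open>f\<close> vanishes. Its distance from \<open>z\<close> is
      \<open>\<sigma> = s / K\<close>, so for \<open>K \<ge> 6\<close> the circle of radius
      \<open>\<sigma>\<close> about it stays inside the disc.\<close>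
    define t where "t = z - f z / p"
    have tz: "norm (t - z) = \<sigma>"
      using p0 F s K unfolding t_def \<sigma>_def K_def F_def by (simp add: norm_divide field_simps)
    have lin: "f z + p * (y - z) = p * (y - t)" for y
      using p0 by (simp add: t_def field_simps)
    have near: "norm (f y - p * (y - t)) \<le> (M\<^sup>2 * m) * (norm (y - z))\<^sup>2" if "y \<in> cball z s" for y
      using taylor[OF that] lin[of y] by (simp add: diff_diff_eq)
    have MsK: "(M\<^sup>2 * m) * \<sigma>\<^sup>2 \<le> F / 10"
    proof -
      have "(M\<^sup>2 * m) * \<sigma>\<^sup>2 = (M\<^sup>2 * s\<^sup>2) * m / K\<^sup>2"
        by (simp add: \<sigma>_def power_divide)
      also have "\<dots> \<le> (1 / 4) * m / K\<^sup>2"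
        using s(3) m0 by (intro divide_right_mono mult_right_mono) auto
      also have "\<dots> \<le> (1 / 4) * (4 / 3 * (1 + K) * F) / K\<^sup>2"
        using mK by (intro divide_right_mono mult_left_mono) auto
      also have "\<dots> = F * ((1 + K) / (3 * K\<^sup>2))" using K by (simp add: frac_eq_eq)
      also have "(1 + K) / (3 * K\<^sup>2) \<le> 1 / 10"
      proof -
        have "6 * K \<le> K\<^sup>2" using K by (simp add: power2_eq_square)
        then have "10 * (1 + K) \<le> 3 * K\<^sup>2" using K by argo
        then show ?thesis using K by (simp add: field_simps)
      qed
      finally show ?thesis using F by simp
    qed
    have sub2: "cball t \<sigma> \<subseteq> cball z s"
    proof
      fix x assume "x \<in> cball t \<sigma>"
      then have "norm (x - t) \<le> \<sigma>" by (simp add: dist_norm norm_minus_commute)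
      then have "norm (x - z) \<le> 2 * \<sigma>"
        using norm_triangle_ineq[of "x - t" "t - z"] tz by simp
      then show "x \<in> cball z s" using \<sigma>(2) by (simp add: dist_norm norm_minus_commute)
    qed
    have tc: "t \<in> cball z s" using sub2 \<sigma> by (meson centre_in_cball less_imp_le subsetD)
    \<comment> \<open>On this circle the linear part has modulus exactly \<open>F\<close>, and the
      remainder at distance at most \<open>2 \<sigma>\<close> from \<open>z\<close> is at most four
      times \<open>F / 10\<close>. The value at the centre is at most \<open>F / 10\<close>, too
      small for the minimum principle.\<close>
    have low: "norm (f y) \<ge> F / 2" if y: "norm (y - t) = \<sigma>" for y
    proof -
      have yc: "y \<in> cball z s" using sub2 y by (auto simp: dist_norm norm_minus_commute)
      have "norm (y - z) \<le> 2 * \<sigma>"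
        using norm_triangle_ineq[of "y - t" "t - z"] tz y by simp
      then have "(norm (y - z))\<^sup>2 \<le> (2 * \<sigma>)\<^sup>2" by (intro power_mono) auto
      then have "(M\<^sup>2 * m) * (norm (y - z))\<^sup>2 \<le> (M\<^sup>2 * m) * (2 * \<sigma>)\<^sup>2"
        using m0 by (intro mult_left_mono) auto
      also have "\<dots> = 4 * ((M\<^sup>2 * m) * \<sigma>\<^sup>2)" by (simp add: power2_eq_square)
      finally have "norm (f y - p * (y - t)) \<le> 4 * (F / 10)" using near[OF yc] MsK by linarith
      moreover have "norm (p * (y - t)) = F"
      proof -
        have "norm (p * (y - t)) = norm p * s / K" using y by (simp add: norm_mult \<sigma>_def)
        then show ?thesis using pF K by simp
      qed
      ultimately show ?thesis
        using norm_triangle_ineq2[of "p * (y - t)" "f y"] F by (simp add: norm_minus_commute)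
    qed
    have "norm (1 / f t) \<le> 2 / F"
    proof (rule maximum_modulus_frontier[of "\<lambda>y. 1 / f y" "cball t \<sigma>"])
      have nzt: "f y \<noteq> 0" if "y \<in> cball t \<sigma>" for y using that sub sub2 nz by blast
      have holt: "(\<lambda>y. 1 / f y) holomorphic_on cball t \<sigma>"
        using sub sub2 nzt by (intro holomorphic_intros holomorphic_on_subset[OF f]) auto
      show "(\<lambda>y. 1 / f y) holomorphic_on interior (cball t \<sigma>)"
        using holt by (rule holomorphic_on_subset) auto
      show "continuous_on (closure (cball t \<sigma>)) (\<lambda>y. 1 / f y)"
        using holt by (simp add: holomorphic_on_imp_continuous_on)
      show "norm (1 / f y) \<le> 2 / F" if "y \<in> frontier (cball t \<sigma>)" for y
      proof -
        have "norm (f y) \<ge> F / 2" using low[of y] that \<sigma> by (auto simp: dist_norm norm_minus_commute)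
        moreover from this have "norm (f y) > 0" using F by linarith
        ultimately show ?thesis using F by (simp add: norm_divide field_simps)
      qed
    qed (use \<sigma> in auto)
    moreover have "norm (f t) \<le> F / 10"
      using near[OF tc] tz MsK by simp
    moreover have "f t \<noteq> 0" using sub tc by (intro nz) blast
    ultimately show False using F by (auto simp: norm_divide field_simps)
  qed
  \<comment> \<open>\<open>1 / (2 M)\<close> is the largest radius allowed by
    \<open>M^2 s^2 \<le> 1/4\<close>; the factor \<open>d \<le> 1\<close> keeps it inside the disc,
    and \<open>6 / s = 12 M / d\<close>.\<close>
  define s where "s = d / (2 * M)"
  have s: "0 < s" "s < d" using d M by (auto simp: s_def field_simps)
  have "M\<^sup>2 * s\<^sup>2 = d\<^sup>2 / 4" using M by (simp add: s_def power_divide field_simps)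
  also have "\<dots> \<le> 1 / 4" using d by (simp add: power_le_one)
  finally have "norm (deriv f z / f z) * s < 6" using s by (intro main) auto
  then show ?thesis using d M by (simp add: s_def field_simps)
qed

section \<open>Functions of minimal type\<close>

text \<open>Maximum principle for the product of the \<open>N\<close> rotations of \<open>Z\<close> about \<open>c\<close>: a bound on an arc thus
  reaches the centre without any integration of \<open>ln \<bar>Z\<bar>\<close>.\<close>
lemma rotation_bound:
  assumes Z: "Z holomorphic_on U" "cball c r \<subseteq> U" and r: "0 < r" 
    and S: "\<And>\<theta>::real. (\<Prod>j<N. norm (Z (c + of_real r * cis (\<theta> + 2 * pi * real j / real N)))) \<le> S"
  shows "norm (Z c) ^ N \<le> S"
proof -
  define W where "W = (\<lambda>x. \<Prod>j<N. Z (c + cis (2 * pi * real j / real N) * x))"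
  have sub: "(\<lambda>x. c + cis t * x) ` cball 0 r \<subseteq> U" for t
    using Z(2) by (auto simp: dist_norm norm_mult subset_iff)
  have hol: "W holomorphic_on cball 0 r"
    unfolding W_def
    by (intro holomorphic_intros holomorphic_on_compose_gen[OF _ Z(1) sub, unfolded o_def])
  have "norm (W 0) \<le> S"
  proof (rule maximum_modulus_frontier[of W "cball 0 r"])
    show "W holomorphic_on interior (cball 0 r)" using hol by (rule holomorphic_on_subset) auto
    show "continuous_on (closure (cball 0 r)) W" using hol by (simp add: holomorphic_on_imp_continuous_on)
    show "norm (W z) \<le> S" if "z \<in> frontier (cball 0 r)" for z
    proof -
      have "z = of_real r * cis (Arg z)" using that rcis_cmod_Arg[of z] by (simp add: rcis_def)
      then have "norm (W z) = (\<Prod>j<N. norm (Z (c + of_real r * cis (Arg z + 2 * pi * real j / real N))))"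
        unfolding W_def prod_norm[symmetric]
        by (intro prod.cong refl) (metis (no_types, lifting) add.commute cis_mult mult.commute mult.left_commute)
      then show ?thesis using S by simp
    qed
  qed (use r in auto)
  then show ?thesis by (simp add: W_def norm_power)
qed

text \<open>Successive rotations differ by \<open>2 \<pi> / N\<close>, less than the length of the
  arc, so from every starting angle at least one of the \<open>N\<close> points falls into the arc;
  the other factors get the global bound.\<close>

lemma arc_bound:
  assumes Z: "Z holomorphic_on U" "cball c r \<subseteq> U" and r: "0 < r"
    and N: "real N * (\<beta> - \<alpha>) > 2 * pi"
    and M: "\<And>\<theta>. norm (Z (c + of_real r * cis \<theta>)) \<le> M"
    and m: "\<And>\<theta>. \<alpha> < \<theta> \<Longrightarrow> \<theta> < \<beta> \<Longrightarrow> norm (Z (c + of_real r * cis \<theta>)) \<le> m"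
  shows "norm (Z c) ^ N \<le> M ^ (N - 1) * m"
proof (rule rotation_bound[OF Z r])
  fix \<theta> :: real
  let ?z = "\<lambda>t. norm (Z (c + of_real r * cis t))"
  have N0: "N > 0" using N pi_gt_zero by (cases N) auto
  \<comment> \<open>The least integer whose rotation carries \<open>\<theta>\<close> beyond
    \<open>\<alpha>\<close>. It may be negative or exceed \<open>N\<close>, hence the reduction
    modulo \<open>N\<close> below.\<close>
  define k where "k = \<lfloor>(\<alpha> - \<theta>) * N / (2 * pi)\<rfloor> + 1"
  define \<phi> where "\<phi> = \<theta> + 2 * pi * of_int k / N"
  have "of_int k > (\<alpha> - \<theta>) * N / (2 * pi)" "of_int k \<le> (\<alpha> - \<theta>) * N / (2 * pi) + 1"
    unfolding k_def by linarith+
  then have "of_int k * (2 * pi) > (\<alpha> - \<theta>) * N" "of_int k * (2 * pi) \<le> (\<alpha> - \<theta>) * N + 2 * pi"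
    by (auto simp: field_simps)
  then have "2 * pi * of_int k / N > \<alpha> - \<theta>" "2 * pi * of_int k / N < \<beta> - \<theta>"
    using N N0 by (auto simp: field_simps)
  then have \<phi>: "\<alpha> < \<phi>" "\<phi> < \<beta>" by (auto simp: \<phi>_def)
  define i where "i = nat (k mod int N)"
  have i: "i < N" "int i = k mod int N" using N0 by (auto simp: i_def nat_less_iff)
  obtain l where l: "k = int i + int N * l" using i by (metis mod_mult_div_eq)
  have "\<phi> = \<theta> + 2 * pi * i / N + 2 * pi * of_int l"
    unfolding \<phi>_def l using N0 by (simp add: field_simps)
  then have cis: "cis \<phi> = cis (\<theta> + 2 * pi * i / N)"
    by (metis cis_mult cis_multiple_2pi Ints_of_int mult.right_neutral)
  have "(\<Prod>j<N. ?z (\<theta> + 2 * pi * real j / real N)) =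
      (\<Prod>j\<in>{..<N} - {i}. ?z (\<theta> + 2 * pi * real j / real N)) * ?z (\<theta> + 2 * pi * i / N)"
    using i by (subst prod.remove[of _ i]) (auto simp: mult.commute)
  also have "\<dots> \<le> (\<Prod>j\<in>{..<N} - {i}. M) * m"
    using m[OF \<phi>] M[of 0] cis
    by (intro mult_mono prod_mono prod_nonneg conjI M) (auto intro: order_trans[OF norm_ge_zero])
  also have "(\<Prod>j\<in>{..<N} - {i}. M) = M ^ (N - 1)" using i by simp
  finally show "(\<Prod>j<N. ?z (\<theta> + 2 * pi * real j / real N)) \<le> M ^ (N - 1) * m" .
qed

definition minimal_type :: "nat \<Rightarrow> (complex \<Rightarrow> complex) \<Rightarrow> bool" where
  "minimal_type n g \<longleftrightarrow> g holomorphic_on UNIV \<and>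
     (\<forall>\<epsilon>>0. \<exists>C. \<forall>z. norm (g z) \<le> C * exp (\<epsilon> * norm z ^ n))"

lemma minimal_typeD:
  assumes "minimal_type n g" "\<epsilon> > 0"
  shows "\<exists>C\<ge>0. \<forall>z. norm (g z) \<le> C * exp (\<epsilon> * norm z ^ n)"
proof -
  obtain C where C: "\<And>z. norm (g z) \<le> C * exp (\<epsilon> * norm z ^ n)"
    using assms unfolding minimal_type_def by blast
  have "0 \<le> C * exp (\<epsilon> * norm (0::complex) ^ n)" using C[of 0] norm_ge_zero order_trans by blast
  then have "C \<ge> 0" by (simp add: zero_le_mult_iff)
  then show ?thesis using C by blast
qed

lemma minimal_type_holomorphic: "minimal_type n g \<Longrightarrow> g holomorphic_on S"
  unfolding minimal_type_def using holomorphic_on_subset by blast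

lemma minimal_type_const: "minimal_type n (\<lambda>z. a)"
  unfolding minimal_type_def
proof (intro conjI allI impI exI)
  fix \<epsilon> :: real and z :: complex
  assume "\<epsilon> > 0"
  then show "norm a \<le> norm a * exp (\<epsilon> * norm z ^ n)"
    using mult_left_mono[of 1 "exp (\<epsilon> * norm z ^ n)" "norm a"] by simp
qed simp

lemma minimal_type_ident:
  assumes "n > 0" shows "minimal_type n (\<lambda>z. z)"
  unfolding minimal_type_def
proof (intro conjI allI impI exI)
  fix \<epsilon> :: real and z :: complex
  assume e: "\<epsilon> > 0"
  have "norm z \<le> 1 + norm z ^ n"
  proof (cases "norm z \<le> 1")
    case True
    then show ?thesis by (smt (verit) norm_ge_zero zero_le_power)
  next
    case False
    then show ?thesis using power_increasing[of 1 n "norm z"] assms by simp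
  qed
  also have "\<dots> \<le> exp (\<epsilon> * norm z ^ n) + (1 / \<epsilon>) * exp (\<epsilon> * norm z ^ n)"
  proof (rule add_mono)
    have "\<epsilon> * norm z ^ n \<le> exp (\<epsilon> * norm z ^ n)"
      using exp_ge_add_one_self[of "\<epsilon> * norm z ^ n"] by linarith
    then show "norm z ^ n \<le> 1 / \<epsilon> * exp (\<epsilon> * norm z ^ n)" using e by (simp add: field_simps)
  qed (use e in simp)
  finally show "norm z \<le> (1 + 1 / \<epsilon>) * exp (\<epsilon> * norm z ^ n)" by (simp add: algebra_simps)
qed simp

lemma minimal_type_add:
  assumes "minimal_type n g" "minimal_type n h" shows "minimal_type n (\<lambda>z. g z + h z)"
  unfolding minimal_type_def
proof (intro conjI allI impI)
  show "(\<lambda>z. g z + h z) holomorphic_on UNIV"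
    using assms by (intro holomorphic_intros) (auto simp: minimal_type_holomorphic)
  fix \<epsilon> :: real assume e: "\<epsilon> > 0"
  obtain C where C: "\<And>z. norm (g z) \<le> C * exp (\<epsilon> * norm z ^ n)" using minimal_typeD[OF assms(1) e] by blast
  obtain D where D: "\<And>z. norm (h z) \<le> D * exp (\<epsilon> * norm z ^ n)" using minimal_typeD[OF assms(2) e] by blast
  have "norm (g z + h z) \<le> (C + D) * exp (\<epsilon> * norm z ^ n)" for z
    using norm_triangle_ineq[of "g z" "h z"] C[of z] D[of z] by (simp add: algebra_simps)
  then show "\<exists>C. \<forall>z. norm (g z + h z) \<le> C * exp (\<epsilon> * norm z ^ n)" by blast
qed

lemma minimal_type_mult:
  assumes "minimal_type n g" "minimal_type n h" shows "minimal_type n (\<lambda>z. g z * h z)"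
  unfolding minimal_type_def
proof (intro conjI allI impI)
  show "(\<lambda>z. g z * h z) holomorphic_on UNIV"
    using assms by (intro holomorphic_intros) (auto simp: minimal_type_holomorphic)
  fix \<epsilon> :: real assume "\<epsilon> > 0"
  then have e: "\<epsilon> / 2 > 0" by simp
  obtain C where C: "C \<ge> 0" "\<And>z. norm (g z) \<le> C * exp (\<epsilon> / 2 * norm z ^ n)" using minimal_typeD[OF assms(1) e] by blast
  obtain D where D: "\<And>z. norm (h z) \<le> D * exp (\<epsilon> / 2 * norm z ^ n)" using minimal_typeD[OF assms(2) e] by blast
  have "norm (g z * h z) \<le> (C * D) * exp (\<epsilon> * norm z ^ n)" for z
  proof -
    have "norm (g z * h z) \<le> (C * exp (\<epsilon> / 2 * norm z ^ n)) * (D * exp (\<epsilon> / 2 * norm z ^ n))"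
      unfolding norm_mult using C by (intro mult_mono C D) auto
    also have "\<dots> = (C * D) * (exp (\<epsilon> / 2 * norm z ^ n) * exp (\<epsilon> / 2 * norm z ^ n))" by simp
    also have "exp (\<epsilon> / 2 * norm z ^ n) * exp (\<epsilon> / 2 * norm z ^ n) = exp (\<epsilon> * norm z ^ n)"
      by (simp flip: exp_add)
    finally show ?thesis .
  qed
  then show "\<exists>C. \<forall>z. norm (g z * h z) \<le> C * exp (\<epsilon> * norm z ^ n)" by blast
qed

lemma minimal_type_uminus: "minimal_type n g \<Longrightarrow> minimal_type n (\<lambda>z. - g z)"
  using minimal_type_mult[OF minimal_type_const[of n "-1"], of g] by simp

lemma minimal_type_diff:
  "minimal_type n g \<Longrightarrow> minimal_type n h \<Longrightarrow> minimal_type n (\<lambda>z. g z - h z)"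
  using minimal_type_add[of n g "\<lambda>z. - h z"] minimal_type_uminus by simp

lemma minimal_type_power: "minimal_type n g \<Longrightarrow> minimal_type n (\<lambda>z. g z ^ k)"
  by (induction k) (auto intro: minimal_type_const minimal_type_mult)

lemma minimal_type_poly:
  assumes "n > 0" shows "minimal_type n (poly p)"
proof (induction p)
  case (pCons a p)
  have "minimal_type n (\<lambda>z. a + z * poly p z)"
    by (intro minimal_type_add minimal_type_mult minimal_type_const minimal_type_ident assms pCons)
  then show ?case by (simp add: fun_eq_iff)
qed (use minimal_type_const[of n 0] in \<open>simp add: fun_eq_iff\<close>)

lemma power_add_one_le: "0 \<le> x \<Longrightarrow> (x + 1) ^ n \<le> 2 ^ n * (x ^ n + 1)" for x :: real
proof (cases "x \<le> 1")
  case True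
  assume "0 \<le> x"
  have "(x + 1) ^ n \<le> 2 ^ n * 1" using True \<open>0 \<le> x\<close> by (simp add: power_mono)
  also have "\<dots> \<le> 2 ^ n * (x ^ n + 1)" using \<open>0 \<le> x\<close> by (intro mult_left_mono) auto
  finally show ?thesis .
next
  case False
  then have "(x + 1) ^ n \<le> (2 * x) ^ n" by (intro power_mono) auto
  also have "\<dots> \<le> 2 ^ n * (x ^ n + 1)" by (simp add: power_mult_distrib)
  finally show ?thesis .
qed

lemma minimal_type_deriv:
  assumes "minimal_type n g" shows "minimal_type n (deriv g)"
  unfolding minimal_type_def
proof (intro conjI allI impI)
  show "deriv g holomorphic_on UNIV"
    using assms by (intro holomorphic_deriv) (auto simp: minimal_type_holomorphic)
  fix \<epsilon> :: real assume "\<epsilon> > 0"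
  \<comment> \<open>Going from \<open>z\<close> to the unit disc about it may multiply the exponent
    by \<open>2^n\<close>, since \<open>(x + 1)^n \<le> 2^n (x^n + 1)\<close>; the smaller exponent
    makes up for this.\<close>
  then have e: "\<epsilon> / 2 ^ n > 0" by simp
  obtain C where C: "C \<ge> 0" "\<And>z. norm (g z) \<le> C * exp (\<epsilon> / 2 ^ n * norm z ^ n)"
    using minimal_typeD[OF assms e] by blast
  have "norm (deriv g z) \<le> C * exp \<epsilon> * exp (\<epsilon> * norm z ^ n)" for z
  proof -
    have "norm (deriv g z) \<le> (C * exp \<epsilon> * exp (\<epsilon> * norm z ^ n)) / 1"
    proof (rule norm_deriv_le_ball)
      fix y assume "y \<in> ball z 1"
      then have "norm y \<le> norm z + 1"
        using norm_triangle_ineq2[of y z] by (simp add: dist_norm norm_minus_commute)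
      then have "norm y ^ n \<le> (norm z + 1) ^ n" by (intro power_mono) auto
      also have "\<dots> \<le> 2 ^ n * (norm z ^ n + 1)" by (rule power_add_one_le) simp
      finally have "\<epsilon> / 2 ^ n * norm y ^ n \<le> \<epsilon> / 2 ^ n * (2 ^ n * (norm z ^ n + 1))"
        using e by (intro mult_left_mono) auto
      also have "\<dots> = \<epsilon> + \<epsilon> * norm z ^ n" by (simp add: algebra_simps)
      finally have "exp (\<epsilon> / 2 ^ n * norm y ^ n) \<le> exp \<epsilon> * exp (\<epsilon> * norm z ^ n)"
        by (simp flip: exp_add)
      then show "norm (g y) \<le> C * exp \<epsilon> * exp (\<epsilon> * norm z ^ n)"
        using C(2)[of y] mult_left_mono[OF _ C(1)] by (smt (verit) mult.assoc)
    qed (use assms minimal_type_holomorphic in auto)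
    then show ?thesis by simp
  qed
  then show "\<exists>C. \<forall>z. norm (deriv g z) \<le> C * exp (\<epsilon> * norm z ^ n)" by blast
qed

lemmas minimal_type_intros = minimal_type_const minimal_type_ident minimal_type_add minimal_type_mult
  minimal_type_uminus minimal_type_diff minimal_type_power minimal_type_poly minimal_type_deriv

section \<open>Dividing out zeros, and decay on an arc\<close>

lemma divide_out_zero:
  assumes "h holomorphic_on UNIV" "h a = (0::complex)"
  obtains k where "k holomorphic_on UNIV" "\<And>z. h z = (z - a) * k z"
proof
  show "(\<lambda>z. if z = a then deriv h a else (h z - h a) / (z - a)) holomorphic_on UNIV"
    by (intro pole_lemma_open assms open_UNIV)
qed (use assms in auto)

lemma divide_out_zero_order:
  assumes h: "h holomorphic_on UNIV" and nz: "h w \<noteq> (0::complex)"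
  obtains k g where "g holomorphic_on UNIV" "g a \<noteq> 0" "\<And>z. h z = (z - a) ^ k * g z"
proof (cases "h a = 0")
  case False
  then show ?thesis using that[of h 0] h by simp
next
  case True
  have "\<not> h constant_on UNIV" using True nz unfolding constant_on_def by (metis UNIV_I)
  then obtain g r k where g: "0 < k" "0 < r" "g holomorphic_on ball a r"
      "\<And>w. w \<in> ball a r \<Longrightarrow> h w = (w - a) ^ k * g w" "\<And>w. w \<in> ball a r \<Longrightarrow> g w \<noteq> 0"
    using holomorphic_factor_zero_nonconstant[OF h open_UNIV connected_UNIV UNIV_I True] by metis
  define G where "G = (\<lambda>z. if z = a then g a else h z / (z - a) ^ k)"
  have Gg: "G z = g z" if "z \<in> ball a r" for z using g(4)[OF that] by (auto simp: G_def)
  have "G holomorphic_on UNIV"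
  proof (rule no_isolated_singularity'[where K = "{a}"])
    have "(\<lambda>z. h z / (z - a) ^ k) holomorphic_on UNIV - {a}"
      by (intro holomorphic_intros holomorphic_on_subset[OF h]) auto
    then show "G holomorphic_on UNIV - {a}"
      by (rule holomorphic_transform) (auto simp: G_def)
    have "isCont g a"
      using g by (metis centre_in_ball continuous_on_eq_continuous_at holomorphic_on_imp_continuous_on open_ball)
    then have "(g \<longlongrightarrow> G a) (at a)" by (simp add: G_def isCont_def)
    then have "(G \<longlongrightarrow> G a) (at a)"
    proof (rule Lim_transform_within_open)
      show "a \<in> ball a r" using g(2) by simp
    qed (use Gg in auto)
    then show "(G \<longlongrightarrow> G z) (at z within UNIV)" if "z \<in> {a}" for z using that by simp
  qed auto
  moreover have "G a \<noteq> 0" using g(5)[of a] g(2) by (simp add: G_def)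
  moreover have "h z = (z - a) ^ k * G z" for z using True g(1) by (auto simp: G_def)
  ultimately show ?thesis using that by blast
qed

lemma filterlim_power_at_top_real: "n > 0 \<Longrightarrow> filterlim (\<lambda>r::real. r ^ n) at_top at_top"
  by (rule filterlim_pow_at_top) (auto simp: filterlim_ident)

lemma eventually_le_exp_power:
  fixes C \<epsilon> :: real
  assumes "n > 0" "\<epsilon> > 0"
  shows "\<forall>\<^sub>F r in at_top. C \<le> exp (\<epsilon> * r ^ n)"
proof -
  have "filterlim (\<lambda>r::real. exp (\<epsilon> * r ^ n)) at_top at_top"
    by (intro filterlim_compose[OF exp_at_top] filterlim_tendsto_pos_mult_at_top[OF tendsto_const]
        filterlim_power_at_top_real assms)
  then show ?thesis by (simp add: filterlim_at_top)
qed

lemma minimal_type_eventually: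
  assumes g: "minimal_type n g" and n: "n > 0" and \<epsilon>: "\<epsilon> > 0"
  shows "\<forall>\<^sub>F r in at_top. \<forall>z. norm z = r \<longrightarrow> norm (g z) \<le> exp (\<epsilon> * r ^ n)"
proof -
  have "\<epsilon> / 2 > 0" using \<epsilon> by simp
  then obtain C where C: "C \<ge> 0" "\<And>z. norm (g z) \<le> C * exp (\<epsilon> / 2 * norm z ^ n)"
    using minimal_typeD[OF g] by blast
  show ?thesis using eventually_le_exp_power[OF n \<open>\<epsilon> / 2 > 0\<close>, of C]
  proof eventually_elim
    case (elim r)
    have "norm (g z) \<le> exp (\<epsilon> * r ^ n)" if "norm z = r" for z
    proof -
      have "norm (g z) \<le> C * exp (\<epsilon> / 2 * r ^ n)" using C(2)[of z] that by simp
      also have "\<dots> \<le> exp (\<epsilon> / 2 * r ^ n) * exp (\<epsilon> / 2 * r ^ n)"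
        using elim by (intro mult_right_mono) auto
      also have "\<dots> = exp (\<epsilon> * r ^ n)" by (simp flip: exp_add)
      finally show ?thesis .
    qed
    then show ?case by blast
  qed
qed

text \<open>In a product of \<open>N\<close> rotations the arc contributes a factor
  \<open>exp (- \<delta> r^n)\<close>. Here \<open>N\<close> is fixed by the length of the arc,
  while minimal type lets the other factors grow as slowly as wanted: with
  \<open>\<epsilon> = \<delta> / (2 N)\<close> they use up at most half of the decay.\<close>

lemma minimal_type_arc_decay_imp_zero:
  assumes T: "minimal_type n T" and n: "n > 0" and ab: "\<alpha> < \<beta>" and \<delta>: "\<delta> > 0"
    and decay: "\<forall>\<^sub>F r in at_top. \<forall>\<theta>. \<alpha> < \<theta> \<longrightarrow> \<theta> < \<beta> \<longrightarrow>
      norm (T (of_real r * cis \<theta>)) \<le> exp (- \<delta> * r ^ n)"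
  shows "T z = 0"
proof (rule ccontr)
  assume "T z \<noteq> 0"
  moreover have holT: "T holomorphic_on UNIV" using T by (rule minimal_type_holomorphic)
  \<comment> \<open>The argument bounds the value at the centre, so the zero of \<open>T\<close> at
    the origin is divided out first; on circles with \<open>r \<ge> 1\<close> this does not increase
    the modulus.\<close>
  ultimately obtain k g where g: "g holomorphic_on UNIV" "g 0 \<noteq> 0" "\<And>z. T z = (z - 0) ^ k * g z"
    using divide_out_zero_order[of T z 0] by metis
  obtain N where N: "real N > 2 * pi / (\<beta> - \<alpha>)" using reals_Archimedean2 by blast
  then have N': "real N * (\<beta> - \<alpha>) > 2 * pi" using ab by (simp add: field_simps)
  have N0: "N > 0" using N' pi_gt_zero by (cases N) auto
  define \<epsilon> where "\<epsilon> = \<delta> / (2 * real N)"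
  have \<epsilon>: "\<epsilon> > 0" using \<delta> N0 by (simp add: \<epsilon>_def)
  have "\<forall>\<^sub>F r::real in at_top. 1 \<le> r" by (rule eventually_ge_at_top)
  then have "\<forall>\<^sub>F r in at_top. norm (g 0) ^ N \<le> exp (- (\<delta> / 2) * r ^ n)"
    using decay minimal_type_eventually[OF T n \<epsilon>]
  proof eventually_elim
    case (elim r)
    have nr: "norm (of_real r * cis \<theta>) = r" for \<theta> using elim(1) by (simp add: norm_mult)
    have gT: "norm (g z) \<le> norm (T z)" if "norm z = r" for z
    proof -
      have "1 * norm (g z) \<le> norm z ^ k * norm (g z)"
        using that elim(1) by (intro mult_right_mono) auto
      then show ?thesis by (simp add: g(3)[of z] norm_mult norm_power)
    qed
    have "norm (g 0) ^ N \<le> exp (\<epsilon> * r ^ n) ^ (N - 1) * exp (- \<delta> * r ^ n)"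
    proof (rule arc_bound[OF g(1) subset_UNIV _ N'])
      show "norm (g (0 + of_real r * cis \<theta>)) \<le> exp (\<epsilon> * r ^ n)" for \<theta>
        using gT[of "of_real r * cis \<theta>"] elim(3) nr[of \<theta>] by (simp, meson order_trans)
      show "norm (g (0 + of_real r * cis \<theta>)) \<le> exp (- \<delta> * r ^ n)" if "\<alpha> < \<theta>" "\<theta> < \<beta>" for \<theta>
        using gT[of "of_real r * cis \<theta>"] elim(2) that nr[of \<theta>] by (simp, meson order_trans)
    qed (use elim in auto)
    also have "exp (\<epsilon> * r ^ n) ^ (N - 1) \<le> exp (\<epsilon> * r ^ n) ^ N"
      using \<epsilon> elim(1) by (intro power_increasing) auto
    also have "exp (\<epsilon> * r ^ n) ^ N * exp (- \<delta> * r ^ n) = exp (- (\<delta> / 2) * r ^ n)"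
      using N0 by (simp add: \<epsilon>_def field_simps flip: exp_add exp_of_nat_mult)
    finally show ?case by simp
  qed
  moreover have "\<forall>\<^sub>F r in at_top. 2 / norm (g 0) ^ N \<le> exp (\<delta> / 2 * r ^ n)"
    using eventually_le_exp_power[OF n, of "\<delta> / 2"] \<delta> by simp
  ultimately have "\<forall>\<^sub>F r::real in at_top. False"
  proof eventually_elim
    case (elim r)
    have G: "norm (g 0) ^ N > 0" using g(2) by simp
    then have "2 \<le> exp (\<delta> / 2 * r ^ n) * norm (g 0) ^ N" using elim(2) by (simp add: field_simps)
    also have "\<dots> \<le> exp (\<delta> / 2 * r ^ n) * exp (- (\<delta> / 2) * r ^ n)" using elim(1) by (intro mult_left_mono) auto
    also have "\<dots> = 1" by (simp flip: exp_add)
    finally show False by simp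
  qed
  then show False by simp
qed

section \<open>Growth of exponential sums along single rays\<close>

lemma of_real_cis_power: "(of_real r * cis \<theta>) ^ n = of_real (r ^ n) * cis (real n * \<theta>)"
  unfolding power_mult_distrib of_real_power Complex.DeMoivre ..

lemma Re_mult_of_real_cis_power:
  "Re (a * (of_real r * cis \<theta>) ^ n) = Re (a * cis (real n * \<theta>)) * r ^ n"
  unfolding of_real_cis_power by (simp add: algebra_simps del: of_real_power)

lemma norm_mult_exp_ray:
  "norm (w * exp (a * (of_real r * cis \<theta>) ^ n)) = norm w * exp (Re (a * cis (real n * \<theta>)) * r ^ n)"
  by (simp only: norm_mult norm_exp_eq_Re Re_mult_of_real_cis_power)

text \<open>An indicator bound without logarithms. The strict gap \<open>y < x\<close> absorbs
  finite sums and coefficients of minimal type, and the negation of the notion yields the lower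
  bound \<open>x\<close> for the indicator.\<close>

definition exp_type_below :: "nat \<Rightarrow> real \<Rightarrow> (real \<Rightarrow> complex) \<Rightarrow> bool" where
  "exp_type_below n x g \<longleftrightarrow> (\<exists>y<x. \<forall>\<^sub>F r in at_top. norm (g r) \<le> exp (y * r ^ n))"

lemma exp_type_below_add:
  assumes n: "n > 0" and "exp_type_below n x g" "exp_type_below n x h"
  shows "exp_type_below n x (\<lambda>r. g r + h r)"
proof -
  obtain y1 y2 where y: "y1 < x" "y2 < x"
    and 1: "\<forall>\<^sub>F r in at_top. norm (g r) \<le> exp (y1 * r ^ n)"
    and 2: "\<forall>\<^sub>F r in at_top. norm (h r) \<le> exp (y2 * r ^ n)"
    using assms unfolding exp_type_below_def by blast
  define y where "y = max y1 y2"
  define y' where "y' = (x + y) / 2"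
  have y': "y < y'" "y' < x" using y by (auto simp: y'_def y_def)
  have "\<forall>\<^sub>F r in at_top. norm (g r + h r) \<le> exp (y' * r ^ n)"
    using 1 2 eventually_le_exp_power[OF n, of "y' - y" 2, OF y'(1)[THEN diff_gt_0_iff_gt[THEN iffD2]]]
      eventually_ge_at_top[of 0]
  proof eventually_elim
    case (elim r)
    have "norm (g r + h r) \<le> exp (y1 * r ^ n) + exp (y2 * r ^ n)"
      using elim norm_triangle_ineq[of "g r" "h r"] by linarith
    also have "\<dots> \<le> exp (y * r ^ n) + exp (y * r ^ n)"
      using elim(4) by (intro add_mono) (auto simp: y_def intro!: mult_right_mono)
    also have "\<dots> \<le> exp ((y' - y) * r ^ n) * exp (y * r ^ n)"
      using mult_right_mono[OF elim(3), of "exp (y * r ^ n)"] by simp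
    also have "\<dots> = exp (y' * r ^ n)" by (simp add: algebra_simps flip: exp_add)
    finally show ?case .
  qed
  then show ?thesis using y' unfolding exp_type_below_def by blast
qed

lemma exp_type_below_zero: "exp_type_below n x (\<lambda>r. 0)"
  unfolding exp_type_below_def by (intro exI[of _ "x - 1"]) simp

lemma exp_type_below_sum:
  assumes "n > 0" "finite J" "\<And>j. j \<in> J \<Longrightarrow> exp_type_below n x (g j)"
  shows "exp_type_below n x (\<lambda>r. \<Sum>j\<in>J. g j r)"
  using assms(2,3)
  by (induction J) (auto intro: exp_type_below_zero exp_type_below_add[OF assms(1)])

lemma exp_type_below_term:
  assumes n: "n > 0" and T: "minimal_type n T" and x: "Re (a * cis (real n * \<theta>)) < x"
  shows "exp_type_below n x (\<lambda>r. T (of_real r * cis \<theta>) * exp (a * (of_real r * cis \<theta>) ^ n))"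
proof -
  define y where "y = Re (a * cis (real n * \<theta>))"
  define \<epsilon> where "\<epsilon> = (x - y) / 2"
  have "y < x" using x by (simp only: y_def)
  then have \<epsilon>: "\<epsilon> > 0" "y + \<epsilon> < x" by (auto simp: \<epsilon>_def field_simps)
  have "\<forall>\<^sub>F r in at_top. norm (T (of_real r * cis \<theta>) * exp (a * (of_real r * cis \<theta>) ^ n)) \<le> exp ((y + \<epsilon>) * r ^ n)"
    using minimal_type_eventually[OF T n \<epsilon>(1)] eventually_ge_at_top[of 0]
  proof eventually_elim
    case (elim r)
    have "norm (T (of_real r * cis \<theta>) * exp (a * (of_real r * cis \<theta>) ^ n)) =
        norm (T (of_real r * cis \<theta>)) * exp (y * r ^ n)"
      by (simp only: norm_mult_exp_ray y_def)
    also have "\<dots> \<le> exp (\<epsilon> * r ^ n) * exp (y * r ^ n)"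
      using elim by (intro mult_right_mono) (auto simp: norm_mult)
    also have "\<dots> = exp ((y + \<epsilon>) * r ^ n)" by (simp add: algebra_simps flip: exp_add)
    finally show ?case .
  qed
  then show ?thesis using \<epsilon> unfolding exp_type_below_def by blast
qed

text \<open>The decay of \<open>T i\<close> along each ray of the arc is not assumed to be uniform in \<open>\<theta>\<close>; Baire's theorem
  yields a smaller arc on which it is.\<close>
lemma dominant_coefficient_zero:
  fixes T :: "'i \<Rightarrow> complex \<Rightarrow> complex" and \<zeta> :: "'i \<Rightarrow> complex"
  assumes n: "n > 0" and J: "finite J" "i \<in> J" and T: "\<And>j. j \<in> J \<Longrightarrow> minimal_type n (T j)"
    and ab: "\<alpha> < \<beta>"
    and dom: "\<And>\<theta> j. \<alpha> < \<theta> \<Longrightarrow> \<theta> < \<beta> \<Longrightarrow> j \<in> J \<Longrightarrow> j \<noteq> i \<Longrightarrow>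
      Re (\<zeta> j * cis (real n * \<theta>)) < Re (\<zeta> i * cis (real n * \<theta>))"
    and dec: "\<And>\<theta>. \<alpha> < \<theta> \<Longrightarrow> \<theta> < \<beta> \<Longrightarrow> exp_type_below n (Re (\<zeta> i * cis (real n * \<theta>)))
      (\<lambda>r. \<Sum>j\<in>J. T j (of_real r * cis \<theta>) * exp (\<zeta> j * (of_real r * cis \<theta>) ^ n))"
  shows "T i z = 0"
proof -
  \<comment> \<open>One index \<open>k\<close> governs both the radius from which the decay holds
    and its rate \<open>1 / (k + 1)\<close>, so that countably many closed sets cover the open
    arc.\<close>
  define E where "E = (\<lambda>k::nat. {\<theta>\<in>{\<alpha>..\<beta>}. \<forall>r::real. r \<ge> real k \<longrightarrow>
    norm (T i (of_real r * cis \<theta>)) \<le> exp (- (1 / real (Suc k)) * r ^ n)})"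
  have contT: "continuous_on UNIV (T i)"
    using minimal_type_holomorphic[OF T[OF J(2)]] by (rule holomorphic_on_imp_continuous_on)
  have "closed (E k)" for k
  proof -
    have "E k = {\<alpha>..\<beta>} \<inter> (\<Inter>r\<in>{real k..}. {\<theta>. norm (T i (of_real r * cis \<theta>)) \<le> exp (- (1 / real (Suc k)) * r ^ n)})"
      by (auto simp: E_def)
    moreover have "closed {\<theta>. norm (T i (of_real r * cis \<theta>)) \<le> exp (- (1 / real (Suc k)) * r ^ n)}" for r
      by (intro closed_Collect_le continuous_on_norm continuous_on_const
          continuous_on_compose2[OF contT] continuous_intros) auto
    ultimately show ?thesis by (auto intro!: closed_Int closed_INT)
  qed
  have cover: "\<exists>k. \<theta> \<in> E k" if \<theta>: "\<alpha> < \<theta>" "\<theta> < \<beta>" for \<theta>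
  proof -
    define x where "x = Re (\<zeta> i * cis (real n * \<theta>))"
    let ?S = "\<lambda>r. \<Sum>j\<in>J. T j (of_real r * cis \<theta>) * exp (\<zeta> j * (of_real r * cis \<theta>) ^ n)"
    \<comment> \<open>All these terms are strictly dominated by the \<open>i\<close>-th one on this
      ray, so subtracting them from the sum isolates that one without spoiling the bound.\<close>
    let ?R = "\<lambda>r. \<Sum>j\<in>J - {i}. - T j (of_real r * cis \<theta>) * exp (\<zeta> j * (of_real r * cis \<theta>) ^ n)"
    have "exp_type_below n x ?R"
      using dom[OF \<theta>] J T unfolding x_def
      by (intro exp_type_below_sum exp_type_below_term minimal_type_uminus n) auto
    then have "exp_type_below n x (\<lambda>r. ?S r + ?R r)"
      using dec[OF \<theta>] unfolding x_def by (intro exp_type_below_add n)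
    moreover have "?S r + ?R r = T i (of_real r * cis \<theta>) * exp (\<zeta> i * (of_real r * cis \<theta>) ^ n)" for r
      using J by (subst sum.remove[of J i]) (auto simp: sum_negf)
    ultimately obtain y where y: "y < x" and
      ev: "\<forall>\<^sub>F r in at_top. norm (T i (of_real r * cis \<theta>) * exp (\<zeta> i * (of_real r * cis \<theta>) ^ n)) \<le> exp (y * r ^ n)"
      unfolding exp_type_below_def by auto
    have "\<forall>\<^sub>F r in at_top. norm (T i (of_real r * cis \<theta>)) \<le> exp (- (x - y) * r ^ n)"
      using ev
    proof eventually_elim
      case (elim r)
      then have "norm (T i (of_real r * cis \<theta>)) * exp (x * r ^ n) \<le> exp (y * r ^ n)"
        by (simp only: norm_mult_exp_ray x_def)
      then have "norm (T i (of_real r * cis \<theta>)) \<le> exp (y * r ^ n) / exp (x * r ^ n)"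
        by (simp add: field_simps)
      then show ?case by (simp add: algebra_simps flip: exp_diff)
    qed
    then obtain r0 where r0: "\<And>r. r \<ge> r0 \<Longrightarrow> norm (T i (of_real r * cis \<theta>)) \<le> exp (- (x - y) * r ^ n)"
      unfolding eventually_at_top_linorder by blast
    obtain k :: nat where k: "real k \<ge> max r0 (1 / (x - y))" using real_arch_simple by blast
    have "norm (T i (of_real r * cis \<theta>)) \<le> exp (- (1 / real (Suc k)) * r ^ n)" if r: "r \<ge> real k" for r
    proof -
      have "norm (T i (of_real r * cis \<theta>)) \<le> exp (- (x - y) * r ^ n)" using r0 r k by simp
      also have "1 / (x - y) \<le> real (Suc k)" using k by simp
      then have "1 / real (Suc k) \<le> x - y" using y by (simp add: field_simps)
      then have "- (x - y) * r ^ n \<le> - (1 / real (Suc k)) * r ^ n"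
        using r by (intro mult_right_mono) auto
      then have "exp (- (x - y) * r ^ n) \<le> exp (- (1 / real (Suc k)) * r ^ n)" by simp
      finally show ?thesis .
    qed
    then show ?thesis using \<theta> unfolding E_def by auto
  qed
  \<comment> \<open>A closed middle third: Baire's theorem is applied to a closed set, while the
    covering is known only on the open arc.\<close>
  define S where "S = {(2 * \<alpha> + \<beta>) / 3..(\<alpha> + 2 * \<beta>) / 3}"
  have Sne: "(2 * \<alpha> + \<beta>) / 3 < (\<alpha> + 2 * \<beta>) / 3" and Ssub: "S \<subseteq> {\<alpha><..<\<beta>}"
    using ab by (auto simp: S_def field_simps)
  \<comment> \<open>If every \<open>S - E k\<close> were dense in \<open>S\<close>, so would be
    their intersection, which is empty.\<close>
  have "\<exists>k. \<not> S \<subseteq> closure (S - E k)"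
  proof (rule ccontr)
    assume *: "\<not> ?thesis"
    have "S \<subseteq> closure (\<Inter>(range (\<lambda>k. S - E k)))"
    proof (rule Baire)
      fix G assume "G \<in> range (\<lambda>k. S - E k)"
      then obtain k where G: "G = S - E k" by blast
      show "openin (top_of_set S) G \<and> S \<subseteq> closure G"
        using * \<open>closed (E k)\<close> unfolding G by (auto simp: openin_open Diff_eq intro!: exI[of _ "- E k"])
    qed (auto simp: S_def)
    moreover have "\<Inter>(range (\<lambda>k. S - E k)) = {}" using cover Ssub by fastforce
    ultimately have "S \<subseteq> {}" by (metis closure_empty)
    moreover have "(2 * \<alpha> + \<beta>) / 3 \<in> S" using Sne by (simp add: S_def)
    ultimately show False by blast
  qed
  then obtain k \<theta> where \<theta>: "\<theta> \<in> S" "\<theta> \<notin> closure (S - E k)" by blast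
  define V where "V = - closure (S - E k)"
  have V: "open V" "\<theta> \<in> V" using \<theta> by (auto simp: V_def)
  have "S = closure {(2 * \<alpha> + \<beta>) / 3<..<(\<alpha> + 2 * \<beta>) / 3}" using Sne by (simp add: S_def)
  then have "V \<inter> {(2 * \<alpha> + \<beta>) / 3<..<(\<alpha> + 2 * \<beta>) / 3} \<noteq> {}"
    using \<theta>(1) V open_Int_closure_eq_empty[OF V(1)] by blast
  then obtain t where t: "t \<in> V \<inter> {(2 * \<alpha> + \<beta>) / 3<..<(\<alpha> + 2 * \<beta>) / 3}" by blast
  moreover have "open (V \<inter> {(2 * \<alpha> + \<beta>) / 3<..<(\<alpha> + 2 * \<beta>) / 3})" using V by (intro open_Int) auto
  ultimately obtain e where e: "e > 0" "ball t e \<subseteq> V \<inter> {(2 * \<alpha> + \<beta>) / 3<..<(\<alpha> + 2 * \<beta>) / 3}"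
    unfolding open_contains_ball by blast
  have inE: "\<phi> \<in> E k" if "t - e < \<phi>" "\<phi> < t + e" for \<phi>
  proof -
    have "\<phi> \<in> ball t e" using that by (auto simp: dist_real_def)
    then have "\<phi> \<in> V" "\<phi> \<in> S" using e(2) by (auto simp: S_def)
    then show ?thesis using closure_subset[of "S - E k"] by (auto simp: V_def)
  qed
  show ?thesis
  proof (rule minimal_type_arc_decay_imp_zero[OF T[OF J(2)] n])
    show "t - e < t + e" using e by simp
    show "\<forall>\<^sub>F r in at_top. \<forall>\<phi>. t - e < \<phi> \<longrightarrow> \<phi> < t + e \<longrightarrow>
        norm (T i (of_real r * cis \<phi>)) \<le> exp (- (1 / real (Suc k)) * r ^ n)"
      using eventually_ge_at_top[of "real k"]
      by eventually_elim (use inE in \<open>auto simp: E_def\<close>)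
  qed simp
qed

section \<open>Growth of exponential sums\<close>

lemma exists_interval_pos:
  fixes g :: "real \<Rightarrow> real"
  assumes "isCont g t" "\<alpha> < t" "t < \<beta>" "g t > 0"
  obtains \<alpha>' \<beta>' where "\<alpha> \<le> \<alpha>'" "\<alpha>' < t" "t < \<beta>'" "\<beta>' \<le> \<beta>" "\<And>s. \<alpha>' < s \<Longrightarrow> s < \<beta>' \<Longrightarrow> g s > 0"
proof -
  have "\<forall>\<^sub>F s in at t. g s > 0"
    using assms(1,4) unfolding isCont_def by (rule order_tendstoD(1))
  then obtain e where "e > 0" "\<And>s. s \<noteq> t \<Longrightarrow> dist s t < e \<Longrightarrow> g s > 0"
    unfolding eventually_at by blast
  then have e: "e > 0" "\<And>s. dist s t < e \<Longrightarrow> g s > 0" using assms(4) by metis+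
  show ?thesis
  proof (rule that[of "max \<alpha> (t - e)" "min \<beta> (t + e)"])
    show "g s > 0" if "max \<alpha> (t - e) < s" "s < min \<beta> (t + e)" for s
      using that by (intro e(2)) (auto simp: dist_real_def)
  qed (use assms e(1) in auto)
qed

lemma exists_Re_mult_cis_nonzero:
  assumes w: "w \<noteq> 0" and n: "n > 0" and ab: "\<alpha> < \<beta>"
  obtains t where "\<alpha> < t" "t < \<beta>" "Re (w * cis (real n * t)) \<noteq> 0"
proof -
  define t1 where "t1 = (\<alpha> + \<beta>) / 2"
  \<comment> \<open>If the real part vanishes at the midpoint, a shift by \<open>s\<close> turns it
    into \<open>- Im W sin (n s)\<close>; \<open>n s \<le> 1 < \<pi>\<close> keeps the sine
    nonzero.\<close>
  define s where "s = min ((\<beta> - \<alpha>) / 4) (1 / real n)"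
  have s: "s > 0" "s \<le> (\<beta> - \<alpha>) / 4" "s \<le> 1 / real n" using ab n by (auto simp: s_def min_def)
  have "0 < real n * s" "real n * s \<le> 1" using s n by (auto simp: field_simps)
  then have sin: "sin (real n * s) \<noteq> 0" using pi_gt3 by (intro less_imp_neq[THEN not_sym] sin_gt_zero) auto
  define W where "W = w * cis (real n * t1)"
  have "W \<noteq> 0" using w by (simp add: W_def)
  have "w * cis (real n * (t1 + s)) = W * cis (real n * s)"
    by (simp add: W_def distrib_left mult.assoc cis_mult)
  then have "Re (w * cis (real n * (t1 + s))) = Re W * cos (real n * s) - Im W * sin (real n * s)"
    by simp
  then have "Re W \<noteq> 0 \<or> Re (w * cis (real n * (t1 + s))) \<noteq> 0"
    using sin \<open>W \<noteq> 0\<close> by (auto simp: complex_eq_iff)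
  moreover have "\<alpha> < t1" "t1 < \<beta>" "\<alpha> < t1 + s" "t1 + s < \<beta>" using ab s(1,2) unfolding t1_def by argo+
  ultimately show ?thesis using that unfolding W_def by blast
qed

lemma isCont_Re_mult_cis: "isCont (\<lambda>t. Re (w * cis (a * t))) t"
proof -
  have "(\<lambda>t. Re (w * cis (a * t))) = (\<lambda>t. Re w * cos (a * t) - Im w * sin (a * t))" by auto
  then show ?thesis by (simp only:) (intro continuous_intros)
qed

text \<open>Two distinct exponents cannot have equal real parts along a whole arc. Each new index is
  compared with the current winner at a direction where they differ, and by continuity one of the
  two wins strictly on a subarc.\<close>

lemma exists_strictly_dominant:
  fixes \<zeta> :: "'i \<Rightarrow> complex"
  assumes n: "n > 0" and "finite J" "J \<noteq> {}" "inj_on \<zeta> J" "\<alpha> < \<beta>"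
  shows "\<exists>i\<in>J. \<exists>\<alpha>' \<beta>'. \<alpha> \<le> \<alpha>' \<and> \<alpha>' < \<beta>' \<and> \<beta>' \<le> \<beta> \<and>
    (\<forall>\<theta> j. \<alpha>' < \<theta> \<longrightarrow> \<theta> < \<beta>' \<longrightarrow> j \<in> J \<longrightarrow> j \<noteq> i \<longrightarrow>
      Re (\<zeta> j * cis (real n * \<theta>)) < Re (\<zeta> i * cis (real n * \<theta>)))"
  using assms(2-4)
proof (induction J rule: finite_ne_induct)
  case (singleton i)
  then show ?case using assms(5) by auto
next
  case (insert k J)
  obtain i \<alpha>' \<beta>' where i: "i \<in> J" "\<alpha> \<le> \<alpha>'" "\<alpha>' < \<beta>'" "\<beta>' \<le> \<beta>"
    and dom: "\<And>\<theta> j. \<alpha>' < \<theta> \<Longrightarrow> \<theta> < \<beta>' \<Longrightarrow> j \<in> J \<Longrightarrow> j \<noteq> i \<Longrightarrow>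
      Re (\<zeta> j * cis (real n * \<theta>)) < Re (\<zeta> i * cis (real n * \<theta>))"
    using insert.IH insert.prems by auto
  define w where "w = \<zeta> k - \<zeta> i"
  have w: "w \<noteq> 0" using insert.prems insert.hyps i by (auto simp: w_def inj_on_def)
  have Re_w: "Re (w * cis (real n * s)) = Re (\<zeta> k * cis (real n * s)) - Re (\<zeta> i * cis (real n * s))" for s
    by (simp add: w_def algebra_simps)
  obtain t where t: "\<alpha>' < t" "t < \<beta>'" "Re (w * cis (real n * t)) \<noteq> 0"
    using exists_Re_mult_cis_nonzero[OF w n i(3)] .
  show ?case
  proof (cases "Re (w * cis (real n * t)) > 0")
    case True
    obtain a b where ab: "\<alpha>' \<le> a" "a < t" "t < b" "b \<le> \<beta>'"
      "\<And>s. a < s \<Longrightarrow> s < b \<Longrightarrow> Re (w * cis (real n * s)) > 0"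
      using exists_interval_pos[OF isCont_Re_mult_cis t(1,2) True] by metis
    have "Re (\<zeta> j * cis (real n * \<theta>)) < Re (\<zeta> k * cis (real n * \<theta>))"
      if "a < \<theta>" "\<theta> < b" "j \<in> insert k J" "j \<noteq> k" for \<theta> j
      using that ab(5)[OF that(1,2)] dom[of \<theta> j] ab(1,4) unfolding Re_w by (cases "j = i") force+
    then show ?thesis using i ab by (intro bexI[of _ k] exI[of _ a] exI[of _ b]) auto
  next
    case False
    then have neg: "Re (- w * cis (real n * t)) > 0" using t(3) by simp
    obtain a b where ab: "\<alpha>' \<le> a" "a < t" "t < b" "b \<le> \<beta>'"
      "\<And>s. a < s \<Longrightarrow> s < b \<Longrightarrow> Re (- w * cis (real n * s)) > 0"
      using exists_interval_pos[OF isCont_Re_mult_cis t(1,2) neg] by metis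
    have "Re (\<zeta> j * cis (real n * \<theta>)) < Re (\<zeta> i * cis (real n * \<theta>))"
      if "a < \<theta>" "\<theta> < b" "j \<in> insert k J" "j \<noteq> i" for \<theta> j
    proof -
      have "Re (w * cis (real n * \<theta>)) < 0" using ab(5)[OF that(1,2)] by simp
      then show ?thesis using that dom[of \<theta> j] ab(1,4) unfolding Re_w by (cases "j = k") force+
    qed
    then show ?thesis using i ab by (intro bexI[of _ i] exI[of _ a] exI[of _ b]) auto
  qed
qed

text \<open>On a subarc with strictly dominant index \<open>i\<close>, slower growth on every ray
  would make \<open>T i\<close> vanish identically. The index \<open>k\<close> ensures that the
  dominant exponent is nonzero, which matters because only coefficients of nonzero exponents are
  known not to vanish.\<close>

lemma exists_ray_of_maximal_growth:
  fixes T :: "'i \<Rightarrow> complex \<Rightarrow> complex" and \<zeta> :: "'i \<Rightarrow> complex"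
  assumes n: "n > 0" and J: "finite J" "J \<noteq> {}" and inj: "inj_on \<zeta> J"
    and T: "\<And>j. j \<in> J \<Longrightarrow> minimal_type n (T j)"
    and nz: "\<And>j. j \<in> J \<Longrightarrow> \<zeta> j \<noteq> 0 \<Longrightarrow> \<exists>z. T j z \<noteq> 0"
    and ab: "\<alpha> < \<beta>" and k: "k \<in> J"
    and pos: "\<And>\<theta>. \<alpha> < \<theta> \<Longrightarrow> \<theta> < \<beta> \<Longrightarrow> Re (\<zeta> k * cis (real n * \<theta>)) > 0"
  obtains \<theta> i where "\<alpha> < \<theta>" "\<theta> < \<beta>" "i \<in> J"
    "\<And>j. j \<in> J \<Longrightarrow> Re (\<zeta> j * cis (real n * \<theta>)) \<le> Re (\<zeta> i * cis (real n * \<theta>))"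
    "\<not> exp_type_below n (Re (\<zeta> i * cis (real n * \<theta>)))
      (\<lambda>r. \<Sum>j\<in>J. T j (of_real r * cis \<theta>) * exp (\<zeta> j * (of_real r * cis \<theta>) ^ n))"
proof -
  obtain i a b where i: "i \<in> J" and ab': "\<alpha> \<le> a" "a < b" "b \<le> \<beta>"
    and dom: "\<And>\<theta> j. a < \<theta> \<Longrightarrow> \<theta> < b \<Longrightarrow> j \<in> J \<Longrightarrow> j \<noteq> i \<Longrightarrow>
      Re (\<zeta> j * cis (real n * \<theta>)) < Re (\<zeta> i * cis (real n * \<theta>))"
    using exists_strictly_dominant[OF n J inj ab] by blast
  have "Re (\<zeta> i * cis (real n * ((a + b) / 2))) > 0"
    using pos[of "(a + b) / 2"] dom[of "(a + b) / 2" k] k ab' by (cases "k = i") force+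
  then have "\<zeta> i \<noteq> 0" by auto
  then obtain z where "T i z \<noteq> 0" using nz i by blast
  then have "\<not> (\<forall>\<theta>. a < \<theta> \<longrightarrow> \<theta> < b \<longrightarrow> exp_type_below n (Re (\<zeta> i * cis (real n * \<theta>)))
      (\<lambda>r. \<Sum>j\<in>J. T j (of_real r * cis \<theta>) * exp (\<zeta> j * (of_real r * cis \<theta>) ^ n)))"
    using dominant_coefficient_zero[where T = T and \<zeta> = \<zeta>, OF n J(1) i T ab'(2) dom] by blast
  then obtain \<theta> where "a < \<theta>" "\<theta> < b" "\<not> exp_type_below n (Re (\<zeta> i * cis (real n * \<theta>)))
      (\<lambda>r. \<Sum>j\<in>J. T j (of_real r * cis \<theta>) * exp (\<zeta> j * (of_real r * cis \<theta>) ^ n))" by blast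
  then show ?thesis using ab' dom i by (intro that[of \<theta> i]) (auto intro: less_imp_le)
qed

lemma exists_interval_Re_pos:
  assumes "w \<noteq> 0" "n > 0"
  obtains \<alpha> \<beta> where "\<alpha> < \<beta>" "\<And>\<theta>. \<alpha> < \<theta> \<Longrightarrow> \<theta> < \<beta> \<Longrightarrow> Re (w * cis (real n * \<theta>)) > norm w / 2"
proof -
  define t where "t = - Arg w / real n"
  have "w * cis (real n * t) = of_real (norm w)"
  proof -
    have "w * cis (real n * t) = rcis (norm w) (Arg w) * cis (- Arg w)"
      using assms by (simp add: t_def rcis_cmod_Arg)
    then show ?thesis by (simp add: rcis_def mult.assoc cis_mult)
  qed
  then have "Re (w * cis (real n * t)) - norm w / 2 > 0" using assms by simp
  moreover have "isCont (\<lambda>s. Re (w * cis (real n * s)) - norm w / 2) t"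
    by (intro isCont_diff isCont_Re_mult_cis continuous_const)
  moreover have "t - 1 < t" "t < t + 1" by auto
  moreover define g where "g = (\<lambda>s. Re (w * cis (real n * s)) - norm w / 2)"
  ultimately have "isCont g t" "t - 1 < t" "t < t + 1" "g t > 0" by blast+
  then obtain a b where "a < t" "t < b" "\<And>s. a < s \<Longrightarrow> s < b \<Longrightarrow> g s > 0"
    using exists_interval_pos[where g = g and t = t and \<alpha> = "t - 1" and \<beta> = "t + 1"] by metis
  then have ab: "a < t" "t < b" "\<And>s. a < s \<Longrightarrow> s < b \<Longrightarrow> Re (w * cis (real n * s)) - norm w / 2 > 0"
    unfolding g_def by blast+
  show ?thesis
  proof (rule that)
    show "a < b" using ab by linarith
    show "Re (w * cis (real n * \<theta>)) > norm w / 2" if "a < \<theta>" "\<theta> < b" for \<theta>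
      using ab(3)[OF that] by linarith
  qed
qed

lemma exponential_sum_not_minimal_type:
  fixes T :: "'i \<Rightarrow> complex \<Rightarrow> complex" and \<zeta> :: "'i \<Rightarrow> complex"
  assumes n: "n > 0" and J: "finite J" and inj: "inj_on \<zeta> J"
    and T: "\<And>j. j \<in> J \<Longrightarrow> minimal_type n (T j)"
    and nz: "\<And>j. j \<in> J \<Longrightarrow> \<zeta> j \<noteq> 0 \<Longrightarrow> \<exists>z. T j z \<noteq> 0"
    and k: "k \<in> J" "\<zeta> k \<noteq> 0"
  shows "\<not> minimal_type n (\<lambda>z. \<Sum>j\<in>J. T j z * exp (\<zeta> j * z ^ n))"
proof
  assume S: "minimal_type n (\<lambda>z. \<Sum>j\<in>J. T j z * exp (\<zeta> j * z ^ n))"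
  obtain \<alpha> \<beta> where ab: "\<alpha> < \<beta>" "\<And>\<theta>. \<alpha> < \<theta> \<Longrightarrow> \<theta> < \<beta> \<Longrightarrow> Re (\<zeta> k * cis (real n * \<theta>)) > norm (\<zeta> k) / 2"
    using exists_interval_Re_pos[OF k(2) n] by blast
  have pos: "Re (\<zeta> k * cis (real n * \<theta>)) > 0" if "\<alpha> < \<theta>" "\<theta> < \<beta>" for \<theta>
    using ab(2)[OF that] norm_ge_zero[of "\<zeta> k"] by linarith
  obtain \<theta> i where \<theta>: "\<alpha> < \<theta>" "\<theta> < \<beta>" "i \<in> J"
    "\<And>j. j \<in> J \<Longrightarrow> Re (\<zeta> j * cis (real n * \<theta>)) \<le> Re (\<zeta> i * cis (real n * \<theta>))"
    "\<not> exp_type_below n (Re (\<zeta> i * cis (real n * \<theta>)))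
      (\<lambda>r. \<Sum>j\<in>J. T j (of_real r * cis \<theta>) * exp (\<zeta> j * (of_real r * cis \<theta>) ^ n))"
    using exists_ray_of_maximal_growth[where T = T and \<zeta> = \<zeta>, OF n J _ inj T nz ab(1) k(1) pos] k(1) by blast
  have "0 < Re (\<zeta> i * cis (real n * \<theta>))" using pos[OF \<theta>(1,2)] \<theta>(4)[OF k(1)] by linarith
  \<comment> \<open>The whole sum is read as a single term with a coefficient of minimal type and
    exponent \<open>0\<close>, hence the trivial exponential factor.\<close>
  then have "exp_type_below n (Re (\<zeta> i * cis (real n * \<theta>)))
      (\<lambda>r. (\<Sum>j\<in>J. T j (of_real r * cis \<theta>) * exp (\<zeta> j * (of_real r * cis \<theta>) ^ n))
        * exp (0 * (of_real r * cis \<theta>) ^ n))"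
    by (intro exp_type_below_term[OF n S]) simp
  then show False using \<theta>(5) by simp
qed

lemma exponential_sum_eventually_le:
  assumes n: "n > 0" and J: "finite J" and T: "\<And>j. j \<in> J \<Longrightarrow> minimal_type n (T j)"
  obtains L where "L > 0"
    "\<forall>\<^sub>F r in at_top. \<forall>z. norm z = r \<longrightarrow> norm (\<Sum>j\<in>J. T j z * exp (\<zeta> j * z ^ n)) \<le> exp (L * r ^ n)"
proof -
  define K where "K = (\<Sum>j\<in>J. norm (\<zeta> j))"
  have K: "norm (\<zeta> j) \<le> K" if "j \<in> J" for j unfolding K_def using J that by (intro member_le_sum) auto
  have "\<forall>\<^sub>F r in at_top. \<forall>j\<in>J. \<forall>z. norm z = r \<longrightarrow> norm (T j z) \<le> exp (1 * r ^ n)"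
    using minimal_type_eventually[OF T n zero_less_one] by (intro eventually_ball_finite J) blast
  then have "\<forall>\<^sub>F r in at_top. \<forall>z. norm z = r \<longrightarrow>
      norm (\<Sum>j\<in>J. T j z * exp (\<zeta> j * z ^ n)) \<le> exp ((K + 2) * r ^ n)"
    using eventually_le_exp_power[OF n zero_less_one, of "real (card J)"] eventually_ge_at_top[of 0]
  proof eventually_elim
    case (elim r)
    show ?case
    proof (intro allI impI)
      fix z :: complex assume z: "norm z = r"
      have "norm (T j z * exp (\<zeta> j * z ^ n)) \<le> exp (1 * r ^ n) * exp (K * r ^ n)" if j: "j \<in> J" for j
      proof -
        have "Re (\<zeta> j * z ^ n) \<le> norm (\<zeta> j) * r ^ n"
          using complex_Re_le_cmod[of "\<zeta> j * z ^ n"] z by (simp add: norm_mult norm_power)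
        also have "\<dots> \<le> K * r ^ n" using K[OF j] elim by (intro mult_right_mono) auto
        finally have "norm (exp (\<zeta> j * z ^ n)) \<le> exp (K * r ^ n)" by (simp only: norm_exp_eq_Re exp_le_cancel_iff)
        then show ?thesis unfolding norm_mult using elim j z by (intro mult_mono) auto
      qed
      then have "norm (\<Sum>j\<in>J. T j z * exp (\<zeta> j * z ^ n)) \<le> real (card J) * (exp (1 * r ^ n) * exp (K * r ^ n))"
        by (rule sum_norm_bound)
      also have "\<dots> \<le> exp (1 * r ^ n) * (exp (1 * r ^ n) * exp (K * r ^ n))"
        using elim by (intro mult_right_mono) auto
      also have "\<dots> = exp ((K + 2) * r ^ n)" by (simp add: algebra_simps flip: exp_add)
      finally show "norm (\<Sum>j\<in>J. T j z * exp (\<zeta> j * z ^ n)) \<le> exp ((K + 2) * r ^ n)" .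
    qed
  qed
  moreover have "K + 2 > 0" by (auto simp: K_def intro!: add_nonneg_pos sum_nonneg)
  ultimately show ?thesis using that by blast
qed

section \<open>Order and indicator\<close>

lemma norm_le_max_modulus:
  assumes "g holomorphic_on UNIV" "norm z = r"
  shows "norm (g z) \<le> max_modulus g r"
  unfolding max_modulus_def
proof (rule cSUP_upper)
  have "compact ((\<lambda>z. norm (g z)) ` sphere 0 r)"
    by (intro compact_continuous_image continuous_on_norm compact_sphere
        holomorphic_on_imp_continuous_on holomorphic_on_subset[OF assms(1)]) auto
  then show "bdd_above ((\<lambda>z. norm (g z)) ` sphere 0 r)" by (simp add: bounded_imp_bdd_above compact_imp_bounded)
qed (use assms in simp)

lemma max_modulus_le:
  assumes "r \<ge> 0" "\<And>z. norm z = r \<Longrightarrow> norm (g z) \<le> M"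
  shows "max_modulus g r \<le> M"
  unfolding max_modulus_def using assms by (intro cSUP_least) auto

lemma ln_plus_mono: "x \<le> y \<Longrightarrow> ln_plus x \<le> ln_plus y"
  by (simp add: ln_plus_def)

lemma less_exp_if_ln_plus: "ln_plus x < y \<Longrightarrow> x < exp y"
proof -
  assume "ln_plus x < y"
  then have "max 1 x < exp y" unfolding ln_plus_def by (metis exp_less_mono exp_ln max.strict_coboundedI1 zero_less_one)
  then show ?thesis by simp
qed

lemma minimal_typeI:
  assumes g: "g holomorphic_on UNIV"
    and ev: "\<And>\<epsilon>. \<epsilon> > 0 \<Longrightarrow> \<forall>\<^sub>F r in at_top. \<forall>z. norm z = r \<longrightarrow> norm (g z) \<le> exp (\<epsilon> * r ^ n)"
  shows "minimal_type n g"
  unfolding minimal_type_def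
proof (intro conjI allI impI g)
  fix \<epsilon> :: real assume \<epsilon>: "\<epsilon> > 0"
  then obtain r0 where r0: "\<And>z. norm z \<ge> r0 \<Longrightarrow> norm (g z) \<le> exp (\<epsilon> * norm z ^ n)"
    using ev[OF \<epsilon>] unfolding eventually_at_top_linorder by blast
  have "compact (g ` cball 0 r0)"
    by (intro compact_continuous_image compact_cball holomorphic_on_imp_continuous_on holomorphic_on_subset[OF g]) auto
  then have "bounded (g ` cball 0 r0)" by (rule compact_imp_bounded)
  then obtain M where "\<forall>w\<in>g ` cball 0 r0. norm w \<le> M" unfolding bounded_iff ..
  then have M: "norm (g z) \<le> M" if "norm z \<le> r0" for z
    using that by (metis image_eqI mem_cball_0)
  have "norm (g z) \<le> max 1 M * exp (\<epsilon> * norm z ^ n)" for z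
  proof (cases "norm z \<le> r0")
    case True
    have "max 1 M * 1 \<le> max 1 M * exp (\<epsilon> * norm z ^ n)" using \<epsilon> by (intro mult_left_mono) auto
    then show ?thesis using M[OF True] by linarith
  next
    case False
    have "1 * exp (\<epsilon> * norm z ^ n) \<le> max 1 M * exp (\<epsilon> * norm z ^ n)" by (intro mult_right_mono) auto
    then show ?thesis using r0[of z] False by linarith
  qed
  then show "\<exists>C. \<forall>z. norm (g z) \<le> C * exp (\<epsilon> * norm z ^ n)" by blast
qed

lemma powr_le_mult_power_eventually:
  fixes \<tau> \<epsilon> C :: real
  assumes "\<tau> < real n" "\<epsilon> > 0"
  shows "\<forall>\<^sub>F r in at_top. C * r powr \<tau> \<le> \<epsilon> * r ^ n"
proof -
  have "((\<lambda>r::real. r powr (\<tau> - real n)) \<longlongrightarrow> 0) at_top"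
    using assms(1) by (intro tendsto_neg_powr filterlim_ident) auto
  then have "((\<lambda>r::real. C * r powr (\<tau> - real n)) \<longlongrightarrow> C * 0) at_top" by (intro tendsto_intros)
  then have "\<forall>\<^sub>F r::real in at_top. C * r powr (\<tau> - real n) < \<epsilon>"
    using assms(2) by (intro order_tendstoD(2)) auto
  then show ?thesis using eventually_gt_at_top[of 0]
  proof eventually_elim
    case (elim r)
    have "C * r powr (\<tau> - real n) * r ^ n \<le> \<epsilon> * r ^ n" using elim by (intro mult_right_mono) auto
    then show ?case using elim(2) by (simp add: powr_diff powr_realpow)
  qed
qed

lemma growth_order_less_imp_minimal_type:
  assumes g: "g holomorphic_on UNIV" and less: "growth_order g < ereal (real n)"
  shows "minimal_type n g"
proof (rule minimal_typeI[OF g])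
  fix \<epsilon> :: real assume \<epsilon>: "\<epsilon> > 0"
  obtain \<tau> where \<tau>: "growth_order g < ereal \<tau>" "\<tau> < real n"
    using ereal_dense2[OF less] by auto
  have "\<forall>\<^sub>F r in at_top. ereal (ln_plus (ln_plus (max_modulus g r)) / ln r) < ereal \<tau>"
    using \<tau>(1) unfolding growth_order_def by (rule Limsup_lessD)
  then show "\<forall>\<^sub>F r in at_top. \<forall>z. norm z = r \<longrightarrow> norm (g z) \<le> exp (\<epsilon> * r ^ n)"
    using eventually_gt_at_top[of 1] powr_le_mult_power_eventually[OF \<tau>(2) \<epsilon>, of 1]
  proof eventually_elim
    case (elim r)
    have "ln_plus (ln_plus (max_modulus g r)) < \<tau> * ln r"
      using elim(1,2) by (simp add: field_simps)
    then have "ln_plus (max_modulus g r) < exp (\<tau> * ln r)" by (rule less_exp_if_ln_plus)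
    also have "exp (\<tau> * ln r) = r powr \<tau>" using elim(2) by (simp add: powr_def)
    also have "\<dots> \<le> \<epsilon> * r ^ n" using elim(3) by simp
    finally have "max_modulus g r < exp (\<epsilon> * r ^ n)" by (rule less_exp_if_ln_plus)
    then show ?case using norm_le_max_modulus[OF g] by (metis less_imp_le order_trans)
  qed
qed

lemma growth_order_le:
  assumes L: "L > 0" and ev: "\<forall>\<^sub>F r in at_top. \<forall>z. norm z = r \<longrightarrow> norm (g z) \<le> exp (L * r ^ n)"
  shows "growth_order g \<le> ereal (real n)"
proof -
  \<comment> \<open>At least \<open>1\<close>, so that for the majorant \<open>exp (K r^n)\<close>
    with \<open>r > 1\<close> both positive parts are plain logarithms and the quotient becomes
    \<open>ln K / ln r + n\<close>.\<close>
  define K where "K = max 1 L"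
  have "((\<lambda>r::real. ln K / ln r + real n) \<longlongrightarrow> 0 + real n) at_top"
    by (intro tendsto_add tendsto_const tendsto_divide_0[OF tendsto_const] filterlim_at_top_imp_at_infinity ln_at_top)
  then have "((\<lambda>r::real. ereal (ln K / ln r + real n)) \<longlongrightarrow> ereal (real n)) at_top" by simp
  then have lim: "Limsup at_top (\<lambda>r::real. ereal (ln K / ln r + real n)) = ereal (real n)"
    by (intro lim_imp_Limsup) auto
  have "\<forall>\<^sub>F r in at_top. ereal (ln_plus (ln_plus (max_modulus g r)) / ln r) \<le> ereal (ln K / ln r + real n)"
    using ev eventually_gt_at_top[of 1]
  proof eventually_elim
    case (elim r)
    have K: "K \<ge> 1" "K \<ge> L" by (auto simp: K_def)
    have rn: "1 \<le> r ^ n" using elim by simp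
    have "max_modulus g r \<le> exp (L * r ^ n)" using elim by (intro max_modulus_le) auto
    also have "\<dots> \<le> exp (K * r ^ n)" using K rn by (simp add: mult_right_mono)
    finally have "ln_plus (max_modulus g r) \<le> ln_plus (exp (K * r ^ n))" by (rule ln_plus_mono)
    also have "\<dots> = K * r ^ n" using K rn by (simp add: ln_plus_def max_def)
    finally have "ln_plus (ln_plus (max_modulus g r)) \<le> ln_plus (K * r ^ n)" by (rule ln_plus_mono)
    also have "1 * 1 \<le> K * r ^ n" using K rn by (intro mult_mono) auto
    then have "ln_plus (K * r ^ n) = ln K + real n * ln r"
      using K elim by (simp add: ln_plus_def max_def ln_mult ln_realpow)
    finally show ?case using elim(2) by (simp add: field_simps)
  qed
  then have "growth_order g \<le> Limsup at_top (\<lambda>r::real. ereal (ln K / ln r + real n))"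
    unfolding growth_order_def by (rule Limsup_mono)
  then show ?thesis by (simp only: lim)
qed

text \<open>The indicator normalises by the order of the function itself, so the orders of
  \<open>A\<close> and \<open>B\<close> have to be exactly \<open>n\<close>. The lower bound comes
  by contraposition: an order below \<open>n\<close> would mean minimal type.\<close>

lemma growth_order_eqI:
  assumes "g holomorphic_on UNIV" "L > 0"
    and "\<forall>\<^sub>F r in at_top. \<forall>z. norm z = r \<longrightarrow> norm (g z) \<le> exp (L * r ^ n)"
    and "\<not> minimal_type n g"
  shows "growth_order g = ereal (real n)"
  using growth_order_le[OF assms(2,3)] growth_order_less_imp_minimal_type[OF assms(1), of n] assms(4)
  by (metis antisym_conv2)

section \<open>Indicators and the position of the exponents\<close>

lemma pl_indicator_less_imp_exp_type_below:
  assumes ord: "growth_order g = ereal (real n)" and less: "pl_indicator g \<theta> < ereal x"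
  shows "exp_type_below n x (\<lambda>r. g (of_real r * cis \<theta>))"
proof -
  obtain y where y: "pl_indicator g \<theta> < ereal y" "y < x" using ereal_dense2[OF less] by auto
  have "\<forall>\<^sub>F r in at_top. ereal (r powr - real n) * ext_ln (norm (g (of_real r * cis \<theta>))) < ereal y"
    using y(1) unfolding pl_indicator_def ord by (intro Limsup_lessD) simp
  then have "\<forall>\<^sub>F r in at_top. norm (g (of_real r * cis \<theta>)) \<le> exp (y * r ^ n)"
    using eventually_gt_at_top[of 0]
  proof eventually_elim
    case (elim r)
    show ?case
    proof (cases "g (of_real r * cis \<theta>) = 0")
      case False
      have "r powr - real n * ln (norm (g (of_real r * cis \<theta>))) < y"
        using elim(1) False by (simp add: ext_ln_def)
      then have "ln (norm (g (of_real r * cis \<theta>))) < y * r ^ n"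
        using elim(2) by (simp add: powr_minus powr_realpow field_simps)
      then have "exp (ln (norm (g (of_real r * cis \<theta>)))) \<le> exp (y * r ^ n)" by simp
      then show ?thesis using False by simp
    qed simp
  qed
  then show ?thesis using y unfolding exp_type_below_def by blast
qed

lemma exp_type_below_imp_pl_indicator_le:
  assumes ord: "growth_order g = ereal (real n)" and below: "exp_type_below n x (\<lambda>r. g (of_real r * cis \<theta>))"
  shows "pl_indicator g \<theta> \<le> ereal x"
proof -
  obtain y where y: "y < x" "\<forall>\<^sub>F r in at_top. norm (g (of_real r * cis \<theta>)) \<le> exp (y * r ^ n)"
    using below unfolding exp_type_below_def by blast
  have "\<forall>\<^sub>F r in at_top. ereal (r powr - real n) * ext_ln (norm (g (of_real r * cis \<theta>))) \<le> ereal x"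
    using y(2) eventually_gt_at_top[of 0]
  proof eventually_elim
    case (elim r)
    show ?case
    proof (cases "g (of_real r * cis \<theta>) = 0")
      case True
      then show ?thesis using elim(2) by (simp add: ext_ln_def)
    next
      case False
      then have "ln (norm (g (of_real r * cis \<theta>))) \<le> y * r ^ n"
        using elim(1) by (metis ln_exp ln_le_cancel_iff exp_gt_zero zero_less_norm_iff)
      then have "r powr - real n * ln (norm (g (of_real r * cis \<theta>))) \<le> y"
        using elim(2) by (simp add: powr_minus powr_realpow field_simps)
      then show ?thesis using False y(1) by (simp add: ext_ln_def)
    qed
  qed
  then show ?thesis unfolding pl_indicator_def ord by (intro Limsup_bounded) simp
qed

text \<open>By continuity the inequality on a dense set of directions gives its weak form on the
  whole half-plane where \<open>w\<close> has positive real part after rotation. Directions near the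
  boundary of the half-plane then force \<open>z / w\<close> to be real, and one strict instance
  makes it exceed \<open>2\<close>.\<close>

lemma double_Re_dense_imp_multiple:
  fixes w z :: complex
  assumes n: "n > 0" and w: "w \<noteq> 0"
    and dense: "\<And>\<alpha> \<beta>. \<alpha> < \<beta> \<Longrightarrow> (\<And>\<theta>. \<alpha> < \<theta> \<Longrightarrow> \<theta> < \<beta> \<Longrightarrow> Re (w * cis (real n * \<theta>)) > 0) \<Longrightarrow>
      \<exists>\<theta>. \<alpha> < \<theta> \<and> \<theta> < \<beta> \<and> Re (z * cis (real n * \<theta>)) > 2 * Re (w * cis (real n * \<theta>))"
  obtains c where "0 < c" "c < 1 / 2" "w = of_real c * z"
proof -
  have le: "Re (z * cis (real n * \<theta>)) \<ge> 2 * Re (w * cis (real n * \<theta>))"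
    if pos: "Re (w * cis (real n * \<theta>)) > 0" for \<theta>
  proof (rule ccontr)
    define u where "u = 2 * w - z"
    have Re_u: "Re (u * cis t) = 2 * Re (w * cis t) - Re (z * cis t)" for t
      by (simp add: u_def algebra_simps)
    assume "\<not> ?thesis"
    then have u: "Re (u * cis (real n * \<theta>)) > 0" unfolding Re_u by linarith
    have t: "\<theta> - 1 < \<theta>" "\<theta> < \<theta> + 1" by auto
    obtain a b where ab: "a < \<theta>" "\<theta> < b" "\<And>s. a < s \<Longrightarrow> s < b \<Longrightarrow> Re (w * cis (real n * s)) > 0"
      using exists_interval_pos[OF isCont_Re_mult_cis t pos] by metis
    obtain a' b' where ab': "a \<le> a'" "a' < \<theta>" "\<theta> < b'" "b' \<le> b" "\<And>s. a' < s \<Longrightarrow> s < b' \<Longrightarrow> Re (u * cis (real n * s)) > 0"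
      using exists_interval_pos[OF isCont_Re_mult_cis ab(1,2) u] by metis
    have "\<exists>\<theta>. a' < \<theta> \<and> \<theta> < b' \<and> Re (z * cis (real n * \<theta>)) > 2 * Re (w * cis (real n * \<theta>))"
      using ab ab' by (intro dense) auto
    then obtain s where "a' < s" "s < b'" "Re (z * cis (real n * s)) > 2 * Re (w * cis (real n * s))" by blast
    then show False using ab'(5)[of s] unfolding Re_u by linarith
  qed
  define \<tau> where "\<tau> = z / w"
  have zw: "z = \<tau> * w" using w by (simp add: \<tau>_def)
  \<comment> \<open>\<open>\<phi> = arctan s\<close> runs through all directions of the half-plane,
    measured from the one that makes \<open>w\<close> positive. Division by
    \<open>cos \<phi>\<close> leaves an inequality affine in \<open>s\<close>, which can hold for
    all real \<open>s\<close> only with slope \<open>0\<close>.\<close>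
  have key: "Re \<tau> - 2 \<ge> Im \<tau> * s" for s
  proof -
    define \<phi> where "\<phi> = arctan s"
    define \<theta> where "\<theta> = (\<phi> - Arg w) / real n"
    have "w * cis (real n * \<theta>) = rcis (norm w) (Arg w) * cis (\<phi> - Arg w)"
      using n by (simp add: \<theta>_def rcis_cmod_Arg)
    then have wc: "w * cis (real n * \<theta>) = of_real (norm w) * cis \<phi>"
      by (simp add: rcis_def mult.assoc cis_mult)
    have cos: "cos \<phi> > 0" using cos_gt_zero_pi[of \<phi>] arctan_bounded[of s] by (simp add: \<phi>_def)
    have "Re (z * cis (real n * \<theta>)) = Re (\<tau> * (of_real (norm w) * cis \<phi>))" by (simp only: zw mult.assoc wc)
    also have "\<dots> = norm w * (Re \<tau> * cos \<phi> - Im \<tau> * sin \<phi>)" by (simp add: algebra_simps)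
    finally have "norm w * (Re \<tau> * cos \<phi> - Im \<tau> * sin \<phi>) \<ge> 2 * (norm w * cos \<phi>)"
      using le[of \<theta>] wc cos w by simp
    then have "norm w * (Re \<tau> * cos \<phi> - Im \<tau> * sin \<phi>) \<ge> norm w * (2 * cos \<phi>)" by simp
    then have "Re \<tau> * cos \<phi> - Im \<tau> * sin \<phi> \<ge> 2 * cos \<phi>" using w by (simp only: mult_le_cancel_left) auto
    moreover have "sin \<phi> = s * cos \<phi>" using cos tan_arctan[of s] by (simp add: \<phi>_def tan_def field_simps)
    ultimately have "(Re \<tau> - 2) * cos \<phi> \<ge> (Im \<tau> * s) * cos \<phi>" by (simp add: algebra_simps)
    then show ?thesis using cos by simp
  qed
  have Im: "Im \<tau> = 0"
  proof (rule ccontr)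
    assume "Im \<tau> \<noteq> 0"
    then show False using key[of "(Re \<tau> - 1) / Im \<tau>"] by simp
  qed
  then have \<tau>: "\<tau> = of_real (Re \<tau>)" by (simp add: complex_eq_iff)
  obtain a b where ab: "a < b" "\<And>\<theta>. a < \<theta> \<Longrightarrow> \<theta> < b \<Longrightarrow> Re (w * cis (real n * \<theta>)) > norm w / 2"
    using exists_interval_Re_pos[OF w n] by blast
  have pos: "Re (w * cis (real n * \<theta>)) > 0" if "a < \<theta>" "\<theta> < b" for \<theta>
    using ab(2)[OF that] norm_ge_zero[of w] by linarith
  obtain \<theta> where \<theta>: "a < \<theta>" "\<theta> < b" "Re (z * cis (real n * \<theta>)) > 2 * Re (w * cis (real n * \<theta>))"
    using dense[OF ab(1) pos] by blast
  have "Re (z * cis (real n * \<theta>)) = Re (of_real (Re \<tau>) * (w * cis (real n * \<theta>)))"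
    by (subst zw, subst \<tau>) (simp only: mult.assoc)
  also have "\<dots> = Re \<tau> * Re (w * cis (real n * \<theta>))" by (simp only: Re_complex_of_real Im_complex_of_real times_complex.simps mult_zero_left diff_zero)
  finally have "2 * Re (w * cis (real n * \<theta>)) < Re \<tau> * Re (w * cis (real n * \<theta>))" using \<theta>(3) by linarith
  then have "2 < Re \<tau>" using pos[OF \<theta>(1,2)] mult_less_cancel_right_pos by blast
  moreover have "w = of_real (1 / Re \<tau>) * z" using \<open>2 < Re \<tau>\<close> by (subst zw, subst \<tau>) simp
  ultimately show ?thesis by (intro that[of "1 / Re \<tau>"]) auto
qed

lemma exponential_sum_growth_order:
  fixes T :: "'i \<Rightarrow> complex \<Rightarrow> complex" and \<zeta> :: "'i \<Rightarrow> complex"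
  assumes n: "n > 0" and J: "finite J" and inj: "inj_on \<zeta> J"
    and T: "\<And>j. j \<in> J \<Longrightarrow> minimal_type n (T j)"
    and nz: "\<And>j. j \<in> J \<Longrightarrow> \<zeta> j \<noteq> 0 \<Longrightarrow> \<exists>z. T j z \<noteq> 0"
    and k: "k \<in> J" "\<zeta> k \<noteq> 0"
  shows "growth_order (\<lambda>z. \<Sum>j\<in>J. T j z * exp (\<zeta> j * z ^ n)) = ereal (real n)"
proof -
  obtain L where "L > 0" "\<forall>\<^sub>F r in at_top. \<forall>z. norm z = r \<longrightarrow> norm (\<Sum>j\<in>J. T j z * exp (\<zeta> j * z ^ n)) \<le> exp (L * r ^ n)"
    using exponential_sum_eventually_le[where T = T and \<zeta> = \<zeta>, OF n J T] by blast
  moreover have "\<not> minimal_type n (\<lambda>z. \<Sum>j\<in>J. T j z * exp (\<zeta> j * z ^ n))"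
    by (rule exponential_sum_not_minimal_type[OF n J inj T nz k])
  moreover have "(\<lambda>z. \<Sum>j\<in>J. T j z * exp (\<zeta> j * z ^ n)) holomorphic_on UNIV"
    using T by (intro holomorphic_intros minimal_type_holomorphic) auto
  ultimately show ?thesis by (intro growth_order_eqI)
qed

text \<open>On a ray of maximal growth for \<open>B\<close>, with largest real part
  \<open>x > 0\<close> among its exponents, the indicator of \<open>B\<close> is at least
  \<open>x\<close>, so that of \<open>A\<close> exceeds \<open>2 x\<close>. No exponent of
  \<open>B\<close> accounts for this, hence the exponent \<open>\<zeta> l\<close> must. Such rays
  are dense in the sectors where the \<open>k\<close>-th exponential grows.\<close>

lemma indicator_gap_imp_multiple:
  fixes T :: "'i \<Rightarrow> complex \<Rightarrow> complex" and \<zeta> :: "'i \<Rightarrow> complex"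
  assumes n: "n > 0" and J: "finite J" and inj: "inj_on \<zeta> J"
    and T: "\<And>j. j \<in> J \<Longrightarrow> minimal_type n (T j)"
    and nz: "\<And>j. j \<in> J \<Longrightarrow> \<zeta> j \<noteq> 0 \<Longrightarrow> \<exists>z. T j z \<noteq> 0"
    and A: "A = (\<lambda>z. \<Sum>j\<in>J. T j z * exp (\<zeta> j * z ^ n))"
    and B: "B = (\<lambda>z. \<Sum>j\<in>J - {l}. T j z * exp (\<zeta> j * z ^ n))"
    and gap: "\<And>\<theta>. pl_indicator B \<theta> > 0 \<Longrightarrow> pl_indicator A \<theta> > 2 * pl_indicator B \<theta>"
    and k: "k \<in> J - {l}" "\<zeta> k \<noteq> 0"
  obtains c where "0 < c" "c < 1 / 2" "\<zeta> k = of_real c * \<zeta> l"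
proof (rule double_Re_dense_imp_multiple[OF n k(2)])
  fix \<alpha> \<beta> :: real
  assume ab: "\<alpha> < \<beta>" and pos: "\<And>\<theta>. \<alpha> < \<theta> \<Longrightarrow> \<theta> < \<beta> \<Longrightarrow> Re (\<zeta> k * cis (real n * \<theta>)) > 0"
  have ordA: "growth_order A = ereal (real n)"
    unfolding A using k by (intro exponential_sum_growth_order[OF n J inj T nz]) auto
  have inj': "inj_on \<zeta> (J - {l})" using inj by (rule inj_on_subset) auto
  have ordB: "growth_order B = ereal (real n)"
    unfolding B using k J inj' by (intro exponential_sum_growth_order[OF n] T nz) auto
  obtain \<theta> i where \<theta>: "\<alpha> < \<theta>" "\<theta> < \<beta>" "i \<in> J - {l}"
    "\<And>j. j \<in> J - {l} \<Longrightarrow> Re (\<zeta> j * cis (real n * \<theta>)) \<le> Re (\<zeta> i * cis (real n * \<theta>))"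
    and nb: "\<not> exp_type_below n (Re (\<zeta> i * cis (real n * \<theta>))) (\<lambda>r. B (of_real r * cis \<theta>))"
    unfolding B
    using exists_ray_of_maximal_growth[where T = T and \<zeta> = \<zeta> and J = "J - {l}" and k = k, OF n _ _ inj' T nz ab _ pos] J k
    by blast
  define x where "x = Re (\<zeta> i * cis (real n * \<theta>))"
  have x: "x > 0" "Re (\<zeta> k * cis (real n * \<theta>)) \<le> x"
    using pos[OF \<theta>(1,2)] \<theta>(4)[OF k(1)] unfolding x_def by linarith+
  have plB: "pl_indicator B \<theta> \<ge> ereal x"
    using pl_indicator_less_imp_exp_type_below[OF ordB, of \<theta> x] nb unfolding x_def by force
  then have "pl_indicator B \<theta> > 0" using x(1) by (metis ereal_less(2) less_le_trans)
  then have "2 * pl_indicator B \<theta> < pl_indicator A \<theta>" by (rule gap)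
  moreover have "ereal (2 * x) \<le> 2 * pl_indicator B \<theta>"
    using ereal_mult_left_mono[OF plB, of 2] by simp
  ultimately have "ereal (2 * x) < pl_indicator A \<theta>" by simp
  then obtain y where y: "2 * x < y" "ereal y < pl_indicator A \<theta>" using ereal_dense2 by force
  have "Re (\<zeta> l * cis (real n * \<theta>)) > 2 * Re (\<zeta> k * cis (real n * \<theta>))"
  proof (rule ccontr)
    assume *: "\<not> ?thesis"
    have less: "Re (\<zeta> j * cis (real n * \<theta>)) < y" if "j \<in> J" for j
    proof (cases "j = l")
      case True
      show ?thesis using * x y(1) unfolding True by linarith
    next
      case False
      then show ?thesis using \<theta>(4)[of j] that x y unfolding x_def by force
    qed
    then have "exp_type_below n y (\<lambda>r. A (of_real r * cis \<theta>))"
      unfolding A using J T by (intro exp_type_below_sum exp_type_below_term n) auto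
    then have "pl_indicator A \<theta> \<le> ereal y" by (rule exp_type_below_imp_pl_indicator_le[OF ordA])
    then show False using y(2) by simp
  qed
  then show "\<exists>\<theta>. \<alpha> < \<theta> \<and> \<theta> < \<beta> \<and> Re (\<zeta> l * cis (real n * \<theta>)) > 2 * Re (\<zeta> k * cis (real n * \<theta>))"
    using \<theta> by blast
qed (use that in blast)

section \<open>The WKB defect\<close>

definition log_deriv :: "(complex \<Rightarrow> complex) \<Rightarrow> complex \<Rightarrow> complex" where
  "log_deriv f z = deriv f z / f z"

definition shifted_log_deriv :: "(complex \<Rightarrow> complex) \<Rightarrow> (complex \<Rightarrow> complex) \<Rightarrow> complex \<Rightarrow> complex" where
  "shifted_log_deriv f h z = log_deriv f z + log_deriv h z / 4"

text \<open>The inhomogeneity in the Riccati equation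
  \<open>v' = (R/2) v - v^2 - h - \<beta>\<close> for the shifted logarithmic derivative
  \<open>v\<close>, where \<open>R = h'/h\<close>.\<close>

definition shifted_potential :: "(complex \<Rightarrow> complex) \<Rightarrow> (complex \<Rightarrow> complex) \<Rightarrow> complex \<Rightarrow> complex" where
  "shifted_potential B h z = B z + (log_deriv h z)\<^sup>2 / 16 - deriv (log_deriv h) z / 4"

text \<open>Where \<open>h\<close> dominates \<open>A = B + h\<close>, the WKB solutions have
  \<open>f'/f \<approx> \<plusminus> \<i> sqrt h - h'/(4 h)\<close>; the defect measures the deviation from that behaviour, since it
  vanishes if \<open>f'/f + h'/(4 h)\<close> is a constant multiple of \<open>sqrt h\<close>.\<close>
definition wkb_defect :: "(complex \<Rightarrow> complex) \<Rightarrow> (complex \<Rightarrow> complex) \<Rightarrow> complex \<Rightarrow> complex" where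
  "wkb_defect f h z =
     2 * deriv (shifted_log_deriv f h) z - log_deriv h z * shifted_log_deriv f h z"

lemma holomorphic_on_log_deriv:
  "f holomorphic_on S \<Longrightarrow> open S \<Longrightarrow> (\<And>z. z \<in> S \<Longrightarrow> f z \<noteq> 0) \<Longrightarrow> log_deriv f holomorphic_on S"
  unfolding log_deriv_def by (intro holomorphic_intros holomorphic_deriv)

lemma holomorphic_on_shifted_log_deriv:
  assumes "open S" "f holomorphic_on S" "h holomorphic_on S"
    "\<And>z. z \<in> S \<Longrightarrow> f z \<noteq> 0" "\<And>z. z \<in> S \<Longrightarrow> h z \<noteq> 0"
  shows "shifted_log_deriv f h holomorphic_on S"
  unfolding shifted_log_deriv_def by (intro holomorphic_intros holomorphic_on_log_deriv assms) auto

lemma holomorphic_on_shifted_potential: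
  assumes "open S" "B holomorphic_on S" "h holomorphic_on S" "\<And>z. z \<in> S \<Longrightarrow> h z \<noteq> 0"
  shows "shifted_potential B h holomorphic_on S"
  unfolding shifted_potential_def
  by (intro holomorphic_intros holomorphic_on_log_deriv holomorphic_deriv assms) auto

lemma holomorphic_on_wkb_defect:
  assumes "open S" "f holomorphic_on S" "h holomorphic_on S"
    "\<And>z. z \<in> S \<Longrightarrow> f z \<noteq> 0" "\<And>z. z \<in> S \<Longrightarrow> h z \<noteq> 0"
  shows "wkb_defect f h holomorphic_on S"
  unfolding wkb_defect_def
  by (intro holomorphic_intros holomorphic_on_log_deriv holomorphic_deriv holomorphic_on_shifted_log_deriv assms) auto

text \<open>The Riccati equation of \<open>f'/f\<close>, rewritten for the shifted logarithmic
  derivative \<open>v\<close>, eliminates \<open>v'\<close>. This algebraic form shows how far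
  \<open>v^2\<close> is from \<open>- h\<close>, and its denominators can be cleared
  directly.\<close>

lemma wkb_defect_eq:
  assumes S: "open S" "z \<in> S" and f: "f holomorphic_on S" and h: "h holomorphic_on S"
    and nz: "\<And>z. z \<in> S \<Longrightarrow> f z \<noteq> 0" "\<And>z. z \<in> S \<Longrightarrow> h z \<noteq> 0"
    and ode: "deriv (deriv f) z + (B z + h z) * f z = 0"
  shows "wkb_defect f h z = - 2 * ((shifted_log_deriv f h z)\<^sup>2 + h z + shifted_potential B h z)"
proof -
  define u where "u = log_deriv f z"
  have fz: "f z \<noteq> 0" using nz S by blast
  have df: "(f has_field_derivative deriv f z) (at z)"
    using holomorphic_derivI[OF f S(1,2)] .
  have ddf: "(deriv f has_field_derivative deriv (deriv f) z) (at z)"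
    using holomorphic_derivI[OF holomorphic_deriv[OF f S(1)] S(1,2)] .
  have dR: "(log_deriv h has_field_derivative deriv (log_deriv h) z) (at z)"
    using holomorphic_derivI[OF holomorphic_on_log_deriv[OF h S(1) nz(2)] S(1,2)] .
  have "((\<lambda>z. deriv f z / f z) has_field_derivative (deriv (deriv f) z * f z - deriv f z * deriv f z) / (f z * f z)) (at z)"
    by (rule DERIV_divide[OF ddf df fz])
  moreover have "(deriv (deriv f) z * f z - deriv f z * deriv f z) / (f z * f z) = - (B z + h z) - u\<^sup>2"
  proof -
    have "deriv (deriv f) z = - ((B z + h z) * f z)" using ode by (simp add: eq_neg_iff_add_eq_0)
    then show ?thesis unfolding u_def log_deriv_def using fz by (simp only:) (simp add: field_simps power2_eq_square)
  qed
  ultimately have du: "(log_deriv f has_field_derivative - (B z + h z) - u\<^sup>2) (at z)"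
    by (simp add: log_deriv_def[abs_def])
  have "(shifted_log_deriv f h has_field_derivative (- (B z + h z) - u\<^sup>2) + deriv (log_deriv h) z / 4) (at z)"
    unfolding shifted_log_deriv_def by (intro DERIV_add du DERIV_cdivide dR)
  then have "deriv (shifted_log_deriv f h) z = (- (B z + h z) - u\<^sup>2) + deriv (log_deriv h) z / 4"
    by (rule DERIV_imp_deriv)
  then show ?thesis
    unfolding wkb_defect_def shifted_potential_def
    by (simp add: shifted_log_deriv_def u_def power2_eq_square algebra_simps)
qed

text \<open>Differentiating the algebraic form and eliminating \<open>v'\<close> and
  \<open>h\<close> leaves an equation linear in the defect: the terms with \<open>v^2\<close>
  cancel, precisely because the shift is \<open>h'/(4 h)\<close>. The coefficient of the defect
  contains \<open>2 v\<close>, which is large where \<open>h\<close> is.\<close>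

lemma deriv_wkb_defect:
  assumes S: "open S" "z \<in> S" and f: "f holomorphic_on S" and h: "h holomorphic_on S"
    and B: "B holomorphic_on S"
    and nz: "\<And>z. z \<in> S \<Longrightarrow> f z \<noteq> 0" "\<And>z. z \<in> S \<Longrightarrow> h z \<noteq> 0"
    and ode: "\<And>z. z \<in> S \<Longrightarrow> deriv (deriv f) z + (B z + h z) * f z = 0"
  shows "deriv (wkb_defect f h) z =
     (log_deriv h z - 2 * shifted_log_deriv f h z) * wkb_defect f h z
       + 2 * (log_deriv h z * shifted_potential B h z - deriv (shifted_potential B h) z)"
proof -
  let ?v = "shifted_log_deriv f h" and ?\<beta> = "shifted_potential B h"
  have dv: "(?v has_field_derivative deriv ?v z) (at z)"
    using holomorphic_derivI[OF holomorphic_on_shifted_log_deriv[OF S(1) f h nz] S] .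
  have d\<beta>: "(?\<beta> has_field_derivative deriv ?\<beta> z) (at z)"
    using holomorphic_derivI[OF holomorphic_on_shifted_potential[OF S(1) B h nz(2)] S] .
  have dh: "(h has_field_derivative deriv h z) (at z)" using holomorphic_derivI[OF h S] .
  have eq: "wkb_defect f h y = - 2 * ((?v y)\<^sup>2 + h y + ?\<beta> y)" if "y \<in> S" for y
    by (rule wkb_defect_eq[where B = B, OF S(1) that f h nz ode[OF that]])
  have "((\<lambda>y. - 2 * (?v y * ?v y + h y + ?\<beta> y)) has_field_derivative
      - 2 * ((deriv ?v z * ?v z + deriv ?v z * ?v z) + deriv h z + deriv ?\<beta> z)) (at z)"
    by (intro DERIV_cmult DERIV_add DERIV_mult dv d\<beta> dh)
  then have "(wkb_defect f h has_field_derivative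
      - 2 * ((deriv ?v z * ?v z + deriv ?v z * ?v z) + deriv h z + deriv ?\<beta> z)) (at z)"
    by (rule has_field_derivative_transform_within_open[OF _ S])
      (simp add: eq power2_eq_square)
  then have "deriv (wkb_defect f h) z = - 2 * ((deriv ?v z * ?v z + deriv ?v z * ?v z) + deriv h z + deriv ?\<beta> z)"
    by (rule DERIV_imp_deriv)
  moreover have "2 * deriv ?v z = wkb_defect f h z + log_deriv h z * ?v z"
    by (simp add: wkb_defect_def)
  then have "deriv ?v z = (wkb_defect f h z + log_deriv h z * ?v z) / 2"
    by (metis nonzero_mult_div_cancel_left zero_neq_numeral)
  moreover have "deriv h z = log_deriv h z * h z" using nz(2)[OF S(2)] by (simp add: log_deriv_def)
  moreover have "h z = - wkb_defect f h z / 2 - (?v z)\<^sup>2 - ?\<beta> z" by (simp add: eq[OF S(2)] field_simps)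
  ultimately show ?thesis by (simp add: power2_eq_square algebra_simps)
qed

text \<open>The first order linear equation for the defect in \<open>deriv_wkb_defect\<close> has a huge coefficient
  where \<open>h\<close> is large, so that Cauchy estimates on two shrinking discs bootstrap a crude bound on the
  defect to a small one. All losses are powers of \<open>q\<close>.\<close>
lemma wkb_defect_bound:
  fixes q E b \<rho> :: real
  assumes \<rho>: "0 < \<rho>" "\<rho> \<le> 1" "1 \<le> q * \<rho>" and q: "q \<ge> 100" and b: "1 \<le> b" "b \<le> E"
    and f: "f holomorphic_on ball z \<rho>" and h: "h holomorphic_on ball z \<rho>" and B: "B holomorphic_on ball z \<rho>"
    and nz: "\<And>y. y \<in> ball z \<rho> \<Longrightarrow> f y \<noteq> 0" "\<And>y. y \<in> ball z \<rho> \<Longrightarrow> h y \<noteq> 0"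
    and ode: "\<And>y. y \<in> ball z \<rho> \<Longrightarrow> deriv (deriv f) y + (B y + h y) * f y = 0"
    and R: "\<And>y. y \<in> ball z \<rho> \<Longrightarrow> norm (log_deriv h y) \<le> q"
    and B_le: "\<And>y. y \<in> ball z \<rho> \<Longrightarrow> norm (B y) \<le> b * q"
    and A_le: "\<And>y. y \<in> ball z \<rho> \<Longrightarrow> norm (B y + h y) \<le> E\<^sup>2 * q"
    and h_ge: "\<And>y. y \<in> ball z \<rho> \<Longrightarrow> q ^ 7 \<le> E \<Longrightarrow> E\<^sup>2 / q \<le> norm (h y)"
  shows "norm (wkb_defect f h z) \<le> q ^ 19 * b / E"
proof -
  let ?v = "shifted_log_deriv f h" and ?\<beta> = "shifted_potential B h" and ?D = "wkb_defect f h" and ?R = "log_deriv h"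
  have E: "E \<ge> 1" using b by linarith
  have qpos: "q > 0" "q \<ge> 1" using q by auto
  have inv: "1 / \<rho> \<le> q" using \<rho> by (simp add: field_simps)
  have holR: "?R holomorphic_on ball z \<rho>" by (rule holomorphic_on_log_deriv[OF h open_ball nz(2)])
  have holv: "?v holomorphic_on ball z \<rho>" by (rule holomorphic_on_shifted_log_deriv[OF open_ball f h nz])
  have hol\<beta>: "?\<beta> holomorphic_on ball z \<rho>" by (rule holomorphic_on_shifted_potential[OF open_ball B h nz(2)])
  have holD: "?D holomorphic_on ball z \<rho>" by (rule holomorphic_on_wkb_defect[OF open_ball f h nz])
  \<comment> \<open>Shrinking the disc by \<open>\<rho> / k\<close> costs a factor
    \<open>k q\<close>, because \<open>1 / \<rho> \<le> q\<close>.\<close>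
  have cauchy: "norm (deriv g y) \<le> M * (k * q)"
    if g: "g holomorphic_on ball z \<rho>" and M: "\<And>y. y \<in> ball z s \<Longrightarrow> norm (g y) \<le> M" and y: "y \<in> ball z t"
      and s: "t < s" "s \<le> \<rho>" "s - t = \<rho> / k" and k: "k > 0" for g M s t k y
  proof -
    have g': "g holomorphic_on ball z s" using g subset_ball[OF s(2)] by (rule holomorphic_on_subset)
    have "norm (deriv g y) \<le> M / (s - t)" by (rule norm_deriv_le_ball_sub[OF g' M y s(1)])
    also have "\<dots> = M * (k * (1 / \<rho>))" by (simp add: s(3))
    also have "\<dots> \<le> M * (k * q)"
    proof (intro mult_left_mono inv)
      have "y \<in> ball z s" using y s(1) by simp
      from M[OF this] show "0 \<le> M" using norm_ge_zero order_trans by blast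
    qed (use k in simp)
    finally show ?thesis .
  qed
  have pow: "q ^ i \<le> q ^ j" if "i \<le> j" for i j using that qpos by (intro power_increasing)
  \<comment> \<open>Numerical constants up to \<open>100\<close> are paid for by one more power of
    \<open>q\<close>.\<close>
  have absorb: "c * q ^ i \<le> q ^ (Suc i)" if "c \<le> 100" for c i
    using mult_right_mono[of c q "q ^ i"] that q by simp
  have absorbE: "c * (a * q ^ i) \<le> a * q ^ (Suc i)" if "c \<le> 100" "a \<ge> 0" for c a i
    using mult_left_mono[OF absorb[OF that(1)] that(2), of i] by (simp add: algebra_simps)
  have sub2: "ball z (\<rho> / 2) \<subseteq> ball z \<rho>" and sub4: "ball z (\<rho> / 4) \<subseteq> ball z (\<rho> / 2)"
    and sub8: "ball z (\<rho> / 8) \<subseteq> ball z (\<rho> / 4)" using \<rho> by (intro subset_ball; simp)+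
  have u_le: "norm (log_deriv f y) \<le> E * q ^ 3" if y: "y \<in> ball z (\<rho> / 2)" for y
  proof -
    have sub: "ball y (\<rho> / 2) \<subseteq> ball z \<rho>"
    proof
      fix x assume "x \<in> ball y (\<rho> / 2)"
      then show "x \<in> ball z \<rho>" using y dist_triangle[of z x y] by simp
    qed
    have "norm (deriv f y / f y) \<le> 12 * (E * q) / (\<rho> / 2)"
    proof (rule log_deriv_bound[where A = "\<lambda>x. B x + h x"])
      show "f holomorphic_on ball y (\<rho> / 2)" using f sub by (rule holomorphic_on_subset)
      show "norm (B x + h x) \<le> (E * q)\<^sup>2" if "x \<in> ball y (\<rho> / 2)" for x
      proof -
        have "q \<le> q\<^sup>2" using pow[of 1 2] by simp
        then have "E\<^sup>2 * q \<le> E\<^sup>2 * q\<^sup>2" by (intro mult_left_mono) auto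
        then show ?thesis using A_le[OF subsetD[OF sub that]] by (simp add: power_mult_distrib)
      qed
      show "1 \<le> E * q" using E qpos mult_mono[of 1 E 1 q] by simp
    qed (use \<rho> sub nz ode in auto)
    also have "\<dots> = 24 * (E * q) * (1 / \<rho>)" using \<rho> by (simp add: field_simps)
    also have "\<dots> \<le> 24 * (E * q) * q" using E qpos by (intro mult_left_mono inv) auto
    also have "\<dots> = 24 * (E * q ^ 2)" by (simp add: power2_eq_square)
    also have "\<dots> \<le> E * q ^ Suc 2" using E by (intro absorbE) auto
    finally show ?thesis by (simp add: log_deriv_def)
  qed
  have v_le: "norm (?v y) \<le> 2 * (E * q ^ 3)" if y: "y \<in> ball z (\<rho> / 2)" for y
  proof -
    have "norm (?v y) \<le> norm (log_deriv f y) + norm (?R y / 4)"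
      unfolding shifted_log_deriv_def by (rule norm_triangle_ineq)
    also have "norm (?R y / 4) \<le> q ^ 1" using R[of y] y sub2 qpos by (auto simp: norm_divide)
    also have "q ^ 1 \<le> q ^ 3" by (rule pow) simp
    also have "q ^ 3 \<le> E * q ^ 3" using mult_right_mono[OF E, of "q ^ 3"] qpos by simp
    finally show ?thesis using u_le[OF y] by simp
  qed
  have D_le: "norm (?D y) \<le> E * q ^ 5" if y: "y \<in> ball z (\<rho> / 4)" for y
  proof -
    have y2: "y \<in> ball z (\<rho> / 2)" using y sub4 by blast
    have "norm (deriv ?v y) \<le> 2 * (E * q ^ 3) * (4 * q)"
      by (rule cauchy[where s = "\<rho> / 2", OF holv v_le y]) (use \<rho> in auto)
    moreover have "norm (?R y * ?v y) \<le> q * (2 * (E * q ^ 3))"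
      unfolding norm_mult using R[of y] v_le[OF y2] y2 sub2 qpos by (intro mult_mono) auto
    moreover have "norm (?D y) \<le> 2 * norm (deriv ?v y) + norm (?R y * ?v y)"
      unfolding wkb_defect_def using norm_triangle_ineq4[of "2 * deriv ?v y" "?R y * ?v y"] by (simp add: norm_mult)
    ultimately have "norm (?D y) \<le> 18 * (E * q ^ 4)" by (simp add: power_numeral_reduce algebra_simps)
    also have "\<dots> \<le> E * q ^ Suc 4" using E by (intro absorbE) auto
    finally show ?thesis by simp
  qed
  show ?thesis
  proof (cases "q ^ 7 \<le> E")
    case False
    \<comment> \<open>For small \<open>E\<close> the crude bound suffices:
      \<open>E^2 \<le> q^14\<close> gives \<open>E q^5 \<le> q^19 / E\<close>. This case dictates
      the exponent \<open>19\<close>; the estimates of the other case are padded to match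
      it.\<close>
    then have "E * E \<le> q ^ 7 * q ^ 7" using E qpos by (intro mult_mono) auto
    then have "E * E * q ^ 5 \<le> (q ^ 7 * q ^ 7) * q ^ 5" using qpos by (intro mult_right_mono) auto
    also have "\<dots> = q ^ 19 * 1" by (simp flip: power_add)
    also have "\<dots> \<le> q ^ 19 * b" using b qpos by (intro mult_left_mono) auto
    finally have "E * q ^ 5 \<le> q ^ 19 * b / E" using E by (simp add: field_simps)
    then show ?thesis using D_le[of z] \<rho> by simp
  next
    case True
    have R'_le: "norm (deriv ?R y) \<le> 2 * q\<^sup>2" if y: "y \<in> ball z (\<rho> / 2)" for y
    proof -
      have "norm (deriv ?R y) \<le> q * (2 * q)"
        by (rule cauchy[where s = \<rho>, OF holR R y]) (use \<rho> in auto)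
      then show ?thesis by (simp add: power2_eq_square)
    qed
    have \<beta>_le: "norm (?\<beta> y) \<le> 2 * (b * q\<^sup>2)" if y: "y \<in> ball z (\<rho> / 2)" for y
    proof -
      have y1: "y \<in> ball z \<rho>" using y sub2 by blast
      have "norm (?\<beta> y) \<le> norm (B y) + norm ((?R y)\<^sup>2 / 16) + norm (deriv ?R y / 4)"
        unfolding shifted_potential_def
        using norm_triangle_ineq4[of "B y + (?R y)\<^sup>2 / 16" "deriv ?R y / 4"] norm_triangle_ineq[of "B y" "(?R y)\<^sup>2 / 16"] by linarith
      also have "norm ((?R y)\<^sup>2 / 16) \<le> q\<^sup>2 / 16"
        using R[OF y1] by (simp add: norm_divide norm_power power_mono)
      also have "norm (deriv ?R y / 4) \<le> 2 * q\<^sup>2 / 4" using R'_le[OF y] by (simp add: norm_divide)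
      also have "norm (B y) \<le> b * q\<^sup>2"
      proof -
        have "b * q ^ 1 \<le> b * q ^ 2" using b pow[of 1 2] by (intro mult_left_mono) auto
        then show ?thesis using B_le[OF y1] by simp
      qed
      finally have "norm (?\<beta> y) \<le> b * q\<^sup>2 + q\<^sup>2 / 16 + 2 * q\<^sup>2 / 4" by simp
      moreover have "q\<^sup>2 \<le> b * q\<^sup>2" using mult_right_mono[OF b(1), of "q\<^sup>2"] by simp
      ultimately show ?thesis using zero_le_power2[of q] by argo
    qed
    have inhom: "norm (2 * (?R y * ?\<beta> y - deriv ?\<beta> y)) \<le> b * q ^ 4" if y: "y \<in> ball z (\<rho> / 4)" for y
    proof -
      have y2: "y \<in> ball z (\<rho> / 2)" using y sub4 by blast
      have "norm (deriv ?\<beta> y) \<le> 2 * (b * q\<^sup>2) * (4 * q)"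
        by (rule cauchy[where s = "\<rho> / 2", OF hol\<beta> \<beta>_le y]) (use \<rho> in auto)
      moreover have "norm (?R y * ?\<beta> y) \<le> q * (2 * (b * q\<^sup>2))"
        unfolding norm_mult using R[of y] \<beta>_le[OF y2] y2 sub2 qpos by (intro mult_mono) auto
      moreover have "norm (2 * (?R y * ?\<beta> y - deriv ?\<beta> y)) \<le> 2 * (norm (?R y * ?\<beta> y) + norm (deriv ?\<beta> y))"
        unfolding norm_mult using norm_triangle_ineq4[of "?R y * ?\<beta> y" "deriv ?\<beta> y"] by (simp add: norm_mult)
      ultimately have "norm (2 * (?R y * ?\<beta> y - deriv ?\<beta> y)) \<le> 20 * (b * q ^ 3)"
        by (simp add: power_numeral_reduce algebra_simps)
      also have "\<dots> \<le> b * q ^ Suc 3" using b by (intro absorbE) auto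
      finally show ?thesis by simp
    qed
    have Eq: "E / q \<ge> q" 
    proof -
      have "q * q \<le> q ^ 7" using pow[of 2 7] by (simp add: power2_eq_square)
      then show ?thesis using True qpos by (simp add: field_simps)
    qed
    \<comment> \<open>In \<open>h = - v^2 - \<beta> - D / 2\<close> the last two terms together are
      at most \<open>E q^5\<close>, hence at most \<open>E^2 / q^2\<close> by
      \<open>q^7 \<le> E\<close>, so \<open>v^2\<close> has to account for most of the lower bound
      on \<open>h\<close>.\<close>
    have v_ge: "norm (?v y) \<ge> E / q" if y: "y \<in> ball z (\<rho> / 4)" for y
    proof -
      have y2: "y \<in> ball z (\<rho> / 2)" and y1: "y \<in> ball z \<rho>" using y sub4 sub2 by blast+
      have "h y = - (?v y)\<^sup>2 - ?\<beta> y - ?D y / 2"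
      proof -
        have "?D y = - 2 * ((?v y)\<^sup>2 + h y + ?\<beta> y)"
          by (rule wkb_defect_eq[where B = B, OF open_ball y1 f h nz ode[OF y1]])
        then show ?thesis by (simp only:) (simp add: field_simps)
      qed
      then have "norm (h y) \<le> norm (?v y) ^ 2 + norm (?\<beta> y) + norm (?D y / 2)"
        using norm_triangle_ineq4[of "- (?v y)\<^sup>2 - ?\<beta> y" "?D y / 2"] norm_triangle_ineq4[of "- (?v y)\<^sup>2" "?\<beta> y"]
        by (simp add: norm_power)
      moreover have "norm (?\<beta> y) \<le> E * q ^ 5 / 2"
      proof -
        have "4 * (b * q\<^sup>2) \<le> b * q ^ Suc 2" using b by (intro absorbE) auto
        also have "\<dots> \<le> E * q ^ 5" using b qpos pow[of "Suc 2" 5] by (intro mult_mono) auto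
        finally show ?thesis using \<beta>_le[OF y2] by simp
      qed
      moreover have "norm (?D y / 2) \<le> E * q ^ 5 / 2" using D_le[OF y] by (simp add: norm_divide)
      ultimately have 1: "E\<^sup>2 / q \<le> norm (?v y) ^ 2 + E * q ^ 5"
        using h_ge[OF y1 True] by linarith
      have "E * q ^ 7 \<le> E * E" using True E by (intro mult_left_mono) auto
      then have 2: "E * q ^ 5 \<le> E\<^sup>2 / q\<^sup>2"
        using qpos by (simp add: field_simps power2_eq_square power_numeral_reduce)
      have "2 * E\<^sup>2 \<le> q * E\<^sup>2" using q by (intro mult_right_mono) auto
      then have 3: "2 * (E\<^sup>2 / q\<^sup>2) \<le> E\<^sup>2 / q" using qpos by (simp add: field_simps power2_eq_square)
      have "(E / q)\<^sup>2 \<le> (norm (?v y))\<^sup>2" using 1 2 3 by (simp add: power_divide)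
      then show ?thesis by (rule power2_le_imp_le) simp
    qed
    have step: "norm (?D y) \<le> (b * q ^ 4 + norm (deriv ?D y)) * q / E" if y: "y \<in> ball z (\<rho> / 4)" for y
    proof -
      have y1: "y \<in> ball z \<rho>" using y sub4 sub2 by blast
      define c where "c = 2 * ?v y - ?R y"
      have "norm c \<ge> 2 * norm (?v y) - norm (?R y)"
        using norm_triangle_ineq2[of "2 * ?v y" "?R y"] by (simp add: c_def norm_mult)
      then have c: "norm c \<ge> E / q" using v_ge[OF y] R[OF y1] Eq by linarith
      have "c * ?D y = 2 * (?R y * ?\<beta> y - deriv ?\<beta> y) - deriv ?D y"
        using deriv_wkb_defect[where B = B, OF open_ball y1 f h B nz ode] by (simp add: c_def algebra_simps)
      then have "norm c * norm (?D y) \<le> b * q ^ 4 + norm (deriv ?D y)"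
        using inhom[OF y] norm_triangle_ineq4[of "2 * (?R y * ?\<beta> y - deriv ?\<beta> y)" "deriv ?D y"]
        by (metis norm_mult add_right_mono order_trans)
      moreover have "E / q * norm (?D y) \<le> norm c * norm (?D y)" using c by (intro mult_right_mono) auto
      ultimately have "E / q * norm (?D y) \<le> b * q ^ 4 + norm (deriv ?D y)" by linarith
      then show ?thesis using E qpos by (simp add: field_simps)
    qed
    \<comment> \<open>First pass: the crude bound loses its factor \<open>E\<close> to the division
      by \<open>v\<close>. The second pass, on a smaller disc, starts from this bound and gains the
      factor \<open>1 / E\<close>.\<close>
    have D_le2: "norm (?D y) \<le> q ^ 9" if y: "y \<in> ball z (\<rho> / 8)" for y
    proof -
      have y4: "y \<in> ball z (\<rho> / 4)" using y sub8 by blast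
      have "norm (deriv ?D y) \<le> (E * q ^ 5) * (8 * q)"
        by (rule cauchy[where s = "\<rho> / 4", OF holD D_le y]) (use \<rho> in auto)
      also have "\<dots> = 8 * (E * q ^ 6)" by (simp add: power_numeral_reduce)
      also have "\<dots> \<le> E * q ^ Suc 6" using E by (intro absorbE) auto
      finally have "norm (?D y) \<le> (b * q ^ 4 + E * q ^ 7) * q / E"
        using step[OF y4] E qpos by (elim order_trans) (auto intro!: divide_right_mono mult_right_mono)
      also have "\<dots> \<le> (E * q ^ 7 + E * q ^ 7) * q / E"
        using b E qpos pow[of 4 7] by (intro divide_right_mono mult_right_mono add_right_mono mult_mono) auto
      also have "\<dots> = 2 * q ^ 8" using E by (simp add: power_numeral_reduce)
      also have "\<dots> \<le> q ^ Suc 8" by (intro absorb) auto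
      finally show ?thesis by simp
    qed
    have "norm (deriv ?D z) \<le> q ^ 9 * (16 * q)"
      by (rule cauchy[where s = "\<rho> / 8" and t = "\<rho> / 16", OF holD D_le2]) (use \<rho> in auto)
    also have "\<dots> = 16 * q ^ 10" by (simp add: power_numeral_reduce)
    also have "\<dots> \<le> q ^ Suc 10" by (intro absorb) auto
    also have "q ^ Suc 10 = 1 * q ^ 11" by simp
    also have "\<dots> \<le> b * q ^ 11" using b qpos by (intro mult_right_mono) auto
    finally have D': "norm (deriv ?D z) \<le> b * q ^ 11" .
    have "z \<in> ball z (\<rho> / 4)" using \<rho> by simp
    then have "norm (?D z) \<le> (b * q ^ 4 + norm (deriv ?D z)) * q / E" by (rule step)
    also have "\<dots> \<le> (b * q ^ 4 + b * q ^ 11) * q / E"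
      using D' E qpos by (intro divide_right_mono mult_right_mono add_left_mono) auto
    also have "\<dots> \<le> (b * q ^ 17 + b * q ^ 17) * q / E"
      using b E qpos pow[of 4 17] pow[of 11 17]
      by (intro divide_right_mono mult_right_mono add_mono mult_left_mono) auto
    also have "\<dots> = (2 * (b * q ^ 17)) * q / E" by simp
    also have "\<dots> \<le> (b * q ^ Suc 17) * q / E"
      using b E qpos by (intro divide_right_mono mult_right_mono absorbE) auto
    also have "\<dots> = q ^ 19 * b / E" by (simp add: power_numeral_reduce)
    finally show ?thesis .
  qed
qed

section \<open>Clearing the denominators of the defect\<close>

definition twisted_deriv :: "(complex \<Rightarrow> complex) \<Rightarrow> (complex \<Rightarrow> complex) \<Rightarrow> complex \<Rightarrow> complex" where
  "twisted_deriv p H z = deriv H z + H z * deriv p z"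

text \<open>\<open>H^2\<close> times the part of the shifted potential of \<open>H e^p\<close> that
  does not involve \<open>B\<close>. Being a differential polynomial in \<open>H\<close> and
  \<open>p\<close>, it inherits minimal type from them.\<close>

definition potential_numerator :: "(complex \<Rightarrow> complex) \<Rightarrow> (complex \<Rightarrow> complex) \<Rightarrow> complex \<Rightarrow> complex" where
  "potential_numerator p H z = (twisted_deriv p H z)\<^sup>2 / 16
     - (deriv (twisted_deriv p H) z * H z - twisted_deriv p H z * deriv H z) / 4"

text \<open>\<open>(f H)^2\<close> times the defect of \<open>f\<close> with respect to
  \<open>H e^p\<close>, written so that it makes sense, and is holomorphic, across the zeros of
  \<open>f\<close> and \<open>H\<close>.\<close>

definition defect_numerator ::
    "(complex \<Rightarrow> complex) \<Rightarrow> (complex \<Rightarrow> complex) \<Rightarrow> (complex \<Rightarrow> complex) \<Rightarrow> (complex \<Rightarrow> complex) \<Rightarrow> complex \<Rightarrow> complex" where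
  "defect_numerator p H B f z = - 2 * ((deriv f z * H z + f z * twisted_deriv p H z / 4)\<^sup>2
     + (f z)\<^sup>2 * (H z)\<^sup>2 * (B z + H z * exp (p z)) + (f z)\<^sup>2 * potential_numerator p H z)"

lemma holomorphic_on_twisted_deriv:
  "open S \<Longrightarrow> p holomorphic_on S \<Longrightarrow> H holomorphic_on S \<Longrightarrow> twisted_deriv p H holomorphic_on S"
  unfolding twisted_deriv_def by (intro holomorphic_intros holomorphic_deriv)

lemma holomorphic_on_defect_numerator:
  assumes "open S" "p holomorphic_on S" "H holomorphic_on S" "B holomorphic_on S" "f holomorphic_on S"
  shows "defect_numerator p H B f holomorphic_on S"
  unfolding defect_numerator_def potential_numerator_def
  by (intro holomorphic_intros holomorphic_deriv holomorphic_on_twisted_deriv assms) auto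

lemma log_deriv_twisted:
  assumes "open S" "z \<in> S" "p holomorphic_on S" "H holomorphic_on S" "H z \<noteq> 0"
  shows "log_deriv (\<lambda>z. H z * exp (p z)) z = twisted_deriv p H z / H z"
proof -
  have "((\<lambda>z. H z * exp (p z)) has_field_derivative deriv H z * exp (p z) + (exp (p z) * deriv p z) * H z) (at z)"
    by (intro DERIV_mult DERIV_fun_exp holomorphic_derivI[OF _ assms(1,2)] assms)
  then have "deriv (\<lambda>z. H z * exp (p z)) z = twisted_deriv p H z * exp (p z)"
    by (simp add: DERIV_imp_deriv twisted_deriv_def algebra_simps)
  then show ?thesis by (simp add: log_deriv_def)
qed

lemma shifted_potential_twisted:
  assumes S: "open S" "z \<in> S" and p: "p holomorphic_on S" and H: "H holomorphic_on S"
    and nz: "\<And>z. z \<in> S \<Longrightarrow> H z \<noteq> 0"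
  shows "shifted_potential B (\<lambda>z. H z * exp (p z)) z = B z + potential_numerator p H z / (H z)\<^sup>2"
proof -
  let ?h = "\<lambda>z. H z * exp (p z)" and ?L = "twisted_deriv p H"
  have Hz: "H z \<noteq> 0" using nz S by blast
  have "((\<lambda>z. ?L z / H z) has_field_derivative (deriv ?L z * H z - ?L z * deriv H z) / (H z * H z)) (at z)"
    by (intro DERIV_divide holomorphic_derivI[OF _ S] holomorphic_on_twisted_deriv p H Hz S)
  then have "(log_deriv ?h has_field_derivative (deriv ?L z * H z - ?L z * deriv H z) / (H z * H z)) (at z)"
    by (rule has_field_derivative_transform_within_open[OF _ S]) (simp add: log_deriv_twisted[OF S(1) _ p H nz])
  then have "deriv (log_deriv ?h) z = (deriv ?L z * H z - ?L z * deriv H z) / (H z * H z)"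
    by (rule DERIV_imp_deriv)
  then have E: "shifted_potential B ?h z = B z + (?L z / H z)\<^sup>2 / 16
      - (deriv ?L z * H z - ?L z * deriv H z) / (H z * H z) / 4"
    unfolding shifted_potential_def log_deriv_twisted[OF S p H Hz] by simp
  show ?thesis
    unfolding E potential_numerator_def using Hz by (simp add: field_simps power2_eq_square)
qed

lemma defect_numerator_eq:
  assumes S: "open S" "z \<in> S" and f: "f holomorphic_on S" and p: "p holomorphic_on S" and H: "H holomorphic_on S"
    and nz: "\<And>z. z \<in> S \<Longrightarrow> f z \<noteq> 0" "\<And>z. z \<in> S \<Longrightarrow> H z \<noteq> 0"
    and ode: "deriv (deriv f) z + (B z + H z * exp (p z)) * f z = 0"
  shows "defect_numerator p H B f z = (f z)\<^sup>2 * (H z)\<^sup>2 * wkb_defect f (\<lambda>z. H z * exp (p z)) z"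
proof -
  let ?h = "\<lambda>z. H z * exp (p z)"
  have h: "?h holomorphic_on S" by (intro holomorphic_intros p H)
  have z: "f z \<noteq> 0" "H z \<noteq> 0" using nz S by blast+
  have nzh: "?h z \<noteq> 0" if "z \<in> S" for z using nz that by simp
  have "wkb_defect f ?h z = - 2 * ((shifted_log_deriv f ?h z)\<^sup>2 + ?h z + shifted_potential B ?h z)"
    by (rule wkb_defect_eq[where B = B and h = ?h, OF S f h nz(1) nzh ode])
  also have "shifted_log_deriv f ?h z = deriv f z / f z + twisted_deriv p H z / H z / 4"
    unfolding shifted_log_deriv_def log_deriv_twisted[OF S p H z(2)] by (simp add: log_deriv_def)
  also have "shifted_potential B ?h z = B z + potential_numerator p H z / (H z)\<^sup>2"
    by (rule shifted_potential_twisted[OF S p H nz(2)])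
  finally have W: "wkb_defect f ?h z = - 2 * ((deriv f z / f z + twisted_deriv p H z / H z / 4)\<^sup>2 + ?h z +
      (B z + potential_numerator p H z / (H z)\<^sup>2))" .
  have "(f z)\<^sup>2 * (H z)\<^sup>2 * wkb_defect f ?h z = - 2 * ((f z * H z * (deriv f z / f z + twisted_deriv p H z / H z / 4))\<^sup>2
      + (f z)\<^sup>2 * (H z)\<^sup>2 * (B z + ?h z) + (f z)\<^sup>2 * ((H z)\<^sup>2 * (potential_numerator p H z / (H z)\<^sup>2)))"
    unfolding W power_mult_distrib by algebra
  also have "f z * H z * (deriv f z / f z + twisted_deriv p H z / H z / 4) = deriv f z * H z + f z * twisted_deriv p H z / 4"
    using z by (simp add: field_simps)
  also have "(H z)\<^sup>2 * (potential_numerator p H z / (H z)\<^sup>2) = potential_numerator p H z"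
    using z by simp
  finally show ?thesis by (simp add: defect_numerator_def)
qed

text \<open>Here \<open>P\<close> stands for the value at \<open>z\<close> of the polynomial with the zeros of \<open>f\<close> near \<open>z\<close>. Where
  \<open>P\<close> and \<open>H\<close> are not small, the defect estimate applies on a disc of radius \<open>1/(2 q\<^sup>2)\<close>; where one of
  them is smaller than \<open>1/q\<close>, its high power compensates the crude bound of the defect.\<close>
lemma defect_numerator_bound:
  fixes q E b d :: real and K :: nat and P :: complex
  assumes q: "q \<ge> 100" and b: "1 \<le> b" "b \<le> E" and d: "0 < d" "d \<le> 1"
    and hol: "f holomorphic_on UNIV" "H holomorphic_on UNIV" "B holomorphic_on UNIV" "p holomorphic_on UNIV"
    and ode: "\<And>y. deriv (deriv f) y + (B y + H y * exp (p y)) * f y = 0"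
    and nzf: "\<And>y. y \<in> ball z d \<Longrightarrow> f y \<noteq> 0"
    and P: "norm P \<le> q * d" "norm P ^ K \<le> q"
    and EK: "E ^ 3 \<le> q ^ K"
    and H_le: "\<And>y. y \<in> ball z 1 \<Longrightarrow> norm (H y) \<le> q" "norm (H z) ^ K \<le> q"
    and H'_le: "\<And>y. y \<in> ball z 1 \<Longrightarrow> norm (deriv H y) \<le> q"
    and L_le: "\<And>y. y \<in> ball z 1 \<Longrightarrow> norm (twisted_deriv p H y) \<le> q"
    and \<kappa>_le: "norm (potential_numerator p H z) \<le> q"
    and B_le: "\<And>y. y \<in> ball z 1 \<Longrightarrow> norm (B y) \<le> b * q"
    and A_le: "\<And>y. y \<in> ball z 1 \<Longrightarrow> norm (B y + H y * exp (p y)) \<le> E\<^sup>2 * q"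
    and exp_ge: "\<And>y. y \<in> ball z 1 \<Longrightarrow> 1 < E \<Longrightarrow> E\<^sup>2 / q \<le> norm (exp (p y))"
  shows "norm (defect_numerator p H B f z * P ^ (K + 2) * H z ^ K / (f z)\<^sup>2) \<le> q ^ 63 * b / E"
proof -
  let ?h = "\<lambda>y. H y * exp (p y)" and ?L = "twisted_deriv p H"
  have E: "E \<ge> 1" using b by linarith
  have qpos: "q > 0" "q \<ge> 1" using q by auto
  have pow: "q ^ i \<le> q ^ j" if "i \<le> j" for i j using that qpos by (intro power_increasing)
  have z1: "z \<in> ball z 1" and fz: "f z \<noteq> 0" using d nzf by auto
  have Pq: "norm P \<le> q" using P(1) d qpos mult_left_mono[of d 1 q] by linarith
  show ?thesis
  proof (cases "norm P \<ge> 1 / q \<and> norm (H z) \<ge> 1 / q")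
    case True
    \<comment> \<open>From \<open>1 / q \<le> norm P \<le> q d\<close> follows
      \<open>d \<ge> 1 / q^2\<close>, so this disc contains no zero of \<open>f\<close>. Since
      \<open>H'\<close> is at most \<open>q\<close> there, \<open>H\<close> varies by at most
      \<open>q \<rho> = 1 / (2 q)\<close> and stays away from \<open>0\<close> as well.\<close>
    define \<rho> where "\<rho> = 1 / (2 * q\<^sup>2)"
    have "1 / q \<le> q * d" using True P(1) by linarith
    then have dq: "1 / q\<^sup>2 \<le> d" using qpos by (simp add: field_simps power2_eq_square)
    have "0 < \<rho>" using qpos by (simp add: \<rho>_def)
    moreover have "1 / q\<^sup>2 = 2 * \<rho>" by (simp add: \<rho>_def)
    with dq \<open>0 < \<rho>\<close> have "\<rho> \<le> d" by linarith
    moreover have "q ^ 3 * \<rho> = q / 2" using qpos by (simp add: \<rho>_def power2_eq_square power3_eq_cube)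
    then have "1 \<le> q ^ 3 * \<rho>" using q by simp
    moreover have "q * \<rho> = 1 / (2 * q)" using qpos by (simp add: \<rho>_def power2_eq_square)
    ultimately have \<rho>: "0 < \<rho>" "\<rho> \<le> d" "1 \<le> q ^ 3 * \<rho>" "q * \<rho> = 1 / (2 * q)" by blast+
    have sub_d: "ball z \<rho> \<subseteq> ball z d" and sub1: "ball z \<rho> \<subseteq> ball z 1" using \<rho> d by (intro subset_ball; simp)+
    have H_ge: "norm (H y) \<ge> 1 / (2 * q)" if y: "y \<in> ball z \<rho>" for y
    proof -
      have "norm (H y - H z) \<le> q * norm (y - z)"
      proof (rule field_differentiable_bound[OF convex_ball])
        fix x assume x: "x \<in> ball z \<rho>"
        show "(H has_field_derivative deriv H x) (at x within ball z \<rho>)"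
          by (rule has_field_derivative_at_within[OF holomorphic_derivI[OF hol(2) open_UNIV UNIV_I]])
        show "norm (deriv H x) \<le> q" using x sub1 by (intro H'_le) blast
      qed (use y \<rho>(1) in simp_all)
      also have "\<dots> \<le> q * \<rho>" using y qpos by (intro mult_left_mono) (auto simp: dist_norm norm_minus_commute)
      finally have "norm (H y - H z) \<le> 1 / (2 * q)" using \<rho>(4) by simp
      moreover have "norm (H z) \<le> norm (H y) + norm (H y - H z)"
        using norm_triangle_ineq3[of "H z" "H y"] by (simp add: norm_minus_commute)
      moreover have "1 / q = 1 / (2 * q) + 1 / (2 * q)" by (simp add: field_simps)
      ultimately show ?thesis using True by linarith
    qed
    have H_nz: "H y \<noteq> 0" if "y \<in> ball z \<rho>" for y using H_ge[OF that] qpos by auto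
    \<comment> \<open>The estimate is used with \<open>q^3\<close> for \<open>q\<close>, because
      \<open>1 / \<rho>\<close> and the bound on \<open>h'/h\<close> are both \<open>2 q^2\<close>.
      This gives \<open>q^57\<close>; six further powers come from the factors \<open>P\<close> and
      \<open>H\<close>.\<close>
    have "norm (wkb_defect f ?h z) \<le> (q ^ 3) ^ 19 * b / E"
    proof (rule wkb_defect_bound[where B = B])
      show "0 < \<rho>" "1 \<le> q ^ 3 * \<rho>" "\<rho> \<le> 1" using \<rho> d by auto
      show "100 \<le> q ^ 3" using q pow[of 1 3] by simp
      show "1 \<le> b" "b \<le> E" by (fact b)+
      show "f holomorphic_on ball z \<rho>" "?h holomorphic_on ball z \<rho>" "B holomorphic_on ball z \<rho>"
        by (auto intro!: holomorphic_intros intro: holomorphic_on_subset[OF hol(1)] holomorphic_on_subset[OF hol(2)]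
            holomorphic_on_subset[OF hol(3)] holomorphic_on_subset[OF hol(4)])
      fix y assume y: "y \<in> ball z \<rho>"
      have y1: "y \<in> ball z 1" and yd: "y \<in> ball z d" using y sub1 sub_d by blast+
      show "f y \<noteq> 0" by (rule nzf[OF yd])
      show "?h y \<noteq> 0" using H_nz[OF y] by simp
      show "deriv (deriv f) y + (B y + ?h y) * f y = 0" by (rule ode)
      show "norm (log_deriv ?h y) \<le> q ^ 3"
      proof -
        have "norm (log_deriv ?h y) = norm (?L y) / norm (H y)"
          by (subst log_deriv_twisted[OF open_UNIV _ hol(4,2) H_nz[OF y]]) (auto simp: norm_divide)
        also have "\<dots> \<le> q / (1 / (2 * q))"
          using qpos L_le[OF y1] H_ge[OF y] by (intro frac_le) auto
        also have "\<dots> = 2 * q ^ 2" by (simp add: power2_eq_square)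
        also have "\<dots> \<le> q * q ^ 2" using q by (intro mult_right_mono) auto
        finally show ?thesis by (simp add: power_numeral_reduce)
      qed
      show "norm (B y) \<le> b * q ^ 3"
        by (rule order_trans[OF B_le[OF y1]]) (use b pow[of 1 3] in \<open>auto intro!: mult_left_mono\<close>)
      show "norm (B y + ?h y) \<le> E\<^sup>2 * q ^ 3"
        by (rule order_trans[OF A_le[OF y1]]) (use pow[of 1 3] in \<open>auto intro!: mult_left_mono\<close>)
      show "E\<^sup>2 / q ^ 3 \<le> norm (?h y)" if "(q ^ 3) ^ 7 \<le> E"
      proof -
        have "q ^ 1 \<le> (q ^ 3) ^ 7" unfolding power_mult[symmetric] by (rule pow) simp
        then have "1 < E" using that q by simp
        have "E\<^sup>2 / q ^ 3 \<le> (1 / (2 * q)) * (E\<^sup>2 / q)"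
        proof -
          have "2 * (q * q) \<le> q * (q * q)" using q by (intro mult_right_mono) auto
          then have "E\<^sup>2 / (q * (q * q)) \<le> E\<^sup>2 / (2 * (q * q))"
            using qpos by (intro divide_left_mono) auto
          then show ?thesis by (simp add: power3_eq_cube mult.assoc)
        qed
        also have "\<dots> \<le> norm (H y) * norm (exp (p y))"
          using H_ge[OF y] exp_ge[OF y1 \<open>1 < E\<close>] qpos by (intro mult_mono) auto
        finally show ?thesis by (simp add: norm_mult)
      qed
    qed
    then have D: "norm (wkb_defect f ?h z) \<le> q ^ 57 * b / E" by (simp flip: power_mult)
    have "defect_numerator p H B f z = (f z)\<^sup>2 * (H z)\<^sup>2 * wkb_defect f ?h z"
    proof (rule defect_numerator_eq[OF open_ball])
      show "z \<in> ball z \<rho>" using \<rho> by simp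
    qed (use hol sub_d nzf H_nz ode in \<open>auto intro: holomorphic_on_subset\<close>)
    then have "defect_numerator p H B f z * P ^ (K + 2) * H z ^ K / (f z)\<^sup>2
        = (P ^ K * H z ^ K) * ((P ^ 2 * (H z) ^ 2) * wkb_defect f ?h z)"
      using fz by (simp add: power_add power2_eq_square)
    then have "norm (defect_numerator p H B f z * P ^ (K + 2) * H z ^ K / (f z)\<^sup>2)
        = (norm P ^ K * norm (H z) ^ K) * ((norm P ^ 2 * norm (H z) ^ 2) * norm (wkb_defect f ?h z))"
      by (simp add: norm_mult norm_power)
    also have "\<dots> \<le> (q * q) * ((q ^ 2 * q ^ 2) * (q ^ 57 * b / E))"
      using P(2) H_le(2) Pq H_le(1)[OF z1] D b E qpos by (intro mult_mono power_mono) auto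
    also have "\<dots> = q ^ 63 * b / E" by (simp add: power_numeral_reduce)
    finally show ?thesis .
  next
    case False
    define u where "u = deriv f z / f z"
    have "norm u \<le> 12 * (E * q) / d"
      unfolding u_def
    proof (rule log_deriv_bound[where A = "\<lambda>y. B y + ?h y"])
      show "f holomorphic_on ball z d" using hol(1) by (rule holomorphic_on_subset) auto
      show "norm (B y + ?h y) \<le> (E * q)\<^sup>2" if "y \<in> ball z d" for y
      proof -
        have "y \<in> ball z 1" using that d by auto
        from A_le[OF this] show ?thesis
          unfolding power_mult_distrib
          by (rule order_trans) (use pow[of 1 2] in \<open>auto intro!: mult_left_mono\<close>)
      qed
      show "1 \<le> E * q" using E qpos mult_mono[of 1 E 1 q] by simp
    qed (use d nzf ode in auto)
    \<comment> \<open>The bound on \<open>f'/f\<close> blows up like \<open>1 / d\<close> at the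
      zeros, and a factor \<open>P\<close> of size at most \<open>q d\<close> cancels this. The
      logarithmic derivative enters squared, hence the two extra factors in
      \<open>P^(K + 2)\<close>.\<close>
    then have "norm u * norm P \<le> (12 * (E * q) / d) * (q * d)"
      using P(1) d E qpos by (intro mult_mono) auto
    then have uP: "norm (u * P) \<le> 12 * E * q\<^sup>2" using d by (simp add: norm_mult power2_eq_square)
    have eq: "defect_numerator p H B f z * P ^ (K + 2) * H z ^ K / (f z)\<^sup>2 =
       (P ^ K * H z ^ K) * (- 2 * ((u * P * H z + P * ?L z / 4)\<^sup>2 + P\<^sup>2 * (H z)\<^sup>2 * (B z + ?h z) + P\<^sup>2 * potential_numerator p H z))"
    proof -
      have "deriv f z = u * f z" using fz by (simp add: u_def)
      then show ?thesis
        using fz unfolding defect_numerator_def by (simp add: power_add power2_eq_square field_simps)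
    qed
    have E1: "1 \<le> E\<^sup>2" using E by simp
    have 1: "norm ((u * P * H z + P * ?L z / 4)\<^sup>2) \<le> 169 * (E\<^sup>2 * q ^ 6)"
    proof -
      have "norm (u * P * H z) \<le> (12 * E * q\<^sup>2) * q"
        unfolding norm_mult[of "u * P"] using uP H_le(1)[OF z1] E qpos by (intro mult_mono) auto
      moreover have "norm (P * ?L z / 4) \<le> q * q / 4"
        unfolding norm_divide norm_mult using Pq L_le[OF z1] qpos by (auto intro!: mult_mono)
      moreover have "q * q / 4 \<le> E * q ^ 3"
      proof -
        have "q ^ 2 / 4 \<le> q ^ 3" using pow[of 2 3] zero_le_power2[of q] by linarith
        also have "\<dots> \<le> E * q ^ 3" using mult_right_mono[OF E, of "q ^ 3"] qpos by simp
        finally show ?thesis by (simp add: power2_eq_square)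
      qed
      ultimately have "norm (u * P * H z + P * ?L z / 4) \<le> 13 * (E * q ^ 3)"
        using norm_triangle_ineq[of "u * P * H z" "P * ?L z / 4"] by (simp add: power_numeral_reduce)
      then have "norm (u * P * H z + P * ?L z / 4) ^ 2 \<le> (13 * (E * q ^ 3)) ^ 2" by (intro power_mono) auto
      also have "(13 * (E * q ^ 3)) ^ 2 = 169 * (E\<^sup>2 * q ^ 6)" by (simp add: power_mult_distrib flip: power_mult)
      finally show ?thesis by (simp add: norm_power)
    qed
    have 2: "norm (P\<^sup>2 * (H z)\<^sup>2 * (B z + ?h z)) \<le> E\<^sup>2 * q ^ 6"
    proof -
      have "norm (P\<^sup>2 * (H z)\<^sup>2 * (B z + ?h z)) \<le> (q\<^sup>2 * q\<^sup>2) * (E\<^sup>2 * q)"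
        unfolding norm_mult norm_power using Pq H_le(1)[OF z1] A_le[OF z1] qpos by (intro mult_mono power_mono) auto
      also have "\<dots> = E\<^sup>2 * q ^ 5" by (simp add: power_numeral_reduce)
      also have "\<dots> \<le> E\<^sup>2 * q ^ 6" by (intro mult_left_mono pow) auto
      finally show ?thesis .
    qed
    have 3: "norm (P\<^sup>2 * potential_numerator p H z) \<le> E\<^sup>2 * q ^ 6"
    proof -
      have "norm (P\<^sup>2 * potential_numerator p H z) \<le> q\<^sup>2 * q"
        unfolding norm_mult norm_power using Pq \<kappa>_le qpos by (intro mult_mono power_mono) auto
      also have "\<dots> \<le> q ^ 6" using pow[of 3 6] by (simp add: power_numeral_reduce)
      also have "\<dots> \<le> E\<^sup>2 * q ^ 6" using mult_right_mono[OF E1, of "q ^ 6"] qpos by simp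
      finally show ?thesis .
    qed
    have "norm (- 2 * ((u * P * H z + P * ?L z / 4)\<^sup>2 + P\<^sup>2 * (H z)\<^sup>2 * (B z + ?h z) + P\<^sup>2 * potential_numerator p H z))
      \<le> 342 * (E\<^sup>2 * q ^ 6)"
      unfolding norm_mult[of "- 2"]
      using 1 2 3 norm_triangle_ineq[of "(u * P * H z + P * ?L z / 4)\<^sup>2 + P\<^sup>2 * (H z)\<^sup>2 * (B z + ?h z)" "P\<^sup>2 * potential_numerator p H z"]
        norm_triangle_ineq[of "(u * P * H z + P * ?L z / 4)\<^sup>2" "P\<^sup>2 * (H z)\<^sup>2 * (B z + ?h z)"]
      by (simp only: norm_minus_cancel norm_numeral)
    also have "\<dots> \<le> q\<^sup>2 * (E\<^sup>2 * q ^ 6)"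
    proof (rule mult_right_mono)
      have "100 * 100 \<le> q * q" using q by (intro mult_mono) auto
      then show "342 \<le> q\<^sup>2" by (simp add: power2_eq_square)
    qed (use qpos in auto)
    also have "\<dots> = E\<^sup>2 * q ^ 8" by (simp add: power_numeral_reduce)
    finally have crude: "norm (- 2 * ((u * P * H z + P * ?L z / 4)\<^sup>2 + P\<^sup>2 * (H z)\<^sup>2 * (B z + ?h z) + P\<^sup>2 * potential_numerator p H z))
      \<le> E\<^sup>2 * q ^ 8" .
    \<comment> \<open>One of the two bases is below \<open>1 / q\<close>, and the
      \<open>K\<close>-th power of the other is at most \<open>q\<close>. As
      \<open>q^K \<ge> E^3\<close>, the product outweighs the crude bound \<open>E^2 q^8\<close> and
      still leaves a factor \<open>1 / E\<close>.\<close>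
    have "norm (P ^ K * H z ^ K) \<le> (1 / q) ^ K * q"
    proof (cases "norm P < 1 / q")
      case True
      then show ?thesis
        unfolding norm_mult norm_power using H_le(2) qpos by (intro mult_mono power_mono) auto
    next
      case False': False
      then have "norm (H z) < 1 / q" using False by auto
      then have "norm (P ^ K * H z ^ K) \<le> q * (1 / q) ^ K"
        unfolding norm_mult norm_power using P(2) qpos by (intro mult_mono power_mono) auto
      then show ?thesis by (simp add: mult.commute)
    qed
    also have "\<dots> = q / q ^ K" by (simp add: power_one_over)
    also have "\<dots> \<le> q / E ^ 3" using EK E qpos by (intro divide_left_mono) auto
    finally have "norm (P ^ K * H z ^ K) \<le> q / E ^ 3" .
    then have "norm (defect_numerator p H B f z * P ^ (K + 2) * H z ^ K / (f z)\<^sup>2) \<le> (q / E ^ 3) * (E\<^sup>2 * q ^ 8)"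
      unfolding eq norm_mult[of "P ^ K * H z ^ K"] using crude E qpos by (intro mult_mono) auto
    also have "\<dots> = q ^ 9 * 1 / E" using E by (simp add: field_simps power_numeral_reduce)
    also have "\<dots> \<le> q ^ 63 * b / E"
      using b E qpos pow[of 9 63] by (intro divide_right_mono mult_mono) auto
    finally show ?thesis .
  qed
qed

section \<open>Vanishing of the defect\<close>

text \<open>On a disc with \<open>M s \<le> 1/2\<close> and \<open>s \<le> 1\<close> the Taylor
  remainder bounds the maximum of \<open>f\<close> by half of itself, so \<open>f\<close> vanishes
  there and by continuation everywhere. Consequently all zeros of a nontrivial solution are
  simple.\<close>

lemma ode_zero_simple:
  assumes f: "f holomorphic_on UNIV" and A: "A holomorphic_on UNIV"
    and ode: "\<And>y. deriv (deriv f) y + A y * f y = 0"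
    and a: "f a = 0" "deriv f a = 0"
  shows "f z = 0"
proof -
  have "compact (A ` cball a 1)"
    by (intro compact_continuous_image compact_cball holomorphic_on_imp_continuous_on holomorphic_on_subset[OF A]) auto
  then have "bounded (A ` cball a 1)" by (rule compact_imp_bounded)
  then obtain M where M: "M > 0" "\<forall>w\<in>A ` cball a 1. norm w \<le> M" unfolding bounded_pos by blast
  define s where "s = min 1 (1 / (2 * M))"
  have s: "0 < s" "s \<le> 1" "M * s \<le> 1 / 2" using M(1) by (auto simp: s_def min_def field_simps)
  have contf: "continuous_on (cball a s) (\<lambda>y. norm (f y))"
    by (intro continuous_on_norm holomorphic_on_imp_continuous_on holomorphic_on_subset[OF f]) auto
  obtain y0 where y0: "y0 \<in> cball a s" "\<And>y. y \<in> cball a s \<Longrightarrow> norm (f y) \<le> norm (f y0)"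
    using continuous_attains_sup[OF compact_cball _ contf] s by auto
  have "norm (f y0 - f a - deriv f a * (y0 - a)) \<le> (M * norm (f y0)) * (norm (y0 - a))\<^sup>2"
  proof (rule taylor_remainder2_le[where \<rho> = "s + 1" and s = s])
    fix x assume x: "x \<in> cball a s"
    then have "norm (A x) \<le> M" using M(2) s by auto
    moreover have "norm (deriv (deriv f) x) = norm (A x) * norm (f x)"
      using ode[of x] by (metis add_eq_0_iff norm_minus_cancel norm_mult)
    ultimately show "norm (deriv (deriv f) x) \<le> M * norm (f y0)"
      using y0(2)[OF x] M(1) by (auto intro!: mult_mono)
  qed (use y0 s f in \<open>auto intro: holomorphic_on_subset\<close>)
  also have "(norm (y0 - a))\<^sup>2 \<le> s\<^sup>2"
    using y0(1) by (intro power_mono) (auto simp: dist_norm norm_minus_commute)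
  also have "s\<^sup>2 \<le> s * 1" unfolding power2_eq_square using s by (intro mult_left_mono) auto
  finally have "norm (f y0) \<le> M * norm (f y0) * (s * 1)"
    using a M(1) by (simp add: mult_left_mono)
  also have "\<dots> = (M * s) * norm (f y0)" by simp
  also have "\<dots> \<le> 1 / 2 * norm (f y0)" using s(3) by (intro mult_right_mono) auto
  finally have "norm (f y0) = 0" by simp
  then have zero: "f y = 0" if "y \<in> ball a s" for y using y0(2)[of y] that by auto
  show ?thesis
  proof (rule analytic_continuation_open[of "ball a s" UNIV f "\<lambda>_. 0"])
    show "ball a s \<noteq> {}" using s by simp
  qed (use f zero in auto)
qed

section \<open>Removing the zeros of a solution; zero-free discs\<close>

lemma divide_out_finite_zeros:
  assumes "finite X" and f: "f holomorphic_on UNIV" and "\<And>a. a \<in> X \<Longrightarrow> f a = (0::complex)"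
  shows "\<exists>g. g holomorphic_on UNIV \<and> (\<forall>z. f z = (\<Prod>a\<in>X. z - a) * g z)"
  using assms(1,3)
proof (induction X rule: finite_induct)
  case empty
  then show ?case using f by (intro exI[of _ f]) simp
next
  case (insert a X)
  then obtain g where g: "g holomorphic_on UNIV" "\<And>z. f z = (\<Prod>b\<in>X. z - b) * g z" by auto
  have "(\<Prod>b\<in>X. a - b) \<noteq> 0" using insert.hyps by auto
  then have "g a = 0" using g(2)[of a] insert.prems[of a] by simp
  then obtain k where "k holomorphic_on UNIV" "\<And>z. g z = (z - a) * k z"
    using divide_out_zero[OF g(1)] by blast
  then show ?case using g(2) insert.hyps by (intro exI[of _ k]) (simp add: mult.assoc mult.left_commute)
qed

text \<open>As the zeros are simple, one linear factor for each removes it completely: if the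
  cofactor vanished at a point of \<open>X\<close>, the product rule would make the derivative of
  \<open>f\<close> vanish there.\<close>

lemma cofactor_nonzero:
  assumes X: "finite X" and g: "g holomorphic_on UNIV" and fg: "\<And>z. f z = (\<Prod>a\<in>X. z - a) * g z"
    and nz: "z \<notin> X \<Longrightarrow> f z \<noteq> 0" and simple: "z \<in> X \<Longrightarrow> deriv f z \<noteq> 0"
  shows "g z \<noteq> 0"
proof
  assume gz: "g z = 0"
  then have "z \<in> X" using nz fg[of z] by auto
  have "(\<lambda>z. \<Prod>a\<in>X. z - a) holomorphic_on UNIV" by (intro holomorphic_intros)
  then have dP: "((\<lambda>z. \<Prod>a\<in>X. z - a) has_field_derivative deriv (\<lambda>z. \<Prod>a\<in>X. z - a) z) (at z)"
    using holomorphic_derivI by blast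
  have "((\<lambda>z. (\<Prod>a\<in>X. z - a) * g z) has_field_derivative
      deriv (\<lambda>z. \<Prod>a\<in>X. z - a) z * g z + deriv g z * (\<Prod>a\<in>X. z - a)) (at z)"
    by (intro DERIV_mult dP holomorphic_derivI[OF g]) auto
  moreover have "(\<lambda>z. (\<Prod>a\<in>X. z - a) * g z) = f" using fg by auto
  ultimately have "deriv f z = deriv (\<lambda>z. \<Prod>a\<in>X. z - a) z * g z + deriv g z * (\<Prod>a\<in>X. z - a)"
    using DERIV_imp_deriv by metis
  moreover have "(\<Prod>a\<in>X. z - a) = 0" using X \<open>z \<in> X\<close> by auto
  ultimately show False using gz simple \<open>z \<in> X\<close> by simp
qed

text \<open>The radius is the distance to the nearest zero, cut off at \<open>1\<close>. If that
  zero is closer than \<open>1\<close>, its factor in the product has modulus \<open>d\<close>, just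
  what is needed against the factor \<open>1 / d\<close> in the bound on \<open>f'/f\<close>; the
  other factors are at most \<open>2 r + 1\<close>.\<close>

lemma exists_zero_free_disc:
  fixes f :: "complex \<Rightarrow> complex" and c :: complex and r :: real
  defines "X \<equiv> {a. f a = 0 \<and> norm (a - c) \<le> r + 1}"
  assumes X: "finite X" and z: "norm (z - c) = r" and fz: "f z \<noteq> 0"
  obtains d where "0 < d" "d \<le> 1" "\<And>y. y \<in> ball z d \<Longrightarrow> f y \<noteq> 0"
    "norm (\<Prod>a\<in>X. z - a) \<le> (2 * r + 1) ^ card X * d"
proof -
  have r: "r \<ge> 0" using z norm_ge_zero by metis
  have dist_le: "norm (z - a) \<le> 2 * r + 1" if "a \<in> X" for a
    using that z norm_triangle_ineq4[of "z - c" "a - c"] by (simp add: X_def)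
  have inX: "y \<in> X" if "f y = 0" "dist z y < 1" for y
  proof -
    have "norm (y - c) \<le> norm (z - c) + norm (y - z)"
      using norm_triangle_ineq[of "z - c" "y - z"] by simp
    then show ?thesis using that z by (simp add: X_def dist_norm norm_minus_commute)
  qed
  show ?thesis
  proof (cases "\<exists>a\<in>X. dist z a < 1")
    case False
    show ?thesis
    proof (rule that[of 1])
      show "f y \<noteq> 0" if "y \<in> ball z 1" for y using False inX[of y] that by auto
      have "norm (\<Prod>a\<in>X. z - a) \<le> (\<Prod>a\<in>X. 2 * r + 1)"
        unfolding prod_norm[symmetric] using dist_le by (intro prod_mono) auto
      then show "norm (\<Prod>a\<in>X. z - a) \<le> (2 * r + 1) ^ card X * 1" by simp
    qed auto
  next
    case True
    then have "X \<noteq> {}" by auto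
    then obtain a where a: "a \<in> X" "\<And>b. b \<in> X \<Longrightarrow> dist z a \<le> dist z b"
      using X arg_min_if_finite[of X "dist z"] by (metis not_less)
    have da: "dist z a < 1" using True a(2) by fastforce
    have za: "z \<noteq> a" using a(1) fz by (auto simp: X_def)
    show ?thesis
    proof (rule that[of "dist z a"])
      show "f y \<noteq> 0" if "y \<in> ball z (dist z a)" for y using inX[of y] a(2)[of y] da that by auto
      have "norm (\<Prod>b\<in>X. z - b) = norm (z - a) * (\<Prod>b\<in>X - {a}. norm (z - b))"
        using X a(1) by (simp add: prod.remove norm_mult prod_norm)
      also have "(\<Prod>b\<in>X - {a}. norm (z - b)) \<le> (\<Prod>b\<in>X - {a}. 2 * r + 1)"
        using dist_le by (intro prod_mono) auto
      also have "(\<Prod>b\<in>X - {a}. 2 * r + 1) \<le> (2 * r + 1) ^ card X"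
        using r by (simp, intro power_increasing card_mono) (use X in \<open>auto intro: card_mono\<close>)
      finally show "norm (\<Prod>b\<in>X. z - b) \<le> (2 * r + 1) ^ card X * dist z a"
        by (simp add: dist_norm mult.commute mult_right_mono)
    qed (use da za in auto)
  qed
qed

section \<open>Asymptotic estimates on large circles\<close>

lemma minimal_type_eventually_cball:
  assumes g: "minimal_type n g" and n: "n > 0" and \<epsilon>: "\<epsilon> > 0"
  shows "\<forall>\<^sub>F r in at_top. \<forall>y. norm y \<le> r + s \<longrightarrow> norm (g y) \<le> exp (\<epsilon> * r ^ n)"
proof -
  define \<delta> where "\<delta> = \<epsilon> / 2 / 2 ^ n"
  have \<delta>: "\<delta> > 0" using \<epsilon> by (simp add: \<delta>_def)
  obtain C where C: "C \<ge> 0" "\<And>z. norm (g z) \<le> C * exp (\<delta> * norm z ^ n)"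
    using minimal_typeD[OF g \<delta>] by blast
  have "\<epsilon> / 2 > 0" using \<epsilon> by simp
  show ?thesis using eventually_le_exp_power[OF n \<open>\<epsilon> / 2 > 0\<close>, of C] eventually_ge_at_top[of s]
  proof eventually_elim
    case (elim r)
    have "norm (g y) \<le> exp (\<epsilon> * r ^ n)" if y: "norm y \<le> r + s" for y
    proof -
      have "norm y \<le> 2 * r" using y elim by simp
      then have "norm y ^ n \<le> (2 * r) ^ n" by (intro power_mono) auto
      then have "\<delta> * norm y ^ n \<le> \<delta> * (2 * r) ^ n" using \<delta> by (intro mult_left_mono) auto
      also have "\<dots> = \<epsilon> / 2 * r ^ n" by (simp add: \<delta>_def power_mult_distrib)
      finally have "C * exp (\<delta> * norm y ^ n) \<le> exp (\<epsilon> / 2 * r ^ n) * exp (\<epsilon> / 2 * r ^ n)"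
        using C elim by (intro mult_mono) auto
      also have "\<dots> = exp (\<epsilon> * r ^ n)" by (simp flip: exp_add)
      finally show ?thesis using C(2)[of y] by linarith
    qed
    then show ?case by blast
  qed
qed

text \<open>The derivative of \<open>z^n\<close> is \<open>O(r^(n-1))\<close>, so a bounded
  displacement changes \<open>a z^n\<close> by \<open>o(r^n)\<close>. This allows exponentials to be
  compared at nearby points and on circles with different centres.\<close>

lemma power_variation_eventually:
  fixes a :: complex and s \<delta> :: real
  assumes n: "n > 0" and \<epsilon>: "\<epsilon> > 0" and \<delta>: "\<delta> \<ge> 0"
  shows "\<forall>\<^sub>F r in at_top. \<forall>x y. norm x \<le> r + s \<longrightarrow> norm y \<le> r + s \<longrightarrow> norm (x - y) \<le> \<delta> \<longrightarrow>
    norm (a * x ^ n - a * y ^ n) \<le> \<epsilon> * r ^ n"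
proof -
  define C where "C = norm a * (real n * 2 ^ (n - 1)) * \<delta>"
  show ?thesis
    using eventually_ge_at_top[of "max 0 s"] eventually_ge_at_top[of "C / \<epsilon>"]
  proof eventually_elim
    case (elim r)
    have "norm (a * x ^ n - a * y ^ n) \<le> \<epsilon> * r ^ n"
      if x: "norm x \<le> r + s" and y: "norm y \<le> r + s" and xy: "norm (x - y) \<le> \<delta>" for x y
    proof -
      have "norm (x ^ n - y ^ n) \<le> (real n * (2 * r) ^ (n - 1)) * norm (x - y)"
      proof (rule field_differentiable_bound[OF convex_cball[of 0 "2 * r"]])
        fix z :: complex assume "z \<in> cball 0 (2 * r)"
        then have "norm z \<le> 2 * r" by simp
        then show "norm (of_nat n * z ^ (n - 1)) \<le> real n * (2 * r) ^ (n - 1)"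
          unfolding norm_mult norm_power by (intro mult_mono power_mono) auto
        show "((\<lambda>z. z ^ n) has_field_derivative of_nat n * z ^ (n - 1)) (at z within cball 0 (2 * r))"
          by (auto intro!: derivative_eq_intros)
      qed (use x y elim in auto)
      also have "\<dots> \<le> (real n * (2 * r) ^ (n - 1)) * \<delta>" using xy elim by (intro mult_left_mono) auto
      finally have "norm a * norm (x ^ n - y ^ n) \<le> norm a * ((real n * (2 * r) ^ (n - 1)) * \<delta>)"
        by (intro mult_left_mono) auto
      also have "\<dots> = C * r ^ (n - 1)" by (simp add: C_def power_mult_distrib)
      also have "\<dots> \<le> (\<epsilon> * r) * r ^ (n - 1)" using elim \<epsilon> by (intro mult_right_mono) (auto simp: field_simps)
      also have "\<dots> = \<epsilon> * r ^ n" using n by (cases n) auto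
      finally show ?thesis by (simp add: norm_mult flip: right_diff_distrib)
    qed
    then show ?case by blast
  qed
qed

lemma zero_product_bound_eventually:
  fixes N :: "real \<Rightarrow> nat" and C \<tau> \<epsilon> :: real
  assumes \<tau>: "0 \<le> \<tau>" "\<tau> < real n" and \<epsilon>: "\<epsilon> > 0"
    and N: "\<forall>\<^sub>F r in at_top. real (N r) \<le> C * r powr \<tau>"
  shows "\<forall>\<^sub>F r in at_top. (2 * r + 1) ^ N r \<le> exp (\<epsilon> * r ^ n)"
proof -
  \<comment> \<open>Half of the gap between \<open>\<tau>\<close> and \<open>n\<close> absorbs the
    logarithm, by \<open>ln x \<le> x^a / a\<close>.\<close>
  define a where "a = (real n - \<tau>) / 2"
  have a: "a > 0" "\<tau> + a < real n" using \<tau> by (auto simp: a_def field_simps)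
  have "\<forall>\<^sub>F r in at_top. (\<bar>C\<bar> * (3 powr a / a)) * r powr (\<tau> + a) \<le> \<epsilon> * r ^ n"
    by (rule powr_le_mult_power_eventually[OF a(2) \<epsilon>])
  then show ?thesis using N eventually_ge_at_top[of 1]
  proof eventually_elim
    case (elim r)
    have "ln (2 * r + 1) \<le> (2 * r + 1) powr a / a" using elim(3) a by (intro ln_powr_bound) auto
    also have "\<dots> \<le> (3 * r) powr a / a" using elim(3) a by (intro divide_right_mono powr_mono2) auto
    finally have ln: "ln (2 * r + 1) \<le> (3 powr a / a) * r powr a" using elim(3) by (simp add: powr_mult)
    have "real (N r) * ln (2 * r + 1) \<le> (\<bar>C\<bar> * r powr \<tau>) * ((3 powr a / a) * r powr a)"
    proof (intro mult_mono ln)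
      show "real (N r) \<le> \<bar>C\<bar> * r powr \<tau>" 
        by (rule order_trans[OF elim(2)]) (auto intro!: mult_right_mono)
    qed (use elim(3) in auto)
    also have "\<dots> = (\<bar>C\<bar> * (3 powr a / a)) * r powr (\<tau> + a)" by (simp add: powr_add)
    also have "\<dots> \<le> \<epsilon> * r ^ n" by (rule elim(1))
    finally have "exp (real (N r) * ln (2 * r + 1)) \<le> exp (\<epsilon> * r ^ n)" by simp
    then show ?case using elim(3) by (simp add: exp_of_nat_mult)
  qed
qed

lemma entire_finite_zeros:
  assumes f: "f holomorphic_on UNIV" and "f c \<noteq> (0::complex)"
  shows "finite {a. f a = 0 \<and> norm (a - b) \<le> r}"
proof (cases "\<exists>a. f a = 0")
  case True
  then have "\<not> f constant_on UNIV" using assms(2) unfolding constant_on_def by (metis UNIV_I)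
  then have "finite {z \<in> cball b r. f z = 0}"
    by (intro holomorphic_compact_finite_zeros[OF f]) auto
  then show ?thesis by (rule finite_subset[rotated]) (auto simp: dist_norm norm_minus_commute)
qed auto

lemma exists_nat_mult_ge:
  fixes a b \<epsilon> :: real
  assumes "\<epsilon> > 0"
  obtains K :: nat where "a \<le> real K * \<epsilon>"
proof -
  obtain K :: nat where "a / \<epsilon> \<le> real K" using real_arch_simple by blast
  then show ?thesis using that[of K] assms by (simp add: field_simps)
qed

text \<open>The circles are centred at \<open>c\<close>, since the product of rotations bounds the
  value at the centre, where the defect is assumed nonzero. The auxiliary function varies with
  \<open>r\<close>, but its value at \<open>c\<close> has a positive lower bound independent of
  \<open>r\<close>.\<close>

lemma wkb_defect_vanishes:
  fixes n :: nat and \<zeta> c :: complex and \<gamma> C \<tau> :: real and H B f :: "complex \<Rightarrow> complex"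
  assumes n: "n > 0" and \<zeta>: "\<zeta> \<noteq> 0" and \<gamma>: "0 \<le> \<gamma>" "\<gamma> < 1 / 2"
    and H: "minimal_type n H" and B: "B holomorphic_on UNIV"
    and B_le: "\<And>\<epsilon>. \<epsilon> > 0 \<Longrightarrow> \<forall>\<^sub>F r in at_top. \<forall>y. norm y \<le> r + (norm c + 1) \<longrightarrow>
      norm (B y) \<le> exp (\<gamma> * max 0 (Re (\<zeta> * y ^ n)) + \<epsilon> * r ^ n)"
    and f: "f holomorphic_on UNIV"
    and ode: "\<And>y. deriv (deriv f) y + (B y + H y * exp (\<zeta> * y ^ n)) * f y = 0"
    and \<tau>: "0 \<le> \<tau>" "\<tau> < real n"
    and zeros: "\<forall>\<^sub>F r in at_top. real (card {a. f a = 0 \<and> norm a \<le> r}) \<le> C * r powr \<tau>"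
    and c: "f c \<noteq> 0" "H c \<noteq> 0"
  shows "wkb_defect f (\<lambda>z. H z * exp (\<zeta> * z ^ n)) c = 0"
proof (rule ccontr)
  assume defect: "wkb_defect f (\<lambda>z. H z * exp (\<zeta> * z ^ n)) c \<noteq> 0"
  define p where "p = (\<lambda>z. \<zeta> * z ^ n)"
  define F where "F = defect_numerator p H B f"
  define s where "s = norm c + 1"
  have hol_p: "p holomorphic_on UNIV" unfolding p_def by (intro holomorphic_intros)
  have hol_H: "H holomorphic_on UNIV" using H by (rule minimal_type_holomorphic)
  have ode': "deriv (deriv f) y + (B y + H y * exp (p y)) * f y = 0" for y using ode by (simp add: p_def)
  have mt_p: "minimal_type n p" unfolding p_def by (intro minimal_type_intros n)
  have mt_L: "minimal_type n (twisted_deriv p H)"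
    unfolding twisted_deriv_def[abs_def] by (intro minimal_type_intros mt_p H)
  have mt_\<kappa>: "minimal_type n (potential_numerator p H)"
    unfolding potential_numerator_def[abs_def] divide_inverse by (intro minimal_type_intros mt_L H)
  have Fc: "F c \<noteq> 0"
  proof -
    let ?S = "{z. f z \<noteq> 0} \<inter> {z. H z \<noteq> 0}"
    have "open ?S"
      using f hol_H by (intro open_Int open_Collect_neq continuous_on_const holomorphic_on_imp_continuous_on)
    then have "F c = (f c)\<^sup>2 * (H c)\<^sup>2 * wkb_defect f (\<lambda>z. H z * exp (p z)) c"
      unfolding F_def using c ode'
      by (intro defect_numerator_eq[of ?S]) (auto intro: holomorphic_on_subset[OF f] holomorphic_on_subset[OF hol_H] holomorphic_on_subset[OF hol_p])
    then show ?thesis using c defect by (simp add: p_def)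
  qed
  have simple: "deriv f a \<noteq> 0" if "f a = 0" for a
  proof
    assume "deriv f a = 0"
    moreover have "(\<lambda>y. B y + H y * exp (p y)) holomorphic_on UNIV"
      by (intro holomorphic_intros B hol_H hol_p)
    ultimately have "f c = 0" using ode_zero_simple[OF f _ ode' that] by blast
    then show False using c by simp
  qed
  define X where "X = (\<lambda>r. {a. f a = 0 \<and> norm (a - c) \<le> r + 1})"
  have finX: "finite (X r)" for r unfolding X_def by (rule entire_finite_zeros[OF f c(1)])

  obtain \<alpha> \<beta> where ab: "\<alpha> < \<beta>" "\<And>\<theta>. \<alpha> < \<theta> \<Longrightarrow> \<theta> < \<beta> \<Longrightarrow> Re (\<zeta> * cis (real n * \<theta>)) > norm \<zeta> / 2"
    using exists_interval_Re_pos[OF \<zeta> n] by blast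
  obtain N where "real N > 2 * pi / (\<beta> - \<alpha>)" using reals_Archimedean2 by blast
  then have N: "real N * (\<beta> - \<alpha>) > 2 * pi" using ab by (simp add: field_simps)
  have N0: "N > 0" using N pi_gt_zero by (cases N) auto
  \<comment> \<open>Decay rate on the arc: about the origin \<open>Re (\<zeta> z^n)\<close> is at
    least \<open>norm \<zeta> / 2 * r^n\<close> there, moving the circle to the centre
    \<open>c\<close> costs at most \<open>norm \<zeta> / 4 * r^n\<close>, and the remaining factor
    is that of \<open>exp (- (1/2 - \<gamma>) Y)\<close>.\<close>
  define \<mu> where "\<mu> = (1 / 2 - \<gamma>) * (norm \<zeta> / 4)"
  have \<mu>: "\<mu> > 0" using \<gamma> \<zeta> by (simp add: \<mu>_def)
  \<comment> \<open>Each of the \<open>N\<close> rotations costs \<open>q^63\<close> with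
    \<open>q = exp (\<epsilon> r^n)\<close>; since \<open>126 = 2 * 63\<close>, the total loss is
    half of the gain \<open>\<mu>\<close>.\<close>
  define \<epsilon> where "\<epsilon> = \<mu> / (126 * real N)"
  have \<epsilon>: "\<epsilon> > 0" "\<epsilon> / 4 > 0" using \<mu> N0 by (auto simp: \<epsilon>_def)
  \<comment> \<open>Chosen so that \<open>E^3 \<le> q^K\<close> for \<open>E = exp (Y / 2)\<close>,
    where \<open>Y \<le> norm \<zeta> * (2 r)^n\<close>; the choice does not depend on
    \<open>r\<close>.\<close>
  obtain K :: nat where K: "3 / 2 * (norm \<zeta> * 2 ^ n) \<le> real K * \<epsilon>"
    using exists_nat_mult_ge[OF \<epsilon>(1)] by blast
  \<comment> \<open>Only zeros within distance \<open>1\<close> of \<open>c\<close> can make the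
    polynomial small at \<open>c\<close>; all others contribute factors of modulus at least
    \<open>1\<close>.\<close>
  define p0 where "p0 = (\<Prod>a\<in>X 0. norm (c - a))"
  have p0: "p0 > 0" unfolding p0_def using c(1) by (intro prod_pos) (auto simp: X_def)
  define Z0 where "Z0 = norm (F c) * p0 ^ (K + 2) * norm (H c) ^ K / norm (f c) ^ 2"
  have Z0: "Z0 > 0" using Fc p0 c by (simp add: Z0_def)

  have "\<forall>\<^sub>F r in at_top. real (card (X r)) \<le> (\<bar>C\<bar> * 2 powr \<tau>) * r powr \<tau>"
  proof -
    have lim: "filterlim (\<lambda>r::real. 2 * r) at_top at_top"
      by (intro filterlim_tendsto_pos_mult_at_top[OF tendsto_const]) (auto simp: filterlim_ident)
    have "\<forall>\<^sub>F r in at_top. real (card {a. f a = 0 \<and> norm a \<le> 2 * r}) \<le> C * (2 * r) powr \<tau>"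
      using zeros lim unfolding filterlim_iff by blast
    then show ?thesis using eventually_ge_at_top[of s]
    proof eventually_elim
      case (elim r)
      have "norm a \<le> 2 * r" if "a \<in> X r" for a
        using that elim(2) norm_triangle_ineq[of "a - c" c] by (simp add: X_def s_def)
      then have "X r \<subseteq> {a. f a = 0 \<and> norm a \<le> 2 * r}" by (auto simp: X_def)
      moreover have "finite {a. f a = 0 \<and> norm a \<le> 2 * r}"
        using entire_finite_zeros[OF f c(1), of 0] by simp
      ultimately have "real (card (X r)) \<le> real (card {a. f a = 0 \<and> norm a \<le> 2 * r})"
        by (intro of_nat_mono card_mono)
      also have "\<dots> \<le> C * (2 * r) powr \<tau>" by (rule elim(1))
      also have "\<dots> \<le> \<bar>C\<bar> * (2 * r) powr \<tau>" by (intro mult_right_mono) auto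
      also have "\<dots> = (\<bar>C\<bar> * 2 powr \<tau>) * r powr \<tau>"
        using elim(2) norm_ge_zero[of c] by (simp add: powr_mult s_def)
      finally show ?case .
    qed
  qed
  note zp = zero_product_bound_eventually[OF \<tau> _ this]
  have "\<epsilon> / real (K + 1) > 0" using \<epsilon> by simp
  note zpK = zp[OF this]
  have \<zeta>4: "norm \<zeta> / 4 > 0" using \<zeta> by simp
  note ev = eventually_ge_at_top[of s] eventually_le_exp_power[OF n \<epsilon>(1), of 100]
    eventually_le_exp_power[OF n \<epsilon>(2), of 2]
    minimal_type_eventually_cball[OF H n \<epsilon>(2), where s = s]
    minimal_type_eventually_cball[OF minimal_type_power[OF H, of K] n \<epsilon>(1), where s = s]
    minimal_type_eventually_cball[OF minimal_type_deriv[OF H] n \<epsilon>(1), where s = s]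
    minimal_type_eventually_cball[OF mt_L n \<epsilon>(1), where s = s]
    minimal_type_eventually_cball[OF mt_\<kappa> n \<epsilon>(1), where s = s]
    power_variation_eventually[OF n \<epsilon>(2) zero_le_one, where s = s and a = \<zeta>]
    power_variation_eventually[OF n \<zeta>4 norm_ge_zero[of c], where s = s and a = \<zeta>]
    B_le[OF \<epsilon>(2), folded s_def] zpK
  have main: "\<forall>\<^sub>F r in at_top. (\<exists>a. f a = 0 \<and> norm (a - c) = r) \<or> Z0 ^ N \<le> exp (- (\<mu> / 2) * r ^ n)"
    using ev
  proof eventually_elim
    case (elim r)
    show ?case
    proof (cases "\<exists>a. f a = 0 \<and> norm (a - c) = r")
      case False
      define q where "q = exp (\<epsilon> * r ^ n)"
      have rs: "r \<ge> s" "r > 0" using elim(1) norm_ge_zero[of c] unfolding s_def by linarith+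
      have q100: "q \<ge> 100" using elim(2) by (simp add: q_def)
      define P where "P = (\<lambda>z. \<Prod>a\<in>X r. z - a)"
      obtain g where g: "g holomorphic_on UNIV" "\<And>z. f z = P z * g z"
        unfolding P_def using divide_out_finite_zeros[OF finX f] by (auto simp: X_def)
      \<comment> \<open>With \<open>f = P g\<close> this equals \<open>F P^(K + 2) H^K / f^2\<close>
        off the zeros of \<open>f\<close>, but it has no poles in the disc of radius
        \<open>r + 1\<close> about \<open>c\<close>, because \<open>g\<close> has no zeros
        there.\<close>
      define Z where "Z = (\<lambda>z. F z * P z ^ K * H z ^ K / (g z)\<^sup>2)"
      have gnz: "g z \<noteq> 0" if "z \<in> ball c (r + 1)" for z
      proof (rule cofactor_nonzero[OF finX[of r] g(1)])
        show "f z = (\<Prod>a\<in>X r. z - a) * g z" for z using g(2) by (simp add: P_def)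
        show "f z \<noteq> 0" if "z \<notin> X r"
          using that \<open>z \<in> ball c (r + 1)\<close> by (auto simp: X_def dist_norm norm_minus_commute)
        show "deriv f z \<noteq> 0" if "z \<in> X r" using that by (intro simple) (simp add: X_def)
      qed
      have holZ: "Z holomorphic_on ball c (r + 1)"
      proof -
        have "F holomorphic_on UNIV"
          unfolding F_def by (intro holomorphic_on_defect_numerator hol_p hol_H B f open_UNIV)
        then show ?thesis
          unfolding Z_def P_def using gnz
          by (intro holomorphic_intros) (auto intro: holomorphic_on_subset[OF _ subset_UNIV] hol_H g)
      qed
      have Z_eq: "Z z = F z * P z ^ (K + 2) * H z ^ K / (f z)\<^sup>2" if "f z \<noteq> 0" for z
      proof -
        have "P z \<noteq> 0" "g z \<noteq> 0" using that g(2)[of z] by auto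
        then show ?thesis unfolding Z_def g(2)[of z] by (simp add: power_add power2_eq_square field_simps)
      qed
      define Y where "Y = (\<lambda>z. max 0 (Re (p z)))"
      have near: "norm y \<le> r + s" if "norm (y - c) \<le> r + 1" for y
        using that norm_triangle_ineq[of "y - c" c] by (simp add: s_def)
      have Zle: "norm (Z z) \<le> q ^ 63 * exp (\<gamma> * Y z) / exp (Y z / 2)" if z: "norm (z - c) = r" for z
      proof -
        have fz: "f z \<noteq> 0" using False z by blast
        obtain d where d: "0 < d" "d \<le> 1" "\<And>y. y \<in> ball z d \<Longrightarrow> f y \<noteq> 0"
          "norm (\<Prod>a\<in>X r. z - a) \<le> (2 * r + 1) ^ card (X r) * d"
          unfolding X_def using exists_zero_free_disc[OF finX[unfolded X_def] z fz] by blast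
        have w1: "(1::real) \<le> (2 * r + 1) ^ card (X r)" using rs by (intro one_le_power) auto
        have w: "((2 * r + 1) ^ card (X r)) ^ (K + 1) \<le> q"
        proof -
          have "((2 * r + 1) ^ card (X r)) ^ (K + 1) \<le> exp (\<epsilon> / real (K + 1) * r ^ n) ^ (K + 1)"
            using elim(12) rs by (intro power_mono) auto
          also have "\<dots> = exp (real (K + 1) * (\<epsilon> / real (K + 1) * r ^ n))"
            by (rule exp_of_nat_mult[symmetric])
          also have "real (K + 1) * (\<epsilon> / real (K + 1) * r ^ n) = \<epsilon> * r ^ n"
            by (simp del: of_nat_add)
          also have "exp (\<epsilon> * r ^ n) = q" by (simp add: q_def)
          finally show ?thesis .
        qed
        have wi: "((2 * r + 1) ^ card (X r)) ^ i \<le> q" if "i \<le> K + 1" for i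
          using power_increasing[OF that w1] w by linarith
        have zin: "norm z \<le> r + s" using near z by simp
        have yin: "norm y \<le> r + s" if "y \<in> ball z 1" for y
        proof (rule near)
          show "norm (y - c) \<le> r + 1"
            using that z norm_triangle_ineq[of "y - z" "z - c"] by (simp add: dist_norm norm_minus_commute)
        qed
        have var: "\<bar>Re (p y) - Re (p z)\<bar> \<le> \<epsilon> / 4 * r ^ n" if y: "y \<in> ball z 1" for y
        proof -
          have "norm (p y - p z) \<le> \<epsilon> / 4 * r ^ n"
            using elim(9) yin[OF y] zin y unfolding p_def by (auto simp: dist_norm norm_minus_commute)
          then show ?thesis using abs_Re_le_cmod[of "p y - p z"] by simp
        qed
        have Yvar: "Y y \<le> Y z + \<epsilon> / 4 * r ^ n" if "y \<in> ball z 1" for y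
        proof -
          have "0 \<le> \<epsilon> / 4 * r ^ n" using \<epsilon> rs by simp
          then show ?thesis using var[OF that] unfolding Y_def abs_le_iff by linarith
        qed
        have Y0: "Y z \<ge> 0" by (simp add: Y_def)
        have q4: "q = exp (\<epsilon> / 4 * r ^ n) * exp (\<epsilon> / 4 * r ^ n) * exp (\<epsilon> / 4 * r ^ n) * exp (\<epsilon> / 4 * r ^ n)"
          unfolding q_def by (simp flip: exp_add)
        have le_q: "x \<le> q" if "x \<le> exp (\<epsilon> / 4 * r ^ n)" for x
        proof -
          have "\<epsilon> / 4 * r ^ n \<le> \<epsilon> * r ^ n" using \<epsilon> rs by (intro mult_right_mono) auto
          then show ?thesis using that unfolding q_def by (meson exp_le_cancel_iff order_trans)
        qed
        \<comment> \<open>The exponent \<open>\<epsilon>\<close> is spent in quarters: one for the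
          bound on \<open>B\<close> or \<open>H\<close>, one for passing from \<open>Y y\<close> to
          \<open>Y z\<close>, and in the bound on \<open>A\<close> one for the factor
          \<open>2\<close> of a sum.\<close>
        have B': "norm (B y) \<le> exp (\<gamma> * Y z + 2 * (\<epsilon> / 4 * r ^ n))" if y: "y \<in> ball z 1" for y
        proof -
          have "norm (B y) \<le> exp (\<gamma> * Y y + \<epsilon> / 4 * r ^ n)"
            using elim(11) yin[OF y] unfolding Y_def p_def by blast
          also have "\<gamma> * Y y \<le> \<gamma> * (Y z + \<epsilon> / 4 * r ^ n)" using Yvar[OF y] \<gamma> by (intro mult_left_mono)
          also have "\<dots> \<le> \<gamma> * Y z + 1 * (\<epsilon> / 4 * r ^ n)"
            unfolding distrib_left using \<gamma> \<epsilon> rs by (intro add_left_mono mult_right_mono) auto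
          finally show ?thesis by (simp add: algebra_simps)
        qed
        have "norm (defect_numerator p H B f z * (P z) ^ (K + 2) * H z ^ K / (f z)\<^sup>2)
          \<le> q ^ 63 * exp (\<gamma> * Y z) / exp (Y z / 2)"
        proof (rule defect_numerator_bound[OF q100 _ _ d(1,2) f hol_H B hol_p ode' d(3)])
          show "1 \<le> exp (\<gamma> * Y z)" using \<gamma> Y0 by simp
          show "exp (\<gamma> * Y z) \<le> exp (Y z / 2)" using \<gamma> Y0 mult_right_mono[of \<gamma> "1 / 2" "Y z"] by simp
          show "norm (P z) \<le> q * d"
          proof -
            have "(2 * r + 1) ^ card (X r) * d \<le> q * d"
              using wi[of 1] d(1) by (intro mult_right_mono) auto
            then show ?thesis using d(4) unfolding P_def by linarith
          qed
          have "norm (P z) \<le> (2 * r + 1) ^ card (X r)"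
          proof -
            have "(2 * r + 1) ^ card (X r) * d \<le> (2 * r + 1) ^ card (X r) * 1"
              using w1 d(2) by (intro mult_left_mono) auto
            then show ?thesis using d(4) unfolding P_def by linarith
          qed
          then have "norm (P z) ^ K \<le> ((2 * r + 1) ^ card (X r)) ^ K" by (intro power_mono) auto
          then show "norm (P z) ^ K \<le> q" using wi[of K] by linarith
          have "Re (p z) \<le> norm \<zeta> * norm z ^ n"
            using complex_Re_le_cmod[of "p z"] by (simp add: p_def norm_mult norm_power)
          also have "\<dots> \<le> norm \<zeta> * (2 * r) ^ n"
            using zin rs by (intro mult_left_mono power_mono) auto
          finally have "Y z \<le> norm \<zeta> * 2 ^ n * r ^ n" using rs by (simp add: Y_def power_mult_distrib)
          then have "3 / 2 * Y z \<le> (3 / 2 * (norm \<zeta> * 2 ^ n)) * r ^ n" by simp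
          also have "\<dots> \<le> (real K * \<epsilon>) * r ^ n" using K rs by (intro mult_right_mono) auto
          finally have "exp (3 / 2 * Y z) \<le> exp (real K * (\<epsilon> * r ^ n))" by (simp add: mult.assoc)
          then show "exp (Y z / 2) ^ 3 \<le> q ^ K"
            unfolding q_def exp_of_nat_mult[symmetric] by (simp add: mult.commute)
          show "norm (H z) ^ K \<le> q" using elim(5) zin unfolding q_def by (simp add: norm_power)
          show "norm (potential_numerator p H z) \<le> q" using elim(8) zin unfolding q_def by blast
          fix y assume y: "y \<in> ball z 1"
          show "norm (H y) \<le> q" using elim(4) yin[OF y] by (intro le_q) blast
          show "norm (deriv H y) \<le> q" using elim(6) yin[OF y] unfolding q_def by blast
          show "norm (twisted_deriv p H y) \<le> q" using elim(7) yin[OF y] unfolding q_def by blast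
          have "\<gamma> * Y z + 2 * (\<epsilon> / 4 * r ^ n) \<le> \<gamma> * Y z + \<epsilon> * r ^ n" using \<epsilon> rs by simp
          then have "exp (\<gamma> * Y z + 2 * (\<epsilon> / 4 * r ^ n)) \<le> exp (\<gamma> * Y z) * q"
            unfolding q_def by (simp only: exp_le_cancel_iff flip: exp_add)
          then show "norm (B y) \<le> exp (\<gamma> * Y z) * q" using B'[OF y] by linarith
          have E2: "(exp (Y z / 2))\<^sup>2 = exp (Y z)" by (simp add: power2_eq_square flip: exp_add)
          have "norm (H y * exp (p y)) \<le> exp (\<epsilon> / 4 * r ^ n) * exp (Y z + \<epsilon> / 4 * r ^ n)"
            unfolding norm_mult norm_exp_eq_Re
          proof (intro mult_mono)
            show "norm (H y) \<le> exp (\<epsilon> / 4 * r ^ n)" using elim(4) yin[OF y] by blast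
            have "Re (p y) \<le> Y y" by (simp add: Y_def)
            then show "exp (Re (p y)) \<le> exp (Y z + \<epsilon> / 4 * r ^ n)" using Yvar[OF y] by simp
          qed auto
          also have "\<dots> = exp (Y z) * exp (2 * (\<epsilon> / 4 * r ^ n))" by (simp flip: exp_add)
          finally have "norm (H y * exp (p y)) \<le> exp (Y z) * exp (2 * (\<epsilon> / 4 * r ^ n))" .
          moreover have "exp (\<gamma> * Y z + 2 * (\<epsilon> / 4 * r ^ n)) \<le> exp (Y z) * exp (2 * (\<epsilon> / 4 * r ^ n))"
            using \<gamma> Y0 mult_right_mono[of \<gamma> 1 "Y z"] by (simp flip: exp_add)
          ultimately have "norm (B y + H y * exp (p y)) \<le> 2 * (exp (Y z) * exp (2 * (\<epsilon> / 4 * r ^ n)))"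
            using B'[OF y] norm_triangle_ineq[of "B y" "H y * exp (p y)"] by linarith
          also have "\<dots> \<le> exp (\<epsilon> / 4 * r ^ n) * (exp (Y z) * exp (2 * (\<epsilon> / 4 * r ^ n)))"
            using elim(3) by (intro mult_right_mono) auto
          also have "\<dots> = exp (Y z + 3 * (\<epsilon> / 4 * r ^ n))" by (simp flip: exp_add)
          also have "\<dots> \<le> exp (Y z + \<epsilon> * r ^ n)" using \<epsilon> rs by simp
          finally show "norm (B y + H y * exp (p y)) \<le> (exp (Y z / 2))\<^sup>2 * q"
            unfolding E2 q_def by (simp add: exp_add)
          show "(exp (Y z / 2))\<^sup>2 / q \<le> norm (exp (p y))" if "1 < exp (Y z / 2)"
          proof -
            \<comment> \<open>\<open>E > 1\<close> means \<open>Y z > 0\<close>, so the positive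
              part is the real part itself and gives a lower bound for
              \<open>exp (p y)\<close>.\<close>
            have "Y z = Re (p z)" using that by (auto simp: Y_def max_def split: if_splits)
            moreover have "0 \<le> \<epsilon> / 4 * r ^ n" "\<epsilon> * r ^ n = 4 * (\<epsilon> / 4 * r ^ n)" using \<epsilon> rs by simp_all
            ultimately have "Y z - \<epsilon> * r ^ n \<le> Re (p y)" using var[OF y] unfolding abs_le_iff by linarith
            then show ?thesis unfolding E2 q_def norm_exp_eq_Re by (simp flip: exp_diff)
          qed
        qed
        then show ?thesis using Z_eq[OF fz] by (simp add: F_def)
      qed
      have dist: "norm (c + of_real r * cis \<theta> - c) = r" for \<theta> using rs by (simp add: norm_mult)
      have drop: "exp (\<gamma> * Y z) / exp (Y z / 2) = exp (- (1 / 2 - \<gamma>) * Y z)" for z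
        by (simp add: algebra_simps flip: exp_diff)
      have "norm (Z c) ^ N \<le> (q ^ 63) ^ (N - 1) * (q ^ 63 * exp (- \<mu> * r ^ n))"
      proof (rule arc_bound[OF holZ _ _ N])
        show "cball c r \<subseteq> ball c (r + 1)" by (auto simp: dist_norm)
        show "0 < r" by (rule rs)
        show "norm (Z (c + of_real r * cis \<theta>)) \<le> q ^ 63" for \<theta>
        proof -
          let ?z = "c + of_real r * cis \<theta>"
          have "norm (Z ?z) \<le> q ^ 63 * (exp (\<gamma> * Y ?z) / exp (Y ?z / 2))" using Zle[OF dist] by simp
          also have "\<dots> \<le> q ^ 63 * 1"
          proof (intro mult_left_mono)
            have "0 \<le> (1 / 2 - \<gamma>) * Y ?z" using \<gamma> by (intro mult_nonneg_nonneg) (auto simp: Y_def)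
            then show "exp (\<gamma> * Y ?z) / exp (Y ?z / 2) \<le> 1"
              unfolding drop mult_minus_left exp_le_one_iff neg_le_0_iff_le .
          qed (use q100 in simp)
          finally show ?thesis by simp
        qed
        show "norm (Z (c + of_real r * cis \<theta>)) \<le> q ^ 63 * exp (- \<mu> * r ^ n)" if \<theta>: "\<alpha> < \<theta>" "\<theta> < \<beta>" for \<theta>
        proof -
          let ?z = "c + of_real r * cis \<theta>" and ?w = "of_real r * cis \<theta>"
          have w: "norm ?w = r" using rs by (simp add: norm_mult)
          have "norm (p ?z - p ?w) \<le> norm \<zeta> / 4 * r ^ n"
            unfolding p_def using elim(10) near[of ?z] dist[of \<theta>] w norm_ge_zero[of c] by (auto simp: s_def)
          then have "Re (p ?z) \<ge> Re (p ?w) - norm \<zeta> / 4 * r ^ n"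
            using abs_Re_le_cmod[of "p ?z - p ?w"] by simp
          moreover have "Re (p ?w) \<ge> norm \<zeta> / 2 * r ^ n"
            unfolding p_def Re_mult_of_real_cis_power using ab(2)[OF \<theta>] rs by (intro mult_right_mono) auto
          ultimately have "Y ?z \<ge> norm \<zeta> / 4 * r ^ n" unfolding Y_def by (simp add: field_simps)
          then have "(1 / 2 - \<gamma>) * (norm \<zeta> / 4 * r ^ n) \<le> (1 / 2 - \<gamma>) * Y ?z"
            using \<gamma> by (intro mult_left_mono) auto
          then have "\<mu> * r ^ n \<le> (1 / 2 - \<gamma>) * Y ?z" by (simp add: \<mu>_def mult.assoc)
          then have "exp (\<gamma> * Y ?z) / exp (Y ?z / 2) \<le> exp (- \<mu> * r ^ n)"
            unfolding drop mult_minus_left exp_le_cancel_iff neg_le_iff_le .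
          then have "q ^ 63 * (exp (\<gamma> * Y ?z) / exp (Y ?z / 2)) \<le> q ^ 63 * exp (- \<mu> * r ^ n)"
            using q100 by (intro mult_left_mono) auto
          then show ?thesis using Zle[OF dist[of \<theta>]] unfolding times_divide_eq_right by linarith
        qed
      qed
      also have "\<dots> = (q ^ 63) ^ N * exp (- \<mu> * r ^ n)"
        using N0 by (cases N) auto
      also have "\<dots> = exp (real (63 * N) * (\<epsilon> * r ^ n)) * exp (- \<mu> * r ^ n)"
        unfolding q_def by (simp only: exp_of_nat_mult power_mult)
      also have "\<dots> = exp (- (\<mu> / 2) * r ^ n)"
        using N0 by (simp add: \<epsilon>_def field_simps flip: exp_add)
      finally have "norm (Z c) ^ N \<le> exp (- (\<mu> / 2) * r ^ n)" .
      moreover have "Z0 \<le> norm (Z c)"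
      proof -
        have "p0 \<le> norm (P c)"
        proof -
          have "X 0 \<subseteq> X r" using rs by (auto simp: X_def)
          then have "norm (P c) = p0 * (\<Prod>a\<in>X r - X 0. norm (c - a))"
            unfolding P_def p0_def prod_norm[symmetric] using finX by (metis mult.commute prod.subset_diff)
          moreover have "(\<Prod>a\<in>X r - X 0. norm (c - a)) \<ge> 1"
            by (intro prod_ge_1) (auto simp: X_def norm_minus_commute)
          ultimately show ?thesis using p0 mult_left_mono[of 1 "\<Prod>a\<in>X r - X 0. norm (c - a)" p0] by simp
        qed
        then have "p0 ^ (K + 2) \<le> norm (P c) ^ (K + 2)" using p0 by (intro power_mono) auto
        then show ?thesis
          unfolding Z_eq[OF c(1)] Z0_def norm_mult norm_divide norm_power
          by (intro divide_right_mono mult_right_mono mult_left_mono) auto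
      qed
      then have "Z0 ^ N \<le> norm (Z c) ^ N" using Z0 by (intro power_mono) auto
      ultimately show ?thesis by (intro disjI2) linarith
    qed auto
  qed
  have "\<forall>\<^sub>F r in at_top. 2 / Z0 ^ N \<le> exp (\<mu> / 2 * r ^ n)"
    using \<mu> by (intro eventually_le_exp_power n) auto
  with main have "\<forall>\<^sub>F r in at_top. \<exists>a. f a = 0 \<and> norm (a - c) = r"
  proof eventually_elim
    case (elim r)
    have Z: "Z0 ^ N > 0" using Z0 by simp
    have "\<not> Z0 ^ N \<le> exp (- (\<mu> / 2) * r ^ n)"
    proof
      assume "Z0 ^ N \<le> exp (- (\<mu> / 2) * r ^ n)"
      then have "exp (\<mu> / 2 * r ^ n) * Z0 ^ N \<le> exp (\<mu> / 2 * r ^ n) * exp (- (\<mu> / 2) * r ^ n)"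
        by (intro mult_left_mono) auto
      also have "\<dots> = 1" by (simp flip: exp_add)
      finally show False using elim(2) Z by (simp add: field_simps)
    qed
    then show ?case using elim(1) by blast
  qed
  then obtain r1 where r1: "\<And>r. r \<ge> r1 \<Longrightarrow> \<exists>a. f a = 0 \<and> norm (a - c) = r"
    unfolding eventually_at_top_linorder by blast
  have "{r1..r1 + 1} \<subseteq> (\<lambda>a. norm (a - c)) ` {a. f a = 0 \<and> norm (a - c) \<le> r1 + 1}"
  proof
    fix r assume "r \<in> {r1..r1 + 1}"
    then obtain a where "f a = 0" "norm (a - c) = r" "r \<le> r1 + 1" using r1[of r] by auto
    then show "r \<in> (\<lambda>a. norm (a - c)) ` {a. f a = 0 \<and> norm (a - c) \<le> r1 + 1}" by auto
  qed
  then have "finite {r1..r1 + 1}"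
    using entire_finite_zeros[OF f c(1)] finite_surj by blast
  then show False using infinite_Icc[of r1 "r1 + 1"] by simp
qed

section \<open>The oscillation theorem\<close>

lemma exists_common_nonzero:
  assumes f: "f holomorphic_on UNIV" and g: "g holomorphic_on UNIV"
    and nz: "f a \<noteq> (0::complex)" "g b \<noteq> (0::complex)"
  shows "\<exists>z. f z \<noteq> 0 \<and> g z \<noteq> 0"
proof (rule ccontr)
  assume *: "\<not> ?thesis"
  have "open {z. f z \<noteq> 0}"
    using f by (intro open_Collect_neq continuous_on_const holomorphic_on_imp_continuous_on)
  then have "g b = 0"
    by (rule analytic_continuation_open[of "{z. f z \<noteq> 0}" UNIV g "\<lambda>_. 0"]) (use * nz g in auto)
  then show False using nz by simp
qed

text \<open>For vanishing defect its linear equation reduces to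
  \<open>\<beta>' = (h'/h) \<beta>\<close>, which says that \<open>\<beta> / h\<close> has
  derivative zero.\<close>

lemma wkb_defect_zero_imp_potential_multiple:
  assumes f: "f holomorphic_on ball c e" and h: "h holomorphic_on ball c e" and B: "B holomorphic_on ball c e"
    and nz: "\<And>z. z \<in> ball c e \<Longrightarrow> f z \<noteq> 0" "\<And>z. z \<in> ball c e \<Longrightarrow> h z \<noteq> 0"
    and ode: "\<And>z. z \<in> ball c e \<Longrightarrow> deriv (deriv f) z + (B z + h z) * f z = 0"
    and zero: "\<And>z. z \<in> ball c e \<Longrightarrow> wkb_defect f h z = 0"
  shows "\<exists>k. \<forall>z\<in>ball c e. shifted_potential B h z = k * h z"
proof -
  let ?\<beta> = "shifted_potential B h"
  have der: "((\<lambda>z. ?\<beta> z / h z) has_field_derivative 0) (at z)" if z: "z \<in> ball c e" for z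
  proof -
    have "(wkb_defect f h has_field_derivative 0) (at z)"
      by (rule has_field_derivative_transform_within_open[OF DERIV_const[of 0] open_ball z]) (simp add: zero)
    then have "log_deriv h z * ?\<beta> z = deriv ?\<beta> z"
      using deriv_wkb_defect[where B = B, OF open_ball z f h B nz ode] zero[OF z] by (simp add: DERIV_imp_deriv)
    then have "deriv ?\<beta> z * h z - ?\<beta> z * deriv h z = 0"
      using nz(2)[OF z] by (simp add: log_deriv_def field_simps)
    moreover have "((\<lambda>z. ?\<beta> z / h z) has_field_derivative (deriv ?\<beta> z * h z - ?\<beta> z * deriv h z) / (h z * h z)) (at z)"
      using nz(2)[OF z] z
      by (intro DERIV_divide holomorphic_derivI[OF _ open_ball z] holomorphic_on_shifted_potential B h nz(2)) auto
    ultimately show ?thesis by simp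
  qed
  have "\<exists>k. \<forall>z\<in>ball c e. ?\<beta> z / h z = k"
    by (rule has_field_derivative_zero_constant[OF convex_ball]) (rule has_field_derivative_at_within[OF der])
  then obtain k where "\<And>z. z \<in> ball c e \<Longrightarrow> ?\<beta> z / h z = k" by blast
  then show ?thesis using nz(2) by (intro exI[of _ k]) (auto simp: field_simps)
qed

text \<open>Each zero other than the origin in the disc of radius \<open>r\<close> contributes at
  least \<open>r^(-\<tau>)\<close> to a convergent sum, its multiplicity being at least
  \<open>1\<close>. A zero at the origin is not part of that sum; it is absorbed by
  \<open>r^\<tau> \<ge> 1\<close>.\<close>

lemma zero_exponent_less_imp_count:
  assumes f: "f holomorphic_on UNIV" and nz: "f w \<noteq> 0" and less: "zero_exponent f < ereal (real n)"
  obtains \<tau> C where "0 \<le> \<tau>" "\<tau> < real n"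
    "\<forall>\<^sub>F r in at_top. real (card {a. f a = 0 \<and> norm a \<le> r}) \<le> C * r powr \<tau>"
proof -
  obtain \<tau> where \<tau>: "\<tau> > 0" "\<tau> < real n"
    and sum: "(\<lambda>z. of_int (zorder f z) * norm z powr (- \<tau>)) summable_on {z. z \<noteq> 0 \<and> f z = 0}"
    using less unfolding zero_exponent_def Inf_less_iff by auto
  have ord: "zorder f a \<ge> 1" if "f a = 0" for a
  proof -
    have "\<exists>\<^sub>F z in at a. f z \<noteq> 0"
    proof (rule ccontr)
      assume "\<not> ?thesis"
      then have "\<forall>\<^sub>F z in at a. f z = 0" by (simp add: frequently_def)
      then obtain d where d: "d > 0" "\<And>z. z \<noteq> a \<Longrightarrow> dist z a < d \<Longrightarrow> f z = 0"
        unfolding eventually_at by blast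
      have "f w = 0"
      proof (rule analytic_continuation_open[of "ball a d" UNIV f "\<lambda>_. 0"])
        show "f z = 0" if "z \<in> ball a d" for z
          using d(2)[of z] that \<open>f a = 0\<close> by (cases "z = a") (auto simp: dist_commute)
      qed (use d f in auto)
      then show False using nz by simp
    qed
    then have "zorder f a > 0" using zorder_pos_iff[OF f open_UNIV UNIV_I] that by blast
    then show ?thesis by simp
  qed
  define S where "S = (\<Sum>\<^sub>\<infinity>z\<in>{z. z \<noteq> 0 \<and> f z = 0}. of_int (zorder f z) * norm z powr (- \<tau>))"
  have "\<forall>\<^sub>F r in at_top. real (card {a. f a = 0 \<and> norm a \<le> r}) \<le> (S + 1) * r powr \<tau>"
    using eventually_ge_at_top[of 1]
  proof eventually_elim
    case (elim r)
    let ?X = "{a. f a = 0 \<and> norm a \<le> r}"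
    have fin: "finite ?X" using entire_finite_zeros[OF f nz, of 0 r] by simp
    have "real (card (?X - {0})) * r powr (- \<tau>) = (\<Sum>a\<in>?X - {0}. r powr (- \<tau>))" by simp
    also have "\<dots> \<le> (\<Sum>a\<in>?X - {0}. of_int (zorder f a) * norm a powr (- \<tau>))"
    proof (rule sum_mono)
      fix a assume a: "a \<in> ?X - {0}"
      have "r powr (- \<tau>) \<le> norm a powr (- \<tau>)" using a \<tau> by (intro powr_mono2') auto
      also have "\<dots> \<le> of_int (zorder f a) * norm a powr (- \<tau>)"
        using ord[of a] a mult_right_mono[of 1 "of_int (zorder f a)" "norm a powr (- \<tau>)"] by simp
      finally show "r powr (- \<tau>) \<le> of_int (zorder f a) * norm a powr (- \<tau>)" .
    qed
    also have "\<dots> \<le> S"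
      unfolding S_def
    proof (rule finite_sum_le_infsum[OF sum])
      show "0 \<le> of_int (zorder f z) * norm z powr (- \<tau>)" if "z \<in> {z. z \<noteq> 0 \<and> f z = 0} - (?X - {0})" for z
        using ord[of z] that by (intro mult_nonneg_nonneg) auto
    qed (use fin in auto)
    finally have "real (card (?X - {0})) \<le> S * r powr \<tau>"
      using elim by (simp add: powr_minus field_simps)
    moreover have "card ?X \<le> card (?X - {0}) + 1"
    proof -
      have "card ?X \<le> card (insert 0 (?X - {0}))" using fin by (intro card_mono) auto
      also have "\<dots> = card (?X - {0}) + 1" using fin by (subst card_insert_disjoint) auto
      finally show ?thesis .
    qed
    moreover have "1 \<le> r powr \<tau>" using elim \<tau> by (simp add: ge_one_powr_ge_zero)
    ultimately show ?case unfolding distrib_right by linarith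
  qed
  then show ?thesis using that[of \<tau>] \<tau> by auto
qed

text \<open>Where \<open>Re (w y^n)\<close> is negative no exponential grows, because all exponents
  are nonnegative multiples of \<open>w\<close>; hence the positive part.\<close>

lemma exponential_sum_bound_positive_multiples:
  fixes T :: "'i \<Rightarrow> complex \<Rightarrow> complex" and \<zeta> :: "'i \<Rightarrow> complex" and w :: complex and c :: "'i \<Rightarrow> real"
  assumes n: "n > 0" and J: "finite J" and T: "\<And>j. j \<in> J \<Longrightarrow> minimal_type n (T j)"
    and c: "\<And>j. j \<in> J \<Longrightarrow> 0 \<le> c j \<and> c j \<le> \<gamma> \<and> \<zeta> j = of_real (c j) * w"
    and \<epsilon>: "\<epsilon> > 0"
  shows "\<forall>\<^sub>F r in at_top. \<forall>y. norm y \<le> r + s \<longrightarrow>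
      norm (\<Sum>j\<in>J. T j y * exp (\<zeta> j * y ^ n)) \<le> exp (\<gamma> * max 0 (Re (w * y ^ n)) + \<epsilon> * r ^ n)"
proof -
  have \<epsilon>2: "\<epsilon> / 2 > 0" using \<epsilon> by simp
  have "\<forall>\<^sub>F r in at_top. \<forall>j\<in>J. \<forall>y. norm y \<le> r + s \<longrightarrow> norm (T j y) \<le> exp (\<epsilon> / 2 * r ^ n)"
    using minimal_type_eventually_cball[OF T n \<epsilon>2] by (intro eventually_ball_finite J) blast
  then show ?thesis using eventually_le_exp_power[OF n \<epsilon>2, of "real (card J)"]
  proof eventually_elim
    case (elim r)
    show ?case
    proof (intro allI impI)
      fix y :: complex assume y: "norm y \<le> r + s"
      let ?Y = "max 0 (Re (w * y ^ n))"
      have "norm (T j y * exp (\<zeta> j * y ^ n)) \<le> exp (\<epsilon> / 2 * r ^ n) * exp (\<gamma> * ?Y)" if j: "j \<in> J" for j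
      proof -
        have "Re (\<zeta> j * y ^ n) = c j * Re (w * y ^ n)"
          using c[OF j] by (simp only: mult.assoc Re_complex_of_real Im_complex_of_real times_complex.simps mult_zero_left diff_zero)
        also have "\<dots> \<le> c j * ?Y" using c[OF j] by (intro mult_left_mono) auto
        also have "\<dots> \<le> \<gamma> * ?Y" using c[OF j] by (intro mult_right_mono) auto
        finally have "norm (exp (\<zeta> j * y ^ n)) \<le> exp (\<gamma> * ?Y)" by (simp only: norm_exp_eq_Re exp_le_cancel_iff)
        then show ?thesis unfolding norm_mult using elim(1) j y by (intro mult_mono) auto
      qed
      then have "norm (\<Sum>j\<in>J. T j y * exp (\<zeta> j * y ^ n)) \<le> real (card J) * (exp (\<epsilon> / 2 * r ^ n) * exp (\<gamma> * ?Y))"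
        by (rule sum_norm_bound)
      also have "\<dots> \<le> exp (\<epsilon> / 2 * r ^ n) * (exp (\<epsilon> / 2 * r ^ n) * exp (\<gamma> * ?Y))"
        using elim(2) by (intro mult_right_mono) auto
      also have "\<dots> = exp (\<gamma> * ?Y + \<epsilon> * r ^ n)" by (simp add: algebra_simps flip: exp_add)
      finally show "norm (\<Sum>j\<in>J. T j y * exp (\<zeta> j * y ^ n)) \<le> exp (\<gamma> * ?Y + \<epsilon> * r ^ n)" .
    qed
  qed
qed

lemma exponential_polynomial_holomorphic:
  "exponential_polynomial g \<Longrightarrow> g holomorphic_on UNIV"
proof -
  assume "exponential_polynomial g"
  then obtain k :: nat and P Q :: "nat \<Rightarrow> complex poly" where "\<And>z. g z = (\<Sum>j<k. poly (P j) z * exp (poly (Q j) z))"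
    unfolding exponential_polynomial_def by blast
  then have "g = (\<lambda>z. \<Sum>j<k. poly (P j) z * exp (poly (Q j) z))" by blast
  then show ?thesis by (auto intro!: holomorphic_intros)
qed

theorem theorem8:
  fixes n m :: nat
    and H :: "nat \<Rightarrow> complex \<Rightarrow> complex"
    and \<zeta> :: "nat \<Rightarrow> complex"
    and A B f :: "complex \<Rightarrow> complex"
  assumes "n > 0" and "m \<ge> 2"
    and "\<And>j. j \<le> m \<Longrightarrow>
           (exponential_polynomial (H j) \<and> growth_order (H j) < ereal (real n))
             \<or> (\<exists>p :: complex poly. \<forall>z. H j z = poly p z)"
    and "\<And>j. j \<in> {1..m} \<Longrightarrow> \<exists>z. H j z \<noteq> 0"
    and "inj_on \<zeta> {1..m}"
    and "\<And>j. j \<in> {1..m} \<Longrightarrow> \<zeta> j \<noteq> 0"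
    and "\<And>z. A z = H 0 z + (\<Sum>j=1..m. H j z * exp (\<zeta> j * z ^ n))"
    and "\<And>z. B z = A z - H 1 z * exp (\<zeta> 1 * z ^ n)"
    and "\<And>\<theta>. pl_indicator B \<theta> > 0 \<Longrightarrow> pl_indicator A \<theta> > 2 * pl_indicator B \<theta>"
    and "circumference (convex hull (insert 0 ((\<lambda>j. cnj (\<zeta> j)) ` {1..m})))
           > 2 * circumference (convex hull (insert 0 ((\<lambda>j. cnj (\<zeta> j)) ` {2..m})))"
    and "f holomorphic_on UNIV" and "\<exists>z. f z \<noteq> 0"
    and "\<And>z. deriv (deriv f) z + A z * f z = 0"
  shows "zero_exponent f \<ge> ereal (real n)"
proof (rule ccontr)
  assume "\<not> ?thesis"
  then have less: "zero_exponent f < ereal (real n)" by simp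
  note n = assms(1) and f = assms(11)
  obtain w where w: "f w \<noteq> 0" using assms(12) by blast
  define J where "J = {0..m}"
  define \<xi> where "\<xi> = (\<lambda>j. if j = 0 then 0 else \<zeta> j)"
  have J: "finite J" "1 \<in> J" "2 \<in> J - {1}" using assms(2) by (auto simp: J_def)
  have inj: "inj_on \<xi> J"
  proof (rule inj_onI)
    fix i j assume ij: "i \<in> J" "j \<in> J" "\<xi> i = \<xi> j"
    have pos: "\<xi> l = \<zeta> l \<and> \<zeta> l \<noteq> 0 \<and> l \<in> {1..m}" if "l \<in> J" "l \<noteq> 0" for l
      using that assms(6)[of l] by (simp add: \<xi>_def J_def)
    show "i = j"
    proof (cases "i = 0 \<or> j = 0")
      case True
      then show ?thesis using pos ij by (metis \<xi>_def)
    next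
      case False
      then show ?thesis using pos[of i] pos[of j] ij inj_onD[OF assms(5)] by metis
    qed
  qed
  have \<xi>1: "\<xi> 1 \<noteq> 0" "\<xi> 2 \<noteq> 0" using assms(2,6) by (auto simp: \<xi>_def)
  have H: "minimal_type n (H j)" if "j \<in> J" for j
  proof -
    have "j \<le> m" using that by (simp add: J_def)
    from assms(3)[OF this] show ?thesis
    proof
      assume "exponential_polynomial (H j) \<and> growth_order (H j) < ereal (real n)"
      then show ?thesis by (intro growth_order_less_imp_minimal_type exponential_polynomial_holomorphic) auto
    next
      assume "\<exists>p :: complex poly. \<forall>z. H j z = poly p z"
      then obtain p :: "complex poly" where "H j = poly p" by blast
      then show ?thesis using minimal_type_poly[OF n, of p] by simp
    qed
  qed
  have nz: "\<exists>z. H j z \<noteq> 0" if "j \<in> J" "\<xi> j \<noteq> 0" for j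
    using assms(4)[of j] that by (auto simp: J_def \<xi>_def split: if_splits)
  have A: "A = (\<lambda>z. \<Sum>j\<in>J. H j z * exp (\<xi> j * z ^ n))"
  proof
    fix z
    have "(\<Sum>j\<in>J. H j z * exp (\<xi> j * z ^ n)) = H 0 z + (\<Sum>j=1..m. H j z * exp (\<xi> j * z ^ n))"
      unfolding J_def by (subst sum.atLeast_Suc_atMost) (auto simp: \<xi>_def)
    also have "(\<Sum>j=1..m. H j z * exp (\<xi> j * z ^ n)) = (\<Sum>j=1..m. H j z * exp (\<zeta> j * z ^ n))"
      by (intro sum.cong) (auto simp: \<xi>_def)
    finally show "A z = (\<Sum>j\<in>J. H j z * exp (\<xi> j * z ^ n))" using assms(7) by simp
  qed
  have B: "B = (\<lambda>z. \<Sum>j\<in>J - {1}. H j z * exp (\<xi> j * z ^ n))"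
  proof
    fix z
    show "B z = (\<Sum>j\<in>J - {1}. H j z * exp (\<xi> j * z ^ n))"
      unfolding assms(8) A using J by (subst sum.remove[of J 1]) (auto simp: \<xi>_def)
  qed
  have holB: "B holomorphic_on UNIV"
    unfolding B using H by (intro holomorphic_intros minimal_type_holomorphic) auto
  have holH1: "H 1 holomorphic_on UNIV" using H[OF J(2)] by (rule minimal_type_holomorphic)
  have "\<exists>c\<ge>0. c < 1 / 2 \<and> \<xi> k = of_real c * \<xi> 1" if k: "k \<in> J - {1}" for k
  proof (cases "\<xi> k = 0")
    case True
    then show ?thesis by (intro exI[of _ 0]) simp
  next
    case False
    show ?thesis
      using indicator_gap_imp_multiple[where T = H and \<zeta> = \<xi>, OF n J(1) inj H nz A B assms(9) k False]
      by (metis less_imp_le)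
  qed
  then obtain c where c: "\<And>k. k \<in> J - {1} \<Longrightarrow> c k \<ge> 0 \<and> c k < 1 / 2 \<and> \<xi> k = of_real (c k) * \<xi> 1"
    by metis
  \<comment> \<open>A maximum of finitely many multiples is still strictly below
    \<open>1/2\<close>.\<close>
  define \<gamma> where "\<gamma> = Max (c ` (J - {1}))"
  have "\<gamma> \<in> c ` (J - {1})" unfolding \<gamma>_def using J by (intro Max_in) auto
  then have \<gamma>: "0 \<le> \<gamma>" "\<gamma> < 1 / 2" using c by auto
  have c\<gamma>: "0 \<le> c k \<and> c k \<le> \<gamma> \<and> \<xi> k = of_real (c k) * \<xi> 1" if "k \<in> J - {1}" for k
    using c[OF that] J that by (auto simp: \<gamma>_def)
  have ode: "deriv (deriv f) z + (B z + H 1 z * exp (\<xi> 1 * z ^ n)) * f z = 0" for z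
    using assms(13)[of z] assms(8)[of z] by (simp add: \<xi>_def)
  obtain \<tau> C where \<tau>: "0 \<le> \<tau>" "\<tau> < real n"
    and zeros: "\<forall>\<^sub>F r in at_top. real (card {a. f a = 0 \<and> norm a \<le> r}) \<le> C * r powr \<tau>"
    using zero_exponent_less_imp_count[OF f w less] .
  define p where "p = (\<lambda>z. \<xi> 1 * z ^ n)"
  let ?h = "\<lambda>z. H 1 z * exp (p z)"
  have defect: "wkb_defect f ?h z = 0" if "f z \<noteq> 0" "H 1 z \<noteq> 0" for z
    unfolding p_def
  proof (rule wkb_defect_vanishes[OF n \<xi>1(1) \<gamma> H[OF J(2)] holB _ f ode \<tau> zeros that])
    fix \<epsilon> :: real assume "\<epsilon> > 0"
    then show "\<forall>\<^sub>F r in at_top. \<forall>y. norm y \<le> r + (norm z + 1) \<longrightarrow>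
      norm (B y) \<le> exp (\<gamma> * max 0 (Re (\<xi> 1 * y ^ n)) + \<epsilon> * r ^ n)"
      unfolding B using J(1) by (intro exponential_sum_bound_positive_multiples[where c = c, OF n _ H c\<gamma>]) auto
  qed
  obtain b where b: "f b \<noteq> 0" "H 1 b \<noteq> 0"
    using exists_common_nonzero[OF f holH1 w] nz[OF J(2) \<xi>1(1)] by blast
  have "open ({z. f z \<noteq> 0} \<inter> {z. H 1 z \<noteq> 0})"
    using f holH1 by (intro open_Int open_Collect_neq continuous_on_const holomorphic_on_imp_continuous_on)
  then obtain e where e: "e > 0" "ball b e \<subseteq> {z. f z \<noteq> 0} \<inter> {z. H 1 z \<noteq> 0}"
    using b open_contains_ball by blast
  have holp: "p holomorphic_on UNIV" unfolding p_def by (intro holomorphic_intros)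
  have sub_hol: "g holomorphic_on ball b e" if "g holomorphic_on UNIV" for g :: "complex \<Rightarrow> complex"
    using that by (rule holomorphic_on_subset) simp
  have "\<exists>k. \<forall>z\<in>ball b e. shifted_potential B ?h z = k * ?h z"
  proof (rule wkb_defect_zero_imp_potential_multiple[of f b e ?h B])
    show "f holomorphic_on ball b e" "?h holomorphic_on ball b e" "B holomorphic_on ball b e"
      by (intro holomorphic_intros sub_hol f holH1 holB holp)+
    show "deriv (deriv f) z + (B z + ?h z) * f z = 0" for z using ode by (simp add: p_def)
    show "f z \<noteq> 0" if "z \<in> ball b e" for z using e(2) that by blast
    show "?h z \<noteq> 0" if "z \<in> ball b e" for z using e(2) that by auto
    show "wkb_defect f ?h z = 0" if "z \<in> ball b e" for z using e(2) that by (intro defect) blast+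
  qed
  then obtain k where k: "\<And>z. z \<in> ball b e \<Longrightarrow> shifted_potential B ?h z = k * ?h z" by blast
  define \<kappa> where "\<kappa> = potential_numerator p (H 1)"
  have mt_p: "minimal_type n p" unfolding p_def by (intro minimal_type_intros n)
  have mt_L: "minimal_type n (twisted_deriv p (H 1))"
    unfolding twisted_deriv_def[abs_def] by (intro minimal_type_intros mt_p H J)
  have mt_\<kappa>: "minimal_type n \<kappa>"
    unfolding \<kappa>_def potential_numerator_def[abs_def] divide_inverse by (intro minimal_type_intros mt_L H J)
  \<comment> \<open>Multiplying \<open>\<beta> = k h\<close> by the square of \<open>H 1\<close>
    gives a relation between entire functions, which extends from the disc to the plane.\<close>
  have local: "(H 1 z)\<^sup>2 * B z + \<kappa> z - k * (H 1 z) ^ 3 * exp (p z) = 0" if z: "z \<in> ball b e" for z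
  proof -
    have H1: "H 1 z \<noteq> 0" using z e by blast
    have "B z + \<kappa> z / (H 1 z)\<^sup>2 = k * ?h z"
      unfolding \<kappa>_def k[OF z, symmetric]
      by (rule shifted_potential_twisted[symmetric, OF open_ball z])
        (use e in \<open>blast intro: sub_hol holp holH1\<close>)+
    then have "(H 1 z)\<^sup>2 * (B z + \<kappa> z / (H 1 z)\<^sup>2) = (H 1 z)\<^sup>2 * (k * ?h z)" by simp
    moreover have "(H 1 z)\<^sup>2 * (B z + \<kappa> z / (H 1 z)\<^sup>2) = (H 1 z)\<^sup>2 * B z + \<kappa> z"
      using H1 by (simp add: distrib_left)
    ultimately have "(H 1 z)\<^sup>2 * B z + \<kappa> z = (H 1 z)\<^sup>2 * (k * ?h z)" by metis
    then show ?thesis by (simp add: power2_eq_square power3_eq_cube mult.assoc mult.left_commute)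
  qed
  have global: "(H 1 z)\<^sup>2 * B z + \<kappa> z - k * (H 1 z) ^ 3 * exp (p z) = 0" for z
  proof (rule analytic_continuation_open[of "ball b e" UNIV "\<lambda>z. (H 1 z)\<^sup>2 * B z + \<kappa> z - k * (H 1 z) ^ 3 * exp (p z)" "\<lambda>_. 0"])
    show "ball b e \<noteq> {}" using e by simp
    show "(\<lambda>z. (H 1 z)\<^sup>2 * B z + \<kappa> z - k * (H 1 z) ^ 3 * exp (p z)) holomorphic_on UNIV"
      by (intro holomorphic_intros holH1 holB holp minimal_type_holomorphic[OF mt_\<kappa>])
  qed (use local in auto)
  \<comment> \<open>The identity as an exponential sum with the original exponents:
    \<open>\<kappa>\<close> is of minimal type and joins the term with exponent \<open>0\<close>,
    while the multiple of \<open>h\<close> takes the place of index \<open>1\<close>, which is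
    absent from \<open>B\<close>.\<close>
  define T where "T = (\<lambda>j. if j = 1 then (\<lambda>z. - k * (H 1 z) ^ 3) else if j = 0 then (\<lambda>z. (H 1 z)\<^sup>2 * H 0 z + \<kappa> z)
     else (\<lambda>z. (H 1 z)\<^sup>2 * H j z))"
  have T: "minimal_type n (T j)" if "j \<in> J" for j
    unfolding T_def using that J(2) by (auto intro!: minimal_type_intros mt_\<kappa> H)
  have TJ: "(\<Sum>j\<in>J - {1}. T j z * exp (\<xi> j * z ^ n)) = (H 1 z)\<^sup>2 * B z + \<kappa> z" for z
  proof -
    have J0: "0 \<in> J - {1}" by (simp add: J_def)
    have "(\<Sum>j\<in>J - {1} - {0}. T j z * exp (\<xi> j * z ^ n)) = (H 1 z)\<^sup>2 * (\<Sum>j\<in>J - {1} - {0}. H j z * exp (\<xi> j * z ^ n))"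
      unfolding sum_distrib_left by (intro sum.cong) (auto simp: T_def)
    moreover have split: "(\<Sum>j\<in>J - {1}. g j) = g 0 + (\<Sum>j\<in>J - {1} - {0}. g j)" for g :: "nat \<Rightarrow> complex"
      using J(1) J0 by (intro sum.remove) auto
    ultimately show ?thesis
      unfolding B split by (simp add: T_def \<xi>_def distrib_left)
  qed
  have zero: "minimal_type n (\<lambda>z. 0)" by (rule minimal_type_const)
  have T_nz: "\<exists>z. T j z \<noteq> 0" if j: "j \<in> J" "\<xi> j \<noteq> 0" "j \<noteq> 1 \<or> k \<noteq> 0" for j
  proof -
    have "H j holomorphic_on UNIV" using H[OF j(1)] by (rule minimal_type_holomorphic)
    then obtain z where "H 1 z \<noteq> 0" "H j z \<noteq> 0"
      using exists_common_nonzero[OF holH1] nz[OF J(2) \<xi>1(1)] nz[OF j(1,2)] by blast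
    moreover have "j \<noteq> 0" using j(2) unfolding \<xi>_def by metis
    ultimately show ?thesis using j(3) by (auto simp: T_def)
  qed
  \<comment> \<open>For \<open>k = 0\<close> the coefficient \<open>T 1\<close> vanishes, so index
    \<open>1\<close> is dropped and index \<open>2\<close>, present because
    \<open>m \<ge> 2\<close>, supplies the nonzero exponent. Otherwise index \<open>1\<close>
    does.\<close>
  show False
  proof (cases "k = 0")
    case True
    have "\<not> minimal_type n (\<lambda>z. \<Sum>j\<in>J - {1}. T j z * exp (\<xi> j * z ^ n))"
      using J T T_nz \<xi>1(2)
      by (intro exponential_sum_not_minimal_type[where k = 2] n inj_on_subset[OF inj]) auto
    moreover have "(\<lambda>z. \<Sum>j\<in>J - {1}. T j z * exp (\<xi> j * z ^ n)) = (\<lambda>z. 0)"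
      unfolding TJ using global True by auto
    ultimately show False using zero by simp
  next
    case False
    have "\<not> minimal_type n (\<lambda>z. \<Sum>j\<in>J. T j z * exp (\<xi> j * z ^ n))"
      using J T T_nz \<xi>1(1) False
      by (intro exponential_sum_not_minimal_type[where k = 1] n inj) auto
    moreover have "(\<Sum>j\<in>J. T j z * exp (\<xi> j * z ^ n)) = 0" for z
    proof -
      have "(\<Sum>j\<in>J. T j z * exp (\<xi> j * z ^ n)) = T 1 z * exp (\<xi> 1 * z ^ n) + (\<Sum>j\<in>J - {1}. T j z * exp (\<xi> j * z ^ n))"
        using J by (intro sum.remove) auto
      then show ?thesis unfolding TJ using global[of z] by (simp add: T_def p_def)
    qed
    ultimately show False using zero by simp
  qed
qed

end
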